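(* Let $n,N\ge 2$ be integers and let $1\le p<2$. Suppose $f\colon\mathbb{R}^{N\times n}\to\mathbb{R}$ is continuous, bounded below and $W^{1,p}$-quasiconvex, and suppose there is a constant $L>0$ such that $$f(\xi)\le L(1+|\xi|)\qquad\text{for all }\xi\in\mathbb{R}^{N\times n}\text{ with }\operatorname{rank}(\xi)\le 1.$$ Then there is a constant $L'>0$ (perhaps larger than $L$) such that $$f(\xi)\le L'(1+|\xi|)\qquad\text{for all }\xi\in\mathbb{R}^{N\times n},$$ and hence $f$ is $W^{1,1}$-quasiconvex.
   Context: $\mathbb{R}^{N\times n}$ is the space of real $N\times n$ matrices, $|\cdot|$ is any fixed norm on it (for example the Euclidean norm $|\xi|=(\sum_{i,j}\xi_{ij}^2)^{1/2}$), and $\mathscr{L}^n$ is Lebesgue measure on $\mathbb{R}^n$. Definition ($W^{1,p}$-quasiconvexity). Let $f\colon\mathbb{R}^{N\times n}\to\mathbb{R}\cup\{+\infty\}$ be Borel measurable and bounded below, and let $1\le p\le\infty$. $f$ is $W^{1,p}$-quasiconvex at $\xi\in\mathbb{R}^{N\times n}$ if for some nonempty bounded open set $\Omega\subset\mathbb{R}^n$ with $\mathscr{L}^n(\partial\Omega)=0$ one has $$\int_\Omega f(\xi+\nabla\phi(x))\,dx\ \ge\ \mathscr{L}^n(\Omega)\,f(\xi)\qquad\text{for all }\phi\in W^{1,p}_0(\Omega;\mathbb{R}^N).$$ $f$ is $W^{1,p}$-quasiconvex if this holds at every $\xi\in\mathbb{R}^{N\times n}$. (If the inequality holds for one such set $\Omega$,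 it holds for all bounded open sets $D\subset\mathbb{R}^n$ with $\mathscr{L}^n(\partial D)=0$.) *)

theory Defs
  imports "HOL-Analysis.Analysis"
begin

section \<open>Test functions\<close>

primrec times_differentiable ::
    "nat \<Rightarrow> ('a::euclidean_space \<Rightarrow> 'b::euclidean_space) \<Rightarrow> bool" where
  "times_differentiable 0 u \<longleftrightarrow> continuous_on UNIV u"
| "times_differentiable (Suc k) u \<longleftrightarrow>
     (\<forall>x. u differentiable (at x)) \<and>
     (\<forall>v. times_differentiable k (\<lambda>x. frechet_derivative u (at x) v))"

definition test_functions ::
    "'a::euclidean_space set \<Rightarrow> ('a \<Rightarrow> 'b::euclidean_space) set" where
  "test_functions \<Omega> =
     {u. (\<forall>k. times_differentiable k u) \<and>
         compact (closure {x. u x \<noteq> 0}) \<and> closure {x. u x \<noteq> 0} \<subseteq> \<Omega>}"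

section \<open>Sobolev spaces with zero boundary values\<close>

text \<open>
  Functions on \<open>\<Omega>\<close> are total functions whose values outside \<open>\<Omega>\<close> are irrelevant. Elements of
  the Lebesgue and Sobolev spaces are functions, not classes of functions modulo null sets.
  Only finite exponents \<open>p\<close> are covered, and the definitions are meant for \<open>p \<ge> 1\<close>.
\<close>

definition Lp_on ::
    "real \<Rightarrow> 'a::euclidean_space set \<Rightarrow> ('a \<Rightarrow> 'b::euclidean_space) set" where
  "Lp_on p \<Omega> =
     {u. u \<in> borel_measurable (lebesgue_on \<Omega>) \<and>
         integrable (lebesgue_on \<Omega>) (\<lambda>x. norm (u x) powr p)}"

definition locally_integrable_on ::
    "('a::euclidean_space \<Rightarrow> 'b::euclidean_space) \<Rightarrow> 'a set \<Rightarrow> bool" where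
  "locally_integrable_on u \<Omega> \<longleftrightarrow>
     u \<in> borel_measurable (lebesgue_on \<Omega>) \<and>
     (\<forall>K. compact K \<and> K \<subseteq> \<Omega> \<longrightarrow> integrable (lebesgue_on K) u)"

text \<open>
  As for \<^const>\<open>jacobian\<close>, the entry in row \<open>i\<close> and column \<open>j\<close> of the gradient is the \<open>j\<close>-th
  partial derivative of the \<open>i\<close>-th component.
\<close>

definition has_weak_gradient ::
    "(real^'n \<Rightarrow> real^'m) \<Rightarrow> (real^'n \<Rightarrow> real^'n^'m) \<Rightarrow> (real^'n) set \<Rightarrow> bool" where
  "has_weak_gradient u G \<Omega> \<longleftrightarrow>
     locally_integrable_on u \<Omega> \<and> locally_integrable_on G \<Omega> \<and>
     (\<forall>\<psi> \<in> (test_functions \<Omega> :: (real^'n \<Rightarrow> real) set). \<forall>i j.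
        (LINT x|lebesgue_on \<Omega>. u x $ i * frechet_derivative \<psi> (at x) (axis j 1)) =
        - (LINT x|lebesgue_on \<Omega>. G x $ i $ j * \<psi> x))"

definition W1p :: "real \<Rightarrow> (real^'n) set \<Rightarrow> (real^'n \<Rightarrow> real^'m) set" where
  "W1p p \<Omega> = {u \<in> Lp_on p \<Omega>. \<exists>G \<in> Lp_on p \<Omega>. has_weak_gradient u G \<Omega>}"

definition W1p_norm ::
    "real \<Rightarrow> (real^'n) set \<Rightarrow> (real^'n \<Rightarrow> real^'m) \<Rightarrow> (real^'n \<Rightarrow> real^'n^'m) \<Rightarrow> real" where
  "W1p_norm p \<Omega> u G =
     (LINT x|lebesgue_on \<Omega>. norm (u x) powr p + norm (G x) powr p) powr (1 / p)"

text \<open>The closure of the test functions in \<^const>\<open>W1p\<close>.\<close>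

definition W1p_0 :: "real \<Rightarrow> (real^'n) set \<Rightarrow> (real^'n \<Rightarrow> real^'m) set" where
  "W1p_0 p \<Omega> =
     {u \<in> W1p p \<Omega>. \<exists>G \<in> Lp_on p \<Omega>. has_weak_gradient u G \<Omega> \<and>
        (\<exists>\<psi> :: nat \<Rightarrow> real^'n \<Rightarrow> real^'m. (\<forall>k. \<psi> k \<in> test_functions \<Omega>) \<and>
           (\<lambda>k. W1p_norm p \<Omega> (\<lambda>x. \<psi> k x - u x) (\<lambda>x. jacobian (\<psi> k) (at x) - G x))
             \<longlonglongrightarrow> 0)}"

section \<open>Quasiconvexity\<close>

text \<open>
  Integral of an extended real valued function as positive part minus negative part
  (\<^const>\<open>e2ennreal\<close> maps negative values to 0). In the definition below the integrand is
  bounded below on a set of finite measure, so the negative part has finite integral and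
  the value, possibly \<open>\<infinity>\<close>, is the usual one.
\<close>

definition ereal_integral :: "'a measure \<Rightarrow> ('a \<Rightarrow> ereal) \<Rightarrow> ereal" where
  "ereal_integral M g =
     enn2ereal (\<integral>\<^sup>+ x. e2ennreal (g x) \<partial>M) - enn2ereal (\<integral>\<^sup>+ x. e2ennreal (- g x) \<partial>M)"

text \<open>
  The weak gradient \<open>G\<close> of \<open>\<phi>\<close> is determined up to a null set, so quantifying over all its
  representatives is harmless.
\<close>

definition W1p_quasiconvex_at ::
    "real \<Rightarrow> (real^'n^'m \<Rightarrow> ereal) \<Rightarrow> real^'n^'m \<Rightarrow> bool" where
  "W1p_quasiconvex_at p f \<xi> \<longleftrightarrow>
     (\<exists>\<Omega> :: (real^'n) set.
        \<Omega> \<noteq> {} \<and> bounded \<Omega> \<and> open \<Omega> \<and> frontier \<Omega> \<in> null_sets lebesgue \<and>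
        (\<forall>\<phi> \<in> (W1p_0 p \<Omega> :: (real^'n \<Rightarrow> real^'m) set). \<forall>G. has_weak_gradient \<phi> G \<Omega> \<longrightarrow>
           ereal_integral (lebesgue_on \<Omega>) (\<lambda>x. f (\<xi> + G x)) \<ge> ereal (measure lebesgue \<Omega>) * f \<xi>))"

definition W1p_quasiconvex :: "real \<Rightarrow> (real^'n^'m \<Rightarrow> ereal) \<Rightarrow> bool" where
  "W1p_quasiconvex p f \<longleftrightarrow>
     f \<in> borel_measurable borel \<and> (\<exists>c::real. \<forall>\<xi>. ereal c \<le> f \<xi>) \<and>
     (\<forall>\<xi>. W1p_quasiconvex_at p f \<xi>)"

section \<open>Arbitrary norms\<close>

definition is_norm :: "('a::real_vector \<Rightarrow> real) \<Rightarrow> bool" where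
  "is_norm \<nu> \<longleftrightarrow>
     (\<forall>x. \<nu> x \<ge> 0) \<and> (\<forall>x. \<nu> x = 0 \<longleftrightarrow> x = 0) \<and>
     (\<forall>a x. \<nu> (a *\<^sub>R x) = \<bar>a\<bar> * \<nu> x) \<and> (\<forall>x y. \<nu> (x + y) \<le> \<nu> x + \<nu> y)"

end

theory Submission
  imports Defs
begin

text \<open>
  Write a matrix as a sum of multiples of elementary matrices and let \<open>\<xi> = Z + P + Q\<close> with
  \<open>P\<close>, \<open>Q\<close> two of the summands. By induction on the number of summands, \<open>f\<close> grows linearly
  on \<open>Z + tP\<close> and on \<open>Z + tQ\<close>. Laminating alternately in the directions \<open>P\<close> and \<open>Q\<close>
  moves \<open>Z + 2\<^sup>r P + 2\<^sup>r Q\<close> with probability nearly one quarter to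
  \<open>Z + 2\<^sup>r\<^sup>+\<^sup>1 P + 2\<^sup>r\<^sup>+\<^sup>1 Q\<close> and otherwise to matrices where \<open>f\<close> is
  already controlled. Iterating this for ever on smaller and smaller open sets gives smooth
  functions whose gradients are bounded in \<open>L\<^sup>p\<close> because \<open>2\<^sup>p / 4 < 1\<close>, so they converge in
  \<open>W\<^sup>1\<^sup>,\<^sup>p\<close>, and testing quasiconvexity at the limit bounds \<open>f \<xi>\<close>. At each stage the
  transition layers have bounded gradient and measure as small as we wish, so that
  no growth of \<open>f\<close> on them is needed.

  Once \<open>f\<close> grows linearly, the integral of \<open>f (\<xi> + \<nabla>\<phi>)\<close> is continuous under \<open>W\<^sup>1\<^sup>,\<^sup>1\<close>
  convergence by Fatou's lemma, and quasiconvexity passes from test functions to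
  \<open>W\<^sup>1\<^sup>,\<^sup>1\<close>.
\<close>

section \<open>Smooth functions\<close>

text \<open>The staircase cannot be stopped after finitely many steps. On the last set the gradient
  would take the value \<open>X k\<close>, about which nothing is known yet, and a small measure
  does not compensate for an unknown growth of \<open>f\<close>. Hence the passage to a limit, whose
  gradient is in general unbounded: this is where an inequality for all of \<open>W1p_0 p\<close>,
  not just for smooth functions, is used.

  At level k the measure is about 2^(-k), while the gradient is about 2^(k/2), as each coefficient
  doubles at every second step. The p-th powers of the gradients are summable exactly when p < 2;
  first powers are then summable too, and these control \<open>f\<close> at the matrices left
  behind. A smooth zigzag does not split a set exactly in halves; the strict inequality p < 2 leaves
  room for a ratio \<mu> slightly above 1/2.

  A lamination works on any bounded open set, so it can begin on whichever \<Omega> the definition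
  supplies and continue on whatever set the previous one leaves.

  The bound for two directions is proportional to the growth constant on the two lines, with a
  factor that depends on p only. This is why the induction preserves linear growth.\<close>

lemma times_differentiable_SucI:
  assumes "\<And>x. (u has_derivative u' x) (at x)" "\<And>v. times_differentiable k (\<lambda>x. u' x v)"
  shows "times_differentiable (Suc k) u"
proof -
  have "frechet_derivative u (at x) = u' x" for x
    using frechet_derivative_at[OF assms(1)] by simp
  then show ?thesis
    using assms by (auto simp: differentiable_def)
qed

lemma times_differentiable_SucD:
  assumes "times_differentiable (Suc k) u"
  shows "(u has_derivative frechet_derivative u (at x)) (at x)"
    and "times_differentiable k (\<lambda>x. frechet_derivative u (at x) v)"
  using assms by (auto simp: frechet_derivative_works)

lemma times_differentiable_Suc_imp:
  "times_differentiable (Suc k) u \<Longrightarrow> times_differentiable k u"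
proof (induction k arbitrary: u)
  case 0
  then show ?case
    by (auto intro!: continuous_at_imp_continuous_on differentiable_imp_continuous_within)
next
  case (Suc k)
  then show ?case by auto
qed

lemma times_differentiable_const: "times_differentiable k (\<lambda>_. c)"
proof (induction k arbitrary: c)
  case (Suc k)
  show ?case by (rule times_differentiable_SucI[OF has_derivative_const]) (rule Suc)
qed simp

lemma times_differentiable_linear:
  assumes "bounded_linear l" shows "times_differentiable k l"
proof (cases k)
  case 0
  then show ?thesis using assms by (simp add: linear_continuous_on)
next
  case (Suc j)
  then show ?thesis
    using times_differentiable_SucI[OF bounded_linear_imp_has_derivative[OF assms], of j]
    by (simp add: times_differentiable_const)
qed

lemma times_differentiable_compose_linear:
  assumes "bounded_linear l" "times_differentiable k u"
  shows "times_differentiable k (\<lambda>x. l (u x))"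
  using assms(2)
proof (induction k arbitrary: u)
  case 0
  then show ?case
    using continuous_on_compose2[OF linear_continuous_on[OF assms(1)]] by auto
next
  case (Suc k)
  show ?case
    by (rule times_differentiable_SucI[OF bounded_linear.has_derivative[OF assms(1)
          times_differentiable_SucD(1)[OF Suc.prems]]])
       (rule Suc.IH[OF times_differentiable_SucD(2)[OF Suc.prems]])
qed

lemma times_differentiable_add:
  assumes "times_differentiable k u" "times_differentiable k v"
  shows "times_differentiable k (\<lambda>x. u x + v x)"
  using assms
proof (induction k arbitrary: u v)
  case 0
  then show ?case by (auto intro: continuous_intros)
next
  case (Suc k)
  show ?case
    by (rule times_differentiable_SucI[OF has_derivative_add[OF
          times_differentiable_SucD(1)[OF Suc.prems(1)] times_differentiable_SucD(1)[OF Suc.prems(2)]]])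
       (rule Suc.IH[OF times_differentiable_SucD(2)[OF Suc.prems(1)] times_differentiable_SucD(2)[OF Suc.prems(2)]])
qed

lemma times_differentiable_sum:
  assumes "\<And>i. i \<in> I \<Longrightarrow> times_differentiable k (u i)"
  shows "times_differentiable k (\<lambda>x. \<Sum>i\<in>I. u i x)"
  using assms
  by (induction I rule: infinite_finite_induct)
     (auto intro: times_differentiable_const times_differentiable_add)

lemma times_differentiable_mult:
  fixes u v :: "'a::euclidean_space \<Rightarrow> real"
  assumes "times_differentiable k u" "times_differentiable k v"
  shows "times_differentiable k (\<lambda>x. u x * v x)"
  using assms
proof (induction k arbitrary: u v)
  case 0
  then show ?case by (auto intro: continuous_intros)
next
  case (Suc k)
  show ?case
    by (rule times_differentiable_SucI[OF has_derivative_mult[OF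
          times_differentiable_SucD(1)[OF Suc.prems(1)] times_differentiable_SucD(1)[OF Suc.prems(2)]]])
       (intro times_differentiable_add Suc.IH times_differentiable_Suc_imp[OF Suc.prems(1)]
          times_differentiable_Suc_imp[OF Suc.prems(2)] times_differentiable_SucD(2)[OF Suc.prems(1)] times_differentiable_SucD(2)[OF Suc.prems(2)])
qed

lemma times_differentiable_compose:
  fixes g :: "real \<Rightarrow> real" and u :: "'a::euclidean_space \<Rightarrow> real"
  assumes "times_differentiable k g" "times_differentiable k u"
  shows "times_differentiable k (\<lambda>x. g (u x))"
  using assms
proof (induction k arbitrary: g u)
  case 0
  then show ?case by (auto intro: continuous_on_compose2[where f = u])
next
  case (Suc k)
  \<comment> \<open>On the real line a derivative is multiplication by its value at 1. This turns
    the chain rule into a product, and the induction hypothesis applies to the scalar function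
    \<open>\<lambda>y. frechet_derivative g (at y) 1\<close> composed with \<open>u\<close>.\<close>
  have lin: "frechet_derivative g (at y) h = h * frechet_derivative g (at y) 1" for y h
    using linear_scale[OF has_derivative_linear[OF times_differentiable_SucD(1)[OF Suc.prems(1)]], of y h 1]
    by simp
  have "((\<lambda>x. g (u x)) has_derivative
      (\<lambda>v. frechet_derivative u (at x) v * frechet_derivative g (at (u x)) 1)) (at x)" for x
    using has_derivative_compose[OF times_differentiable_SucD(1)[OF Suc.prems(2)]
        times_differentiable_SucD(1)[OF Suc.prems(1)], of x]
    by (subst (asm) lin)
  then show ?case
    by (rule times_differentiable_SucI)
       (intro times_differentiable_mult Suc.IH[where g = "\<lambda>y. frechet_derivative g (at y) 1"]
         times_differentiable_SucD(2)[OF Suc.prems(1)] times_differentiable_SucD(2)[OF Suc.prems(2)]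
         times_differentiable_Suc_imp[OF Suc.prems(2)])
qed

section \<open>Smooth functions of one real variable\<close>

lemma times_differentiable_real_SucI:
  fixes u :: "real \<Rightarrow> real"
  assumes "\<And>x. (u has_real_derivative u' x) (at x)" "times_differentiable k u'"
  shows "times_differentiable (Suc k) u"
proof (rule times_differentiable_SucI)
  show "(u has_derivative (\<lambda>v. u' x * v)) (at x)" for x
    using assms(1)[of x] by (simp add: has_field_derivative_def)
  show "times_differentiable k (\<lambda>x. u' x * v)" for v
    by (intro times_differentiable_mult assms(2) times_differentiable_const)
qed

lemma times_differentiable_real_I:
  fixes u :: "real \<Rightarrow> real"
  assumes "\<And>x. (u has_real_derivative u' x) (at x)" "\<And>k. times_differentiable k u'"
  shows "times_differentiable k u"
  by (rule times_differentiable_Suc_imp[OF times_differentiable_real_SucI[OF assms]])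

lemma times_differentiable_sin: "times_differentiable k (sin :: real \<Rightarrow> real)"
proof -
  have "times_differentiable k (sin :: real \<Rightarrow> real) \<and> times_differentiable k (cos :: real \<Rightarrow> real)"
  proof (induction k)
    case 0
    show ?case by (simp add: continuous_on_sin continuous_on_cos)
  next
    case (Suc k)
    have "times_differentiable k (\<lambda>x. (-1) * sin x :: real)"
      by (intro times_differentiable_mult times_differentiable_const Suc[THEN conjunct1])
    then show ?case
      using Suc by (auto intro!: times_differentiable_real_SucI[OF DERIV_sin]
          times_differentiable_real_SucI[OF DERIV_cos] simp del: times_differentiable.simps)
  qed
  then show ?thesis by blast
qed

text \<open>The function exp(-1/t), flat at 0, together with the powers of 1/t that differentiation
  produces. The family over \<open>n\<close> is closed under derivatives up to linear combinations,
  as an induction on the order of differentiability requires.\<close>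

definition exp_pole :: "nat \<Rightarrow> real \<Rightarrow> real" where
  "exp_pole n t = (if t > 0 then (1 / t) ^ n * exp (- (1 / t)) else 0)"

lemma exp_pole_tendsto_0: "(exp_pole n \<longlongrightarrow> 0) (at 0)"
proof -
  have "((\<lambda>t::real. (1 / t) ^ n * exp (- (1 / t))) \<longlongrightarrow> 0) (at_right 0)"
  proof -
    have "((\<lambda>x::real. x ^ n / exp x) \<longlongrightarrow> 0) at_top" by (rule tendsto_power_div_exp_0)
    from filterlim_compose[OF this filterlim_inverse_at_top_right]
    show ?thesis by (simp add: exp_minus field_simps)
  qed
  then have "(exp_pole n \<longlongrightarrow> 0) (at_right 0)"
    by (rule tendsto_cong[THEN iffD1, rotated])
       (auto simp: exp_pole_def eventually_at_filter)
  moreover have "(exp_pole n \<longlongrightarrow> 0) (at_left 0)"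
    by (rule tendsto_cong[THEN iffD1, OF _ tendsto_const])
       (auto simp: exp_pole_def eventually_at_filter)
  ultimately show ?thesis by (simp add: filterlim_split_at)
qed

text \<open>Away from 0 this is the product rule or the zero function. At 0 the difference quotient
  of \<open>exp_pole n\<close> is \<open>exp_pole (Suc n)\<close>, which tends to 0, so the same
  formula persists.\<close>

lemma DERIV_exp_pole:
  "(exp_pole n has_real_derivative exp_pole (n + 2) t - real n * exp_pole (n + 1) t) (at t)"
proof -
  consider "t > 0" | "t < 0" | "t = 0" by linarith
  then show ?thesis
  proof cases
    case 1
    have "((\<lambda>t. (1 / t) ^ n) has_real_derivative - real n * (1 / t) ^ (n + 1)) (at t)"
    proof -
      have "((\<lambda>t. 1 / t) has_real_derivative - ((1 / t) ^ 2)) (at t)"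
        using 1 by (auto intro!: derivative_eq_intros simp: power2_eq_square field_simps)
      from DERIV_power[OF this, of n] show ?thesis
        by (rule DERIV_cong)
          (cases n; simp add: power2_eq_square left_diff_distrib distrib_right diff_divide_distrib add_divide_distrib)
    qed
    moreover have "((\<lambda>t. exp (- (1 / t))) has_real_derivative exp (- (1 / t)) * (1 / t) ^ 2) (at t)"
      using 1 by (auto intro!: derivative_eq_intros simp: power2_eq_square field_simps)
    ultimately have "((\<lambda>t. (1 / t) ^ n * exp (- (1 / t))) has_real_derivative
        - real n * (1 / t) ^ (n + 1) * exp (- (1 / t)) + exp (- (1 / t)) * (1 / t) ^ 2 * (1 / t) ^ n) (at t)"
      by (rule DERIV_mult)
    moreover have "- real n * (1 / t) ^ (n + 1) * exp (- (1 / t)) + exp (- (1 / t)) * (1 / t) ^ 2 * (1 / t) ^ n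
      = exp_pole (n + 2) t - real n * exp_pole (n + 1) t"
      using 1 by (simp add: exp_pole_def power_add power2_eq_square) (simp add: field_simps)
    ultimately have "((\<lambda>t. (1 / t) ^ n * exp (- (1 / t))) has_real_derivative
        exp_pole (n + 2) t - real n * exp_pole (n + 1) t) (at t)"
      by simp
    then show ?thesis
      by (rule DERIV_cong_ev[THEN iffD1, rotated 3, OF _ ])
        (use 1 in \<open>auto simp: exp_pole_def intro!: eventually_mono[OF eventually_nhds_in_open[of "{0<..}" t]]\<close>)
  next
    case 2
    have "((\<lambda>t. 0) has_real_derivative exp_pole (n + 2) t - real n * exp_pole (n + 1) t) (at t)"
      using 2 by (simp add: exp_pole_def)
    then show ?thesis
      by (rule DERIV_cong_ev[THEN iffD1, rotated 3, OF _ ])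
        (use 2 in \<open>auto simp: exp_pole_def intro!: eventually_mono[OF eventually_nhds_in_open[of "{..<0}" t]]\<close>)
  next
    case 3
    have "((\<lambda>h. exp_pole n h / h) \<longlongrightarrow> 0) (at 0)"
      by (rule tendsto_cong[THEN iffD1, OF _ exp_pole_tendsto_0[of "Suc n"]])
         (auto simp: exp_pole_def eventually_at_filter)
    then show ?thesis
      using 3 by (simp add: DERIV_def exp_pole_def)
  qed
qed

lemma times_differentiable_exp_pole: "times_differentiable k (exp_pole n)"
proof (induction k arbitrary: n)
  case 0
  show ?case using DERIV_exp_pole by (auto intro!: continuous_at_imp_continuous_on DERIV_isCont)
next
  case (Suc k)
  have "times_differentiable k (\<lambda>t. exp_pole (n + 2) t + (- real n) * exp_pole (n + 1) t)"
    by (intro times_differentiable_add times_differentiable_mult times_differentiable_const Suc)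
  then show ?case
    using times_differentiable_real_SucI[OF DERIV_exp_pole] by simp
qed

lemma continuous_has_antiderivative:
  fixes f :: "real \<Rightarrow> real"
  assumes "continuous_on UNIV f"
  obtains F where "\<And>x. (F has_real_derivative f x) (at x)"
  using einterval_antiderivative[of "-\<infinity>" "\<infinity>" f] assms
  by (auto simp: continuous_on_eq_continuous_at has_real_derivative_iff_has_vector_derivative)

text \<open>A normalised primitive of an even bump that lives on [-1, 1]. Evenness of the bump makes
  the primitive odd up to a constant, and oddness is what later makes the zigzag periodic.\<close>

lemma smooth_odd_sign:
  obtains g :: "real \<Rightarrow> real" where
    "\<And>k. times_differentiable k g" "\<And>y. g (- y) = - g y" "\<And>y. y \<ge> 1 \<Longrightarrow> g y = 1"
    "\<And>y. y \<le> -1 \<Longrightarrow> g y = -1" "\<And>y. \<bar>g y\<bar> \<le> 1"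
proof -
  define b where "b y = exp_pole 0 (1 + y) * exp_pole 0 (1 + (-1) * y)" for y :: real
  have lin: "times_differentiable k (\<lambda>y::real. 1 + c * y)" for k c
    by (intro times_differentiable_add times_differentiable_const times_differentiable_linear
        bounded_linear_mult_right)
  have b: "times_differentiable k b" for k
    using lin[of k 1] lin[of k "-1"] unfolding b_def
    by (intro times_differentiable_mult times_differentiable_compose[OF times_differentiable_exp_pole]) auto
  obtain F where F: "\<And>x. (F has_real_derivative b x) (at x)"
    using continuous_has_antiderivative[of b] b[of 0] by auto
  have sF: "times_differentiable k F" for k
    by (rule times_differentiable_real_I[OF F b])
  have b0: "b y \<ge> 0" for y by (simp add: b_def exp_pole_def)
  have mono: "F x \<le> F y" if "x \<le> y" for x y
    by (rule DERIV_nonneg_imp_nondecreasing[OF that]) (use F b0 in blast)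
  have up: "F y = F 1" if "y \<ge> 1" for y
    by (rule order.antisym[OF _ mono[OF that]],
       rule DERIV_nonpos_imp_nonincreasing[OF that], use F in \<open>force simp: b_def exp_pole_def\<close>)
  have down: "F y = F (-1)" if "y \<le> -1" for y
    by (rule order.antisym[OF mono[OF that]],
       rule DERIV_nonpos_imp_nonincreasing[OF that], use F in \<open>force simp: b_def exp_pole_def\<close>)
  have sym: "F y + F (- y) = F 1 + F (- 1)" for y
  proof -
    have "((\<lambda>y. F y + F (- y)) has_real_derivative 0) (at x)" for x
      using DERIV_add[OF F[of x] DERIV_mirror[THEN iffD1, OF F[of "- x"]]] by (simp add: b_def)
    from DERIV_isconst_all[of _ y 1, OF allI, OF this] show ?thesis by simp
  qed
  have lt: "F (-1) < F 1"
    by (rule DERIV_pos_imp_increasing_open[of "-1" 1 F])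
      (use F in \<open>force simp: b_def exp_pole_def intro!: mult_pos_pos continuous_at_imp_continuous_on DERIV_isCont\<close>)+
  define d where "d = (F 1 - F (-1)) / 2"
  have d: "d > 0" using lt by (simp add: d_def)
  define g where "g y = (1 / d) * (F y + (- (F 1 + F (-1)) / 2))" for y
  show thesis
  proof
    show "times_differentiable k g" for k unfolding g_def
      by (intro times_differentiable_mult times_differentiable_add times_differentiable_const sF)
    show "g (- y) = - g y" for y
    proof -
      have "F (- y) + (- (F 1 + F (-1)) / 2) = - (F y + (- (F 1 + F (-1)) / 2))"
        using sym[of y] by (simp add: field_simps)
      then show ?thesis unfolding g_def by (metis mult_minus_right)
    qed
    show "g y = 1" if "y \<ge> 1" for y
      unfolding g_def up[OF that] using d by (simp add: d_def field_simps)
    show "g y = -1" if "y \<le> -1" for y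
      unfolding g_def down[OF that] using d by (simp add: d_def field_simps)
    show "\<bar>g y\<bar> \<le> 1" for y
    proof -
      have "F (-1) \<le> F y" "F y \<le> F 1"
        using mono[of y 1] mono[of "-1" y] up[of y] down[of y] mono[of "-1" 1] by linarith+
      then have "\<bar>F y + (- (F 1 + F (-1)) / 2)\<bar> \<le> d" unfolding d_def abs_le_iff by (simp add: field_simps)
      then show ?thesis using d by (simp add: g_def abs_mult field_simps)
    qed
  qed
qed

text \<open>A primitive of \<open>g (sin t / \<tau>)\<close>, rescaled by \<kappa>. The slope
  differs from 1 and -1 only where the sine is smaller than \<tau>, while the height is controlled
  by \<kappa> alone, so \<tau> may be chosen after \<kappa>. The factor 7 stands for 2 pi, the
  length of a period on which the slope is at most 1.\<close>

lemma smooth_zigzag: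
  fixes \<kappa> \<tau> :: real
  assumes "\<kappa> > 0" "\<tau> > 0"
  obtains h h' :: "real \<Rightarrow> real" where
    "\<And>k. times_differentiable k h" "\<And>t. (h has_real_derivative h' t) (at t)"
    "\<And>t. \<bar>h t\<bar> \<le> 7 * \<kappa>" "\<And>t. \<bar>h' t\<bar> \<le> 1"
    "\<And>t. sin (t / \<kappa>) \<ge> \<tau> \<Longrightarrow> h' t = 1" "\<And>t. sin (t / \<kappa>) \<le> - \<tau> \<Longrightarrow> h' t = -1"
proof -
  obtain g :: "real \<Rightarrow> real" where g:
    "\<And>k. times_differentiable k g" "\<And>y. g (- y) = - g y" "\<And>y. y \<ge> 1 \<Longrightarrow> g y = 1"
    "\<And>y. y \<le> -1 \<Longrightarrow> g y = -1" "\<And>y. \<bar>g y\<bar> \<le> 1"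
    using smooth_odd_sign by metis
  define w' where "w' t = g ((1 / \<tau>) * sin t)" for t
  have sw': "times_differentiable k w'" for k
    unfolding w'_def
    by (rule times_differentiable_compose[OF g(1)])
       (intro times_differentiable_mult times_differentiable_const times_differentiable_sin)
  obtain w where w: "\<And>x. (w has_real_derivative w' x) (at x)"
    using continuous_has_antiderivative[of w'] sw'[of 0] by auto
  have sw: "times_differentiable k w" for k
    by (rule times_differentiable_real_I[OF w sw'])
  \<comment> \<open>Oddness of \<open>g\<close> makes the primitive even, hence periodic and bounded independently of \<open>\<tau>\<close>.\<close>
  have even: "w (- t) = w t" for t
  proof -
    have "((\<lambda>y. w y - w (- y)) has_real_derivative 0) (at x)" for x
      using DERIV_diff[OF w[of x] DERIV_mirror[THEN iffD1, OF w[of "- x"]]] by (simp add: w'_def g(2))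
    from DERIV_isconst_all[of _ t 0, OF allI, OF this] show ?thesis by simp
  qed
  have per: "w (t + 2 * pi) = w t" for t
  proof -
    have "((\<lambda>y. w (y + 2 * pi) - w y) has_real_derivative 0) (at x)" for x
      using w[of x] w[of "x + 2 * pi"] by (auto intro!: derivative_eq_intros simp: w'_def DERIV_shift)
    from DERIV_isconst_all[of _ t "- pi", OF allI, OF this] show ?thesis using even[of pi] by simp
  qed
  interpret periodic_fun_simple w "2 * pi" by standard (rule per)
  have bound: "\<bar>w t - w 0\<bar> \<le> 7" for t
  proof -
    define n where "n = \<lfloor>t / (2 * pi)\<rfloor>"
    define r where "r = t - of_int n * (2 * pi)"
    have "of_int n \<le> t / (2 * pi)" "t / (2 * pi) < of_int n + 1" unfolding n_def by linarith+
    then have r: "0 \<le> r" "r \<le> 2 * pi" unfolding r_def by (simp_all add: field_simps)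
    have "norm (w r - w 0) \<le> 1 * norm (r - 0)"
      by (rule field_differentiable_bound[of UNIV w w'])
         (use w g(5) in \<open>auto simp: w'_def\<close>)
    moreover have "w t = w r" unfolding r_def by (simp add: minus_of_int)
    moreover have "pi < 3.5" using pi_approx by simp
    ultimately show ?thesis using r by simp
  qed
  define h where "h t = \<kappa> * (w ((1 / \<kappa>) * t) + - w 0)" for t
  show thesis
  proof
    show "times_differentiable k h" for k unfolding h_def
      by (intro times_differentiable_mult times_differentiable_const times_differentiable_add
          times_differentiable_compose[OF sw] times_differentiable_linear bounded_linear_mult_right
          bounded_linear_ident)
    show "(h has_real_derivative w' (t / \<kappa>)) (at t)" for t
      unfolding h_def using assms(1) by (auto intro!: derivative_eq_intros DERIV_chain2[OF w])
    show "\<bar>h t\<bar> \<le> 7 * \<kappa>" for t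
      using bound assms(1) by (simp add: h_def abs_mult)
    show "\<bar>w' (t / \<kappa>)\<bar> \<le> 1" for t by (simp add: w'_def g)
    show "w' (t / \<kappa>) = 1" if "sin (t / \<kappa>) \<ge> \<tau>" for t
      using that assms unfolding w'_def by (intro g) (simp add: field_simps)
    show "w' (t / \<kappa>) = -1" if "sin (t / \<kappa>) \<le> - \<tau>" for t
      using that assms unfolding w'_def by (intro g) (simp add: field_simps)
  qed
qed

text \<open>Finitely many balls cover \<open>K\<close>; bumps on them are added and squashed by a
  smooth step. That \<eta> is 1 on an open set \<open>W\<close>, and not merely on \<open>K\<close>,
  makes its derivative vanish there.\<close>

lemma smooth_cutoff:
  fixes K U :: "'a::euclidean_space set"
  assumes "compact K" "open U" "K \<subseteq> U"
  obtains \<eta> :: "'a \<Rightarrow> real" and W where "\<eta> \<in> test_functions U" "\<And>x. 0 \<le> \<eta> x" "\<And>x. \<eta> x \<le> 1"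
    "open W" "K \<subseteq> W" "W \<subseteq> U" "\<And>x. x \<in> W \<Longrightarrow> \<eta> x = 1"
proof -
  obtain g :: "real \<Rightarrow> real" where g:
    "\<And>k. times_differentiable k g" "\<And>y. g (- y) = - g y" "\<And>y. y \<ge> 1 \<Longrightarrow> g y = 1"
    "\<And>y. y \<le> -1 \<Longrightarrow> g y = -1" "\<And>y. \<bar>g y\<bar> \<le> 1"
    using smooth_odd_sign by metis
  define S where "S y = (1 / 2) * (1 + g y)" for y
  have S: "times_differentiable k S" for k
    unfolding S_def by (intro times_differentiable_mult times_differentiable_add times_differentiable_const g)
  have S01: "0 \<le> S y" "S y \<le> 1" for y
    using g(5)[of y] by (auto simp: S_def abs_le_iff)
  have S1: "y \<ge> 1 \<Longrightarrow> S y = 1" and S0: "y \<le> -1 \<Longrightarrow> S y = 0" for y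
    using g(3,4)[of y] by (auto simp: S_def)
  have "\<exists>r>0. cball x (2 * r) \<subseteq> U" if x: "x \<in> K" for x
  proof -
    obtain e where "e > 0" "cball x e \<subseteq> U"
      using assms(2,3) x open_contains_cball_eq[of U] by blast
    then show ?thesis by (intro exI[of _ "e / 2"]) simp
  qed
  then obtain r where r: "\<And>x. x \<in> K \<Longrightarrow> r x > 0" "\<And>x. x \<in> K \<Longrightarrow> cball x (2 * r x) \<subseteq> U"
    by metis
  have "K \<subseteq> (\<Union>x\<in>K. ball x (r x))" using r(1) by force
  then obtain F where F: "F \<subseteq> K" "finite F" "K \<subseteq> (\<Union>x\<in>F. ball x (r x))"
    using compactE_image[OF assms(1), of K "\<lambda>x. ball x (r x)"] by auto
  \<comment> \<open>The squared distance is expanded in coordinates, which exhibits \<beta> as a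
    composition of smooth maps. The argument of \<open>S\<close> is at least 1 for distances up to
    \<open>r z\<close> and at most -5 from \<open>2 * r z\<close> on.\<close>
  define \<beta> where "\<beta> z x = S (3 + (- 2 / (r z)\<^sup>2) * (\<Sum>b\<in>Basis. (x \<bullet> b + - (z \<bullet> b)) * (x \<bullet> b + - (z \<bullet> b))))" for z x
  have sq: "(\<Sum>b\<in>Basis. (x \<bullet> b + - (z \<bullet> b)) * (x \<bullet> b + - (z \<bullet> b))) = (dist z x)\<^sup>2" for z x
  proof -
    have "(dist z x)\<^sup>2 = (x - z) \<bullet> (x - z)"
      by (simp add: dist_norm norm_minus_commute power2_norm_eq_inner)
    also have "\<dots> = (\<Sum>b\<in>Basis. ((x - z) \<bullet> b) * ((x - z) \<bullet> b))" by (rule euclidean_inner)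
    finally show ?thesis by (simp add: inner_diff_left)
  qed
  have s\<beta>: "times_differentiable k (\<beta> z)" for k z
    unfolding \<beta>_def
    by (intro times_differentiable_compose[OF S] times_differentiable_add times_differentiable_mult
        times_differentiable_const times_differentiable_sum times_differentiable_linear bounded_linear_inner_left)
  have \<beta>0: "\<beta> z x \<ge> 0" for z x by (simp add: \<beta>_def S01)
  have \<beta>1: "\<beta> z x = 1" if "z \<in> F" "x \<in> ball z (r z)" for z x
  proof -
    have "r z > 0" using r F that by auto
    moreover have "(dist z x)\<^sup>2 \<le> (r z)\<^sup>2" using that by (intro power_mono) auto
    ultimately show ?thesis unfolding \<beta>_def sq by (intro S1) (simp add: field_simps)
  qed
  have \<beta>2: "\<beta> z x = 0" if "z \<in> F" "x \<notin> cball z (2 * r z)" for z x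
  proof -
    have "r z > 0" using r F that by auto
    moreover have "(2 * r z)\<^sup>2 \<le> (dist z x)\<^sup>2" using that \<open>r z > 0\<close> by (intro power_mono) auto
    ultimately show ?thesis unfolding \<beta>_def sq
      by (intro S0) (simp add: field_simps, use zero_le_power2[of "r z"] in linarith)
  qed
  \<comment> \<open>Outside all bumps the argument is -1, where \<open>S\<close> vanishes; where
    some bump equals 1 the argument is at least 1.\<close>
  define \<eta> where "\<eta> x = S (-1 + 2 * (\<Sum>z\<in>F. \<beta> z x))" for x
  define W where "W = (\<Union>z\<in>F. ball z (r z))"
  have supp: "{x. \<eta> x \<noteq> 0} \<subseteq> (\<Union>z\<in>F. cball z (2 * r z))"
  proof
    fix x assume "x \<in> {x. \<eta> x \<noteq> 0}"
    then have "(\<Sum>z\<in>F. \<beta> z x) \<noteq> 0" using S0[of "-1"] by (auto simp: \<eta>_def)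
    then obtain z where "z \<in> F" "\<beta> z x \<noteq> 0" by (rule sum.not_neutral_contains_not_neutral)
    then show "x \<in> (\<Union>z\<in>F. cball z (2 * r z))" using \<beta>2 by blast
  qed
  have comp: "compact (\<Union>z\<in>F. cball z (2 * r z))" using F by auto
  show thesis
  proof
    show "\<eta> \<in> test_functions U"
    proof -
      have "closure {x. \<eta> x \<noteq> 0} \<subseteq> (\<Union>z\<in>F. cball z (2 * r z))"
        using closure_minimal[OF supp compact_imp_closed[OF comp]] .
      moreover have "(\<Union>z\<in>F. cball z (2 * r z)) \<subseteq> U" using r F by blast
      moreover have "times_differentiable k \<eta>" for k unfolding \<eta>_def
        by (intro times_differentiable_compose[OF S] times_differentiable_add times_differentiable_mult
          times_differentiable_const times_differentiable_sum s\<beta>)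
      moreover have "compact (closure {x. \<eta> x \<noteq> 0})"
        by (simp add: compact_closure) (rule bounded_subset[OF compact_imp_bounded[OF comp] supp])
      ultimately show ?thesis unfolding test_functions_def by blast
    qed
    show "0 \<le> \<eta> x" "\<eta> x \<le> 1" for x by (simp_all add: \<eta>_def S01)
    show "open W" "K \<subseteq> W" using F by (auto simp: W_def)
    show "W \<subseteq> U" unfolding W_def
    proof safe
      fix z x assume *: "z \<in> F" "x \<in> ball z (r z)"
      then have "x \<in> cball z (2 * r z)" using r(1)[of z] F by auto
      then show "x \<in> U" using r(2)[of z] F * by blast
    qed
    show "\<eta> x = 1" if x: "x \<in> W" for x
    proof -
      obtain z where z: "z \<in> F" "x \<in> ball z (r z)" using x by (auto simp: W_def)
      have "\<beta> z x \<le> (\<Sum>z\<in>F. \<beta> z x)" by (rule member_le_sum) (use z F \<beta>0 in auto)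
      then show ?thesis using \<beta>1[OF z] unfolding \<eta>_def by (intro S1) simp
    qed
  qed
qed

section \<open>Test functions\<close>

lemma has_derivative_zero_outside_support:
  assumes "x \<notin> closure {x. u x \<noteq> 0}"
  shows "(u has_derivative (\<lambda>_. 0)) (at x)"
proof (rule has_derivative_transform_within_open[where f = "\<lambda>_. 0" and s = "- closure {x. u x \<noteq> 0}"])
  show "\<And>y. y \<in> - closure {x. u x \<noteq> 0} \<Longrightarrow> 0 = u y"
    using closure_subset[of "{x. u x \<noteq> 0}"] by auto
qed (use assms in auto)

section \<open>Integrals of functions with compact support\<close>

lemma compact_support_bounded:
  assumes "continuous_on UNIV w" "compact K" "\<And>x. x \<notin> K \<Longrightarrow> w x = 0"
  obtains B where "B > 0" "\<And>x. norm (w x) \<le> B"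
proof -
  have "bounded (w ` K)"
    using assms compact_continuous_image[of K w] compact_imp_bounded continuous_on_subset by blast
  then obtain B where "B > 0" "\<And>x. x \<in> K \<Longrightarrow> norm (w x) \<le> B"
    by (auto simp: bounded_pos)
  then show ?thesis using assms(3) by (intro that[of B]) (metis norm_zero order_less_imp_le)+
qed

lemma integrable_lebesgue_on_if:
  fixes w :: "'a::euclidean_space \<Rightarrow> 'b::euclidean_space"
  assumes "integrable lebesgue w" "S \<in> sets lebesgue"
  shows "integrable (lebesgue_on S) w"
  using assms by (simp add: integrable_restrict_space integrable_mult_indicator)

lemma compact_support_integrable:
  fixes w :: "'a::euclidean_space \<Rightarrow> 'b::euclidean_space"
  assumes "continuous_on UNIV w" "compact K" "\<And>x. x \<notin> K \<Longrightarrow> w x = 0" "S \<in> sets lebesgue"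
  shows "integrable (lebesgue_on S) w"
proof (rule integrable_lebesgue_on_if[OF _ assms(4)])
  have "integrable lborel (\<lambda>x. indicator K x *\<^sub>R w x)"
    by (intro borel_integrable_compact assms continuous_on_subset[OF assms(1)]) auto
  also have "(\<lambda>x. indicator K x *\<^sub>R w x) = w" using assms(3) by (auto simp: indicator_def)
  finally show "integrable lebesgue w"
    by (subst integrable_completion) (auto intro: borel_measurable_continuous_onI assms)
qed

lemma integral_lebesgue_on_support:
  fixes w :: "'a::euclidean_space \<Rightarrow> 'b::euclidean_space"
  assumes "S \<in> sets lebesgue" "\<And>x. x \<notin> S \<Longrightarrow> w x = 0"
  shows "(LINT x|lebesgue_on S. w x) = (LINT x|lebesgue. w x)"
proof -
  have "(\<lambda>x. if x \<in> S then w x else 0) = w" using assms by auto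
  then show ?thesis using Lebesgue_Measure.integral_restrict_UNIV[OF assms(1), of w] by simp
qed

text \<open>The difference quotients of \<open>v\<close> along \<open>e\<close> have integral 0 by
  translation invariance of Lebesgue measure, and dominated convergence carries this over to the
  derivative.\<close>

lemma integral_directional_derivative_eq_0:
  fixes v :: "'a::euclidean_space \<Rightarrow> real"
  assumes v: "times_differentiable (Suc 0) v" and supp: "compact (closure {x. v x \<noteq> 0})"
  shows "(LINT x|lebesgue. frechet_derivative v (at x) e) = 0"
proof -
  let ?K = "closure {x. v x \<noteq> 0}"
  define D where "D x = frechet_derivative v (at x) e" for x
  have der: "(v has_derivative frechet_derivative v (at x)) (at x)" for x
    by (rule times_differentiable_SucD(1)[OF v])
  have cD: "continuous_on UNIV D"
    using v by (simp add: D_def)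
  have cv: "continuous_on UNIV v"
    using times_differentiable_Suc_imp[OF v] by simp
  have D0: "D x = 0" if "x \<notin> ?K" for x
    using fun_cong[OF frechet_derivative_at[OF has_derivative_zero_outside_support[OF that]], of e]
    by (simp add: D_def)
  have v0: "v x = 0" if "x \<notin> ?K" for x
    using that closure_subset[of "{x. v x \<noteq> 0}"] by auto
  obtain M where M: "M > 0" "\<And>x. norm (D x) \<le> M"
    using compact_support_bounded[OF cD supp D0] by blast
  obtain R where R: "\<And>x. x \<in> ?K \<Longrightarrow> norm x \<le> R"
    using compact_imp_bounded[OF supp] by (auto simp: bounded_iff)
  have line: "((\<lambda>t. v (x + t *\<^sub>R e)) has_real_derivative D (x + t *\<^sub>R e)) (at t)" for x t
  proof -
    have "((\<lambda>t. v (x + t *\<^sub>R e)) has_derivative (\<lambda>h. frechet_derivative v (at (x + t *\<^sub>R e)) (h *\<^sub>R e))) (at t)"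
      by (rule has_derivative_compose[OF _ der]) (auto intro!: derivative_eq_intros)
    moreover have "(\<lambda>h. frechet_derivative v (at (x + t *\<^sub>R e)) (h *\<^sub>R e)) = (*) (D (x + t *\<^sub>R e))"
      by (auto simp: D_def linear_scale[OF has_derivative_linear[OF der]])
    ultimately show ?thesis by (simp add: has_field_derivative_def)
  qed
  define t where "t n = inverse (real (Suc n))" for n
  define s where "s n x = (v (x + t n *\<^sub>R e) - v x) / t n" for n x
  have t: "0 < t n" "t n \<le> 1" for n by (auto simp: t_def field_simps)
  have mv: "v \<in> borel_measurable borel" using cv by (rule borel_measurable_continuous_onI)
  then have [measurable]: "v \<in> borel_measurable lborel" by simp
  have [measurable]: "D \<in> borel_measurable lborel"
    using cD by (simp add: borel_measurable_continuous_onI)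
  have ms[measurable]: "s n \<in> borel_measurable lborel" for n
    unfolding s_def using measurable_compose[OF _ mv, of "\<lambda>x. x + t n *\<^sub>R e" borel] by simp
  have iv: "integrable lborel v"
    using compact_support_integrable[OF cv supp v0, of UNIV]
    by (simp add: lebesgue_on_UNIV_eq integrable_completion mv)
  have shift: "integrable lborel (\<lambda>x. v (x + c))" "(LINT x|lborel. v (x + c)) = (LINT x|lborel. v x)" for c
  proof -
    have "integrable (distr lborel borel ((+) c)) v" using iv by (simp add: lborel_distr_plus)
    then show "integrable lborel (\<lambda>x. v (x + c))"
      by (subst (asm) integrable_distr_eq) (auto simp: mv add.commute)
    have "(LINT x|distr lborel borel ((+) c). v x) = (LINT x|lborel. v (c + x))"
      by (rule integral_distr) (auto simp: mv)
    then show "(LINT x|lborel. v (x + c)) = (LINT x|lborel. v x)" by (simp add: lborel_distr_plus add.commute)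
  qed
  \<comment> \<open>Since \<open>t n \<le> 1\<close>, all difference quotients vanish outside the
    ball of radius \<open>R + norm e\<close>; inside, the mean value inequality bounds them by
    \<open>M\<close>.\<close>
  have "(\<lambda>n. LINT x|lborel. s n x) \<longlonglongrightarrow> (LINT x|lborel. D x)"
  proof (rule integral_dominated_convergence[where w = "\<lambda>x. indicator (cball 0 (R + norm e)) x *\<^sub>R M"])
    show "integrable lborel (\<lambda>x. indicator (cball 0 (R + norm e)) x *\<^sub>R M)"
      by (intro borel_integrable_compact) auto
    show "AE x in lborel. (\<lambda>n. s n x) \<longlonglongrightarrow> D x"
    proof (rule AE_I2)
      fix x
      have "((\<lambda>h. (v (x + h *\<^sub>R e) - v x) / h) \<longlongrightarrow> D x) (at 0)"
        using line[of x 0] by (simp add: DERIV_def)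
      moreover have "filterlim t (at 0) sequentially"
        unfolding filterlim_at t_def using LIMSEQ_inverse_real_of_nat by auto
      ultimately show "(\<lambda>n. s n x) \<longlonglongrightarrow> D x"
        unfolding s_def by (rule filterlim_compose)
    qed
    show "AE x in lborel. norm (s n x) \<le> indicator (cball 0 (R + norm e)) x *\<^sub>R M" for n
    proof (rule AE_I2)
      fix x
      show "norm (s n x) \<le> indicator (cball 0 (R + norm e)) x *\<^sub>R M"
      proof (cases "x \<in> cball 0 (R + norm e)")
        case True
        have "norm (v (x + t n *\<^sub>R e) - v (x + 0 *\<^sub>R e)) \<le> M * norm (t n - 0)"
          by (rule field_differentiable_bound[of UNIV _ "\<lambda>t. D (x + t *\<^sub>R e)"]) (use line M in auto)
        then show ?thesis using True t[of n] by (simp add: s_def field_simps)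
      next
        case False
        then have x: "norm x > R + norm e" by simp
        have "norm (x + t n *\<^sub>R e) \<ge> norm x - t n * norm e"
          using norm_diff_ineq[of x "t n *\<^sub>R e"] t[of n] by simp
        moreover have "t n * norm e \<le> norm e"
          using t[of n] mult_right_mono[of "t n" 1 "norm e"] by simp
        ultimately have "v (x + t n *\<^sub>R e) = 0" "v x = 0"
          using R x norm_ge_zero[of e] by (smt (verit) v0)+
        then show ?thesis using M(1) by (simp add: s_def)
      qed
    qed
  qed auto
  moreover have "(LINT x|lborel. s n x) = 0" for n
    unfolding s_def using shift iv by simp
  ultimately have "(LINT x|lborel. D x) = 0"
    using LIMSEQ_unique[OF _ tendsto_const] by auto
  then show ?thesis
    unfolding D_def[symmetric] by (subst integral_completion) auto
qed

lemma open_sets_lebesgue: "open S \<Longrightarrow> S \<in> sets lebesgue"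
  using borel_open[of S] by (metis sets_completionI_sets sets_lborel)

lemma test_functionsD:
  assumes "u \<in> test_functions \<Omega>"
  shows "times_differentiable k u" "compact (closure {x. u x \<noteq> 0})" "closure {x. u x \<noteq> 0} \<subseteq> \<Omega>"
  using assms by (simp_all add: test_functions_def del: times_differentiable.simps)

lemma test_functions_derivative:
  assumes "u \<in> test_functions \<Omega>"
  shows "(u has_derivative frechet_derivative u (at x)) (at x)"
  by (rule times_differentiable_SucD(1)[OF test_functionsD(1)[OF assms]])

lemma test_functions_continuous:
  assumes "u \<in> test_functions \<Omega>" shows "continuous_on UNIV u"
  using test_functionsD(1)[OF assms, of 0] by simp

lemma test_functions_zero_outside:
  assumes "u \<in> test_functions \<Omega>" "x \<notin> closure {x. u x \<noteq> 0}"
  shows "u x = 0" "frechet_derivative u (at x) v = 0"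
  using fun_cong[OF frechet_derivative_at[OF has_derivative_zero_outside_support[OF assms(2)]], of v]
    assms(2) closure_subset[of "{x. u x \<noteq> 0}"] by auto

lemma test_functions_continuous_derivative:
  assumes "u \<in> test_functions \<Omega>" shows "continuous_on UNIV (\<lambda>x. frechet_derivative u (at x) v)"
  using test_functionsD(1)[OF assms, of "Suc 0"] by simp

lemma jacobian_zero_outside_support:
  fixes u :: "real^'n \<Rightarrow> real^'m"
  assumes "u \<in> test_functions \<Omega>" "x \<notin> closure {x. u x \<noteq> 0}"
  shows "jacobian u (at x) = 0"
  using test_functions_zero_outside(2)[OF assms] by (simp add: jacobian_def matrix_def vec_eq_iff)

lemma jacobian_continuous:
  fixes u :: "real^'n \<Rightarrow> real^'m"
  assumes "u \<in> test_functions \<Omega>"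
  shows "continuous_on UNIV (\<lambda>x. jacobian u (at x))"
  unfolding jacobian_def matrix_def
  by (intro continuous_on_vec_lambda continuous_on_component test_functions_continuous_derivative[OF assms])

section \<open>Sums and linear images of test functions\<close>

lemma test_functions_mono: "u \<in> test_functions U \<Longrightarrow> U \<subseteq> V \<Longrightarrow> u \<in> test_functions V"
  by (auto simp: test_functions_def)

lemma test_functions_subset_support:
  assumes "\<And>k. times_differentiable k u" "compact K" "K \<subseteq> \<Omega>" "\<And>x. x \<notin> K \<Longrightarrow> u x = 0"
  shows "u \<in> test_functions \<Omega>"
proof -
  have sub: "{x. u x \<noteq> 0} \<subseteq> K" using assms(4) by blast
  have "closure {x. u x \<noteq> 0} \<subseteq> K"
    using closure_minimal[OF sub compact_imp_closed[OF assms(2)]] .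
  moreover have "compact (closure {x. u x \<noteq> 0})"
    unfolding compact_closure by (rule bounded_subset[OF compact_imp_bounded[OF assms(2)] sub])
  ultimately show ?thesis
    using assms(1,3) unfolding test_functions_def by blast
qed

lemma test_functions_add:
  assumes "u \<in> test_functions \<Omega>" "v \<in> test_functions \<Omega>"
  shows "(\<lambda>x. u x + v x) \<in> test_functions \<Omega>"
proof (rule test_functions_subset_support[of _ "closure {x. u x \<noteq> 0} \<union> closure {x. v x \<noteq> 0}"])
  show "times_differentiable k (\<lambda>x. u x + v x)" for k
    by (intro times_differentiable_add test_functionsD(1)[OF assms(1)] test_functionsD(1)[OF assms(2)])
  show "u x + v x = 0" if "x \<notin> closure {x. u x \<noteq> 0} \<union> closure {x. v x \<noteq> 0}" for x
    using that test_functions_zero_outside(1)[OF assms(1), of x] test_functions_zero_outside(1)[OF assms(2), of x]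
    by simp
qed (use test_functionsD(2,3)[OF assms(1)] test_functionsD(2,3)[OF assms(2)] in \<open>simp_all add: compact_Un\<close>)

lemma test_functions_sum:
  assumes "\<And>i. i \<in> I \<Longrightarrow> u i \<in> test_functions \<Omega>"
  shows "(\<lambda>x. \<Sum>i\<in>I. u i x) \<in> test_functions \<Omega>"
  using assms
proof (induction I rule: infinite_finite_induct)
  case (insert i I)
  then show ?case using test_functions_add[of "u i" \<Omega>] by simp
qed (auto intro!: test_functions_subset_support[of _ "{}"] times_differentiable_const)

lemma test_functions_linear:
  assumes "bounded_linear l" "u \<in> test_functions \<Omega>"
  shows "(\<lambda>x. l (u x)) \<in> test_functions \<Omega>"
proof (rule test_functions_subset_support[of _ "closure {x. u x \<noteq> 0}"])
  show "times_differentiable k (\<lambda>x. l (u x))" for k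
    by (rule times_differentiable_compose_linear[OF assms(1) test_functionsD(1)[OF assms(2)]])
  show "l (u x) = 0" if "x \<notin> closure {x. u x \<noteq> 0}" for x
    using test_functions_zero_outside(1)[OF assms(2) that] linear_simps(3)[OF assms(1)] by simp
qed (use test_functionsD(2,3)[OF assms(2)] in simp_all)

lemma jacobian_add:
  fixes u v :: "real^'n \<Rightarrow> real^'m"
  assumes "u \<in> test_functions \<Omega>" "v \<in> test_functions \<Omega>"
  shows "jacobian (\<lambda>x. u x + v x) (at x) = jacobian u (at x) + jacobian v (at x)"
  using fun_cong[OF frechet_derivative_at[OF has_derivative_add[OF test_functions_derivative[OF assms(1)]
        test_functions_derivative[OF assms(2)]], of x], symmetric]
  by (simp add: jacobian_def matrix_def vec_eq_iff)

lemma jacobian_sum: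
  fixes u :: "'i \<Rightarrow> real^'n \<Rightarrow> real^'m"
  assumes "\<And>i. i \<in> I \<Longrightarrow> u i \<in> test_functions \<Omega>"
  shows "jacobian (\<lambda>x. \<Sum>i\<in>I. u i x) (at x) = (\<Sum>i\<in>I. jacobian (u i) (at x))"
  using assms
proof (induction I rule: infinite_finite_induct)
  case (insert i I)
  then show ?case using jacobian_add[of "u i" \<Omega> "\<lambda>x. \<Sum>i\<in>I. u i x" x] test_functions_sum[of I u \<Omega>] by simp
qed (simp_all add: jacobian_def matrix_def vec_eq_iff)

lemma test_functions_integrable:
  assumes "u \<in> test_functions \<Omega>" "S \<in> sets lebesgue"
  shows "integrable (lebesgue_on S) u"
  by (rule compact_support_integrable[OF test_functions_continuous[OF assms(1)] test_functionsD(2)[OF assms(1)]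
        test_functions_zero_outside(1)[OF assms(1)] assms(2)])

lemma jacobian_integrable:
  fixes u :: "real^'n \<Rightarrow> real^'m"
  assumes "u \<in> test_functions \<Omega>" "S \<in> sets lebesgue"
  shows "integrable (lebesgue_on S) (\<lambda>x. jacobian u (at x))"
  by (rule compact_support_integrable[OF jacobian_continuous[OF assms(1)] test_functionsD(2)[OF assms(1)]
        jacobian_zero_outside_support[OF assms(1)] assms(2)])

text \<open>The product of a component of \<open>u\<close> with \<psi> is a test function on
  \<Omega>, so its partial derivatives have integral 0, and the product rule becomes integration by
  parts. The support of \<open>u\<close> may lie in any \<open>V\<close>, as \<psi> already cuts off
  the product.\<close>

lemma test_functions_weak_gradient:
  fixes u :: "real^'n \<Rightarrow> real^'m"
  assumes u: "u \<in> test_functions V" and \<Omega>: "open \<Omega>"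
  shows "has_weak_gradient u (\<lambda>x. jacobian u (at x)) \<Omega>"
proof -
  have L: "\<Omega> \<in> sets lebesgue" using \<Omega> by (rule open_sets_lebesgue)
  have "locally_integrable_on u \<Omega>" "locally_integrable_on (\<lambda>x. jacobian u (at x)) \<Omega>"
    unfolding locally_integrable_on_def
    using test_functions_integrable[OF u] jacobian_integrable[OF u] L
      borel_measurable_integrable[OF test_functions_integrable[OF u L]]
      borel_measurable_integrable[OF jacobian_integrable[OF u L]]
    by (simp_all add: fmeasurableD lmeasurable_compact)
  moreover have "(LINT x|lebesgue_on \<Omega>. u x $ i * frechet_derivative \<psi> (at x) (axis j 1)) =
      - (LINT x|lebesgue_on \<Omega>. jacobian u (at x) $ i $ j * \<psi> x)"
    if \<psi>: "\<psi> \<in> test_functions \<Omega>" for \<psi> :: "real^'n \<Rightarrow> real" and i j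
  proof -
    let ?K = "closure {x. \<psi> x \<noteq> 0}"
    have K: "compact ?K" "?K \<subseteq> \<Omega>" by (fact test_functionsD[OF \<psi>])+
    have \<psi>0: "c * \<psi> x = 0" "c * frechet_derivative \<psi> (at x) e = 0" if "x \<notin> ?K" for c x e
      using test_functions_zero_outside[OF \<psi> that] by simp_all
    have cu: "continuous_on UNIV (\<lambda>x. u x $ i)"
      by (intro continuous_on_component test_functions_continuous[OF u])
    have cJ: "continuous_on UNIV (\<lambda>x. jacobian u (at x) $ i $ j)"
      by (intro continuous_on_component jacobian_continuous[OF u])
    have I1: "integrable (lebesgue_on \<Omega>) (\<lambda>x. u x $ i * frechet_derivative \<psi> (at x) (axis j 1))"
      by (intro compact_support_integrable[OF _ K(1) _ L] continuous_on_mult cu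
          test_functions_continuous_derivative[OF \<psi>]) (rule \<psi>0)
    have I2: "integrable (lebesgue_on \<Omega>) (\<lambda>x. jacobian u (at x) $ i $ j * \<psi> x)"
      by (intro compact_support_integrable[OF _ K(1) _ L] continuous_on_mult cJ
          test_functions_continuous[OF \<psi>]) (rule \<psi>0)
    define v where "v x = u x $ i * \<psi> x" for x
    have sv: "times_differentiable k v" for k
      unfolding v_def
      by (rule times_differentiable_mult[OF times_differentiable_compose_linear[OF bounded_linear_vec_nth
          test_functionsD(1)[OF u]] test_functionsD(1)[OF \<psi>]])
    have dv: "frechet_derivative v (at x) (axis j 1) =
        u x $ i * frechet_derivative \<psi> (at x) (axis j 1) + jacobian u (at x) $ i $ j * \<psi> x" for x
    proof -
      have "((\<lambda>x. u x $ i) has_derivative (\<lambda>h. frechet_derivative u (at x) h $ i)) (at x)"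
        using bounded_linear.has_derivative[OF bounded_linear_vec_nth test_functions_derivative[OF u]] .
      from has_derivative_mult[OF this test_functions_derivative[OF \<psi>]]
      have "frechet_derivative v (at x) = (\<lambda>h. u x $ i * frechet_derivative \<psi> (at x) h + frechet_derivative u (at x) h $ i * \<psi> x)"
        unfolding v_def by (rule frechet_derivative_at[symmetric])
      then show ?thesis by (simp add: jacobian_def matrix_def)
    qed
    have "v \<in> test_functions \<Omega>"
      by (rule test_functions_subset_support[OF sv K]) (unfold v_def, rule \<psi>0(1))
    then have "compact (closure {x. v x \<noteq> 0})" by (rule test_functionsD)
    then have "0 = (LINT x|lebesgue. frechet_derivative v (at x) (axis j 1))"
      using integral_directional_derivative_eq_0[OF sv] by simp
    also have "\<dots> = (LINT x|lebesgue_on \<Omega>. frechet_derivative v (at x) (axis j 1))"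
    proof (rule integral_lebesgue_on_support[OF L, symmetric])
      show "frechet_derivative v (at x) (axis j 1) = 0" if "x \<notin> \<Omega>" for x
      proof -
        have x: "x \<notin> ?K" using that K(2) by blast
        show ?thesis unfolding dv \<psi>0[OF x] by simp
      qed
    qed
    also have "\<dots> = (LINT x|lebesgue_on \<Omega>. u x $ i * frechet_derivative \<psi> (at x) (axis j 1))
        + (LINT x|lebesgue_on \<Omega>. jacobian u (at x) $ i $ j * \<psi> x)"
      unfolding dv by (rule Bochner_Integration.integral_add[OF I1 I2])
    finally show ?thesis by simp
  qed
  ultimately show ?thesis unfolding has_weak_gradient_def by blast
qed

lemma compact_support_Lp:
  assumes "continuous_on UNIV w" "compact K" "\<And>x. x \<notin> K \<Longrightarrow> w x = 0" "S \<in> sets lebesgue" "p > 0"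
  shows "w \<in> Lp_on p S"
proof -
  have "continuous_on UNIV (\<lambda>x. norm (w x) powr p)"
    using assms by (intro continuous_on_powr' continuous_intros) auto
  then have "integrable (lebesgue_on S) (\<lambda>x. norm (w x) powr p)"
    using assms by (intro compact_support_integrable[of _ K]) auto
  moreover have "integrable (lebesgue_on S) w"
    using assms by (intro compact_support_integrable[of _ K]) auto
  ultimately show ?thesis unfolding Lp_on_def by auto
qed

lemma test_functions_subset_W1p_0:
  fixes u :: "real^'n \<Rightarrow> real^'m"
  assumes u: "u \<in> test_functions \<Omega>" and "open \<Omega>" "p > 0"
  shows "u \<in> W1p_0 p \<Omega>"
proof -
  let ?K = "closure {x. u x \<noteq> 0}"
  have K: "compact ?K" by (rule test_functionsD[OF u])
  have L: "\<Omega> \<in> sets lebesgue" using assms(2) by (rule open_sets_lebesgue)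
  have 1: "u \<in> Lp_on p \<Omega>"
    using compact_support_Lp[OF test_functions_continuous[OF u] K _ L \<open>p > 0\<close>] test_functions_zero_outside(1)[OF u] by blast
  have 2: "(\<lambda>x. jacobian u (at x)) \<in> Lp_on p \<Omega>"
    using compact_support_Lp[OF jacobian_continuous[OF u] K _ L \<open>p > 0\<close>] jacobian_zero_outside_support[OF u] by blast
  have "(\<lambda>k::nat. W1p_norm p \<Omega> (\<lambda>x. u x - u x) (\<lambda>x. jacobian u (at x) - jacobian u (at x))) \<longlonglongrightarrow> 0"
    by (simp add: W1p_norm_def)
  with 1 2 test_functions_weak_gradient[OF u assms(2)] u show ?thesis
    unfolding W1p_0_def W1p_def mem_Collect_eq by (intro conjI bexI[of _ "\<lambda>x. jacobian u (at x)"] exI[of _ "\<lambda>_. u"]) auto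
qed

section \<open>A single lamination\<close>

lemma open_inner_compact:
  fixes U :: "'a::euclidean_space set"
  assumes "bounded U" "open U" "e > 0"
  obtains K where "compact K" "K \<subseteq> U" "measure lebesgue (U - K) < e"
proof -
  obtain T where T: "closed T" "T \<subseteq> U" "U - T \<in> lmeasurable" "emeasure lebesgue (U - T) < ennreal e"
    using sets_lebesgue_inner_closed[OF open_sets_lebesgue[OF assms(2)] assms(3)] by blast
  have "compact T" using T(1,2) assms(1) bounded_subset compact_eq_bounded_closed by blast
  moreover have "measure lebesgue (U - T) < e"
    using T(3,4) assms(3) by (simp add: emeasure_eq_measure2 ennreal_less_iff)
  ultimately show thesis using T(2) that by blast
qed

text \<open>As the threshold decreases, the slabs shrink to the zeros of the sine, a countable
  family of parallel hyperplanes and hence a null set. Continuity of the measure from above applies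
  because \<open>U\<close> has finite measure.\<close>

lemma measure_sine_slab_small:
  fixes U :: "(real^'n) set" and j :: 'n
  assumes "bounded U" "open U" "\<kappa> > 0" "e > 0"
  obtains \<tau> :: real where "\<tau> > 0" "measure lebesgue {x\<in>U. \<bar>sin (x $ j / \<kappa>)\<bar> \<le> \<tau>} < e"
    "{x\<in>U. \<bar>sin (x $ j / \<kappa>)\<bar> \<le> \<tau>} \<in> lmeasurable"
proof -
  define A where "A n = {x\<in>U. \<bar>sin (x $ j / \<kappa>)\<bar> \<le> inverse (real (Suc n))}" for n
  have cl: "closed {x::real^'n. \<bar>sin (x $ j / \<kappa>)\<bar> \<le> t}" for t
    using assms(3) by (intro closed_Collect_le continuous_intros) simp
  have m: "A n \<in> sets lebesgue" for n
  proof -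
    have "{x::real^'n. \<bar>sin (x $ j / \<kappa>)\<bar> \<le> inverse (real (Suc n))} \<in> sets lebesgue"
      using borel_closed[OF cl] by (metis sets_completionI_sets sets_lborel)
    from sets.Int[OF open_sets_lebesgue[OF assms(2)] this] show ?thesis
      by (simp add: A_def Collect_conj_eq)
  qed
  have U: "U \<in> lmeasurable" using assms by (simp add: lmeasurable_open)
  have lm: "A n \<in> lmeasurable" for n
    by (rule fmeasurableI2[OF U _ m]) (auto simp: A_def)
  have "(\<lambda>n. measure lebesgue (A n)) \<longlonglongrightarrow> measure lebesgue (\<Inter>n. A n)"
  proof (rule Lim_measure_decseq)
    show "range A \<subseteq> sets lebesgue" using m by auto
    show "decseq A" unfolding decseq_def A_def
    proof safe
      fix m n :: nat and x assume "m \<le> n" "\<bar>sin (x $ j / \<kappa>)\<bar> \<le> inverse (real (Suc n))"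
      moreover have "inverse (real (Suc n)) \<le> inverse (real (Suc m))" using \<open>m \<le> n\<close> by simp
      ultimately show "\<bar>sin (x $ j / \<kappa>)\<bar> \<le> inverse (real (Suc m))" by linarith
    qed
    show "emeasure lebesgue (A n) \<noteq> \<infinity>" for n using fmeasurableD2[OF lm[of n]] by simp
  qed
  moreover have "negligible (\<Inter>n. A n)"
  proof (rule negligible_subset)
    show "negligible (\<Union>i::int. {x::real^'n. axis j 1 \<bullet> x = \<kappa> * (of_int i * pi)})"
      by (rule negligible_countable_Union) (auto intro!: negligible_hyperplane simp: axis_eq_0_iff)
    show "(\<Inter>n. A n) \<subseteq> (\<Union>i::int. {x::real^'n. axis j 1 \<bullet> x = \<kappa> * (of_int i * pi)})"
    proof
      fix x assume x: "x \<in> (\<Inter>n. A n)"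
      have "\<bar>sin (x $ j / \<kappa>)\<bar> \<le> 0"
        by (rule LIMSEQ_le_const[OF LIMSEQ_inverse_real_of_nat]) (use x in \<open>auto simp: A_def\<close>)
      then have "sin (x $ j / \<kappa>) = 0" by simp
      then obtain i where "x $ j / \<kappa> = of_int i * pi" by (auto simp: sin_zero_iff_int2)
      then have "x $ j = \<kappa> * (of_int i * pi)" using assms(3) by (simp add: field_simps)
      then show "x \<in> (\<Union>i::int. {x::real^'n. axis j 1 \<bullet> x = \<kappa> * (of_int i * pi)})"
        by (auto simp: inner_axis')
    qed
  qed
  ultimately have "(\<lambda>n. measure lebesgue (A n)) \<longlonglongrightarrow> 0"
    by (simp add: negligible_imp_measure0)
  from order_tendstoD(2)[OF this assms(4)] obtain n where "measure lebesgue (A n) < e"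
    by (auto simp: eventually_sequentially)
  then show thesis using that[of "inverse (real (Suc n))"] lm[of n] by (simp add: A_def)
qed

text \<open>A zigzag in the \<open>j\<close>-th coordinate times a cutoff \<eta>. The set
  \<open>V\<close>, where the slope is 1, is open because the next lamination is to take place on
  it; \<open>B\<close> collects the boundary layer and the turning zones of the zigzag. The cutoff
  is chosen before the amplitude \<kappa>, and \<kappa> before the threshold \<tau>, as each choice
  depends on the previous one.\<close>

lemma lamination_step:
  fixes U :: "(real^'n) set" and j :: 'n
  assumes U: "bounded U" "open U" and lam: "1 / 2 < \<mu>" and \<delta>: "\<delta> > 0"
  obtains \<theta> :: "real^'n \<Rightarrow> real" and V B where
    "\<theta> \<in> test_functions U" "\<And>x. \<bar>\<theta> x\<bar> \<le> 1"
    "\<And>x v. \<bar>frechet_derivative \<theta> (at x) v\<bar> \<le> 2 * norm v"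
    "open V" "V \<subseteq> U" "measure lebesgue V \<le> \<mu> * measure lebesgue U"
    "\<And>x v. x \<in> V \<Longrightarrow> frechet_derivative \<theta> (at x) v = v $ j"
    "B \<in> lmeasurable" "B \<subseteq> U" "measure lebesgue B \<le> \<delta>"
    "\<And>x v. x \<in> U - V - B \<Longrightarrow> frechet_derivative \<theta> (at x) v = - (v $ j)"
proof -
  \<comment> \<open>Chosen with (1 + \<epsilon>) / (2 + \<epsilon>) \<le> \<mu>, the largest share
    of \<open>V\<close> that a derivative of mean zero permits if it is at least -1 - \<epsilon> off
    \<open>V\<close>. The cap at 1 gives the gradient bound 2.\<close>
  define \<epsilon> where "\<epsilon> = min 1 (2 * \<mu> - 1)"
  have \<epsilon>: "0 < \<epsilon>" "\<epsilon> \<le> 1" "1 + \<epsilon> \<le> 2 * \<mu>" using lam by (auto simp: \<epsilon>_def)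
  obtain K where K: "compact K" "K \<subseteq> U" "measure lebesgue (U - K) < \<delta> / 2"
    using open_inner_compact[OF U, of "\<delta> / 2"] \<delta> by auto
  obtain \<eta> :: "real^'n \<Rightarrow> real" and W where \<eta>: "\<eta> \<in> test_functions U" "\<And>x. 0 \<le> \<eta> x" "\<And>x. \<eta> x \<le> 1"
    and W: "open W" "K \<subseteq> W" "W \<subseteq> U" "\<And>x. x \<in> W \<Longrightarrow> \<eta> x = 1"
    using smooth_cutoff[OF K(1) U(2) K(2)] by metis
  let ?d\<eta> = "\<lambda>x. frechet_derivative \<eta> (at x)"
  have d\<eta>: "(\<eta> has_derivative ?d\<eta> x) (at x)" for x by (rule test_functions_derivative[OF \<eta>(1)])
  have "\<exists>B. \<forall>x. \<bar>?d\<eta> x b\<bar> \<le> B" for b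
    using compact_support_bounded[OF test_functions_continuous_derivative[OF \<eta>(1)] test_functionsD(2)[OF \<eta>(1)]
        test_functions_zero_outside(2)[OF \<eta>(1)], of b] by (metis real_norm_def)
  then obtain Bd where Bd: "\<And>b x. \<bar>?d\<eta> x b\<bar> \<le> Bd b" by metis
  define D where "D = (\<Sum>b\<in>Basis. Bd b) + 1"
  have Bd0: "0 \<le> Bd b" for b using Bd[of undefined b] by linarith
  then have D: "D > 0" by (simp add: D_def add_nonneg_pos sum_nonneg)
  have dD: "\<bar>?d\<eta> x v\<bar> \<le> D * norm v" for x v
  proof -
    have lin: "linear (?d\<eta> x)" using d\<eta> has_derivative_linear by blast
    have "?d\<eta> x v = (\<Sum>b\<in>Basis. (v \<bullet> b) * ?d\<eta> x b)"
      by (subst (1) euclidean_representation[of v, symmetric]) (simp add: linear_sum[OF lin] linear_scale[OF lin])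
    also have "\<bar>\<dots>\<bar> \<le> (\<Sum>b\<in>Basis. \<bar>(v \<bullet> b) * ?d\<eta> x b\<bar>)" by (rule sum_abs)
    also have "\<dots> \<le> (\<Sum>b\<in>Basis. norm v * Bd b)"
      by (intro sum_mono) (auto simp: abs_mult intro!: mult_mono Basis_le_norm Bd)
    also have "\<dots> = norm v * (\<Sum>b\<in>Basis. Bd b)" by (simp add: sum_distrib_left)
    also have "\<dots> \<le> D * norm v" by (simp add: D_def algebra_simps)
    finally show ?thesis .
  qed
  \<comment> \<open>The first bound keeps \<theta> below 1 in absolute value. The second makes the
    contribution of the derivative of \<eta> to that of \<theta>, which is at most \<open>D\<close>
    times the height \<open>7 * \<kappa>\<close>, at most \<epsilon>.\<close>
  define \<kappa> where "\<kappa> = min (1 / 7) (\<epsilon> / (7 * D))"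
  have \<kappa>: "\<kappa> > 0" "7 * \<kappa> \<le> 1" "7 * \<kappa> * D \<le> \<epsilon>"
  proof -
    show "\<kappa> > 0" "7 * \<kappa> \<le> 1" using \<epsilon> D by (auto simp: \<kappa>_def)
    have "\<kappa> \<le> \<epsilon> / (7 * D)" by (simp add: \<kappa>_def)
    then show "7 * \<kappa> * D \<le> \<epsilon>" using D by (simp add: field_simps)
  qed
  obtain \<tau> where \<tau>: "\<tau> > 0" and slab: "measure lebesgue {x\<in>U. \<bar>sin (x $ j / \<kappa>)\<bar> \<le> \<tau>} < \<delta> / 2"
    "{x\<in>U. \<bar>sin (x $ j / \<kappa>)\<bar> \<le> \<tau>} \<in> lmeasurable"
    using measure_sine_slab_small[OF U \<kappa>(1), of "\<delta> / 2" j] \<delta> by auto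
  obtain h h' :: "real \<Rightarrow> real" where h: "\<And>k. times_differentiable k h"
    "\<And>t. (h has_real_derivative h' t) (at t)" "\<And>t. \<bar>h t\<bar> \<le> 7 * \<kappa>" "\<And>t. \<bar>h' t\<bar> \<le> 1"
    "\<And>t. sin (t / \<kappa>) \<ge> \<tau> \<Longrightarrow> h' t = 1" "\<And>t. sin (t / \<kappa>) \<le> - \<tau> \<Longrightarrow> h' t = -1"
    using smooth_zigzag[OF \<kappa>(1) \<tau>] by blast
  define \<theta> where "\<theta> x = \<eta> x * h (x $ j)" for x
  have \<eta>0: "\<eta> x * c = 0" if "x \<notin> closure {x. \<eta> x \<noteq> 0}" for x c
    using test_functions_zero_outside(1)[OF \<eta>(1) that] by simp
  have s\<theta>: "times_differentiable k \<theta>" for k unfolding \<theta>_def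
    by (rule times_differentiable_mult[OF test_functionsD(1)[OF \<eta>(1)]
      times_differentiable_compose[OF h(1) times_differentiable_linear[OF bounded_linear_vec_nth]]])
  have t\<theta>: "\<theta> \<in> test_functions U"
    by (rule test_functions_subset_support[OF s\<theta> test_functionsD(2,3)[OF \<eta>(1)]]) (unfold \<theta>_def, rule \<eta>0)
  have der: "frechet_derivative \<theta> (at x) v = \<eta> x * (v $ j * h' (x $ j)) + ?d\<eta> x v * h (x $ j)" for x v
  proof -
    have "((\<lambda>x. h (x $ j)) has_derivative (\<lambda>v. v $ j * h' (x $ j))) (at x)"
    proof -
      have "((\<lambda>x. x $ j) has_derivative (\<lambda>v. v $ j)) (at x)"
        by (rule bounded_linear_imp_has_derivative[OF bounded_linear_vec_nth])
      from has_derivative_compose[OF this h(2)[unfolded has_field_derivative_def]]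
      show ?thesis by (simp add: mult.commute)
    qed
    from has_derivative_mult[OF d\<eta> this]
    have "frechet_derivative \<theta> (at x) = (\<lambda>v. \<eta> x * (v $ j * h' (x $ j)) + ?d\<eta> x v * h (x $ j))"
      unfolding \<theta>_def by (rule frechet_derivative_at[symmetric])
    then show ?thesis by simp
  qed
  have derW: "frechet_derivative \<theta> (at x) v = v $ j * h' (x $ j)" if x: "x \<in> W" for x v
  proof -
    have "(\<eta> has_derivative (\<lambda>_. 0)) (at x)"
      by (rule has_derivative_transform_within_open[OF has_derivative_const[of 1] W(1) x]) (simp add: W(4))
    then have "?d\<eta> x = (\<lambda>_. 0)" by (rule frechet_derivative_at[symmetric])
    then show ?thesis using W(4)[OF x] by (simp add: der)
  qed
  have hd: "\<bar>?d\<eta> x v * h (x $ j)\<bar> \<le> \<epsilon> * norm v" for x v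
  proof -
    have "\<bar>?d\<eta> x v * h (x $ j)\<bar> \<le> (D * norm v) * (7 * \<kappa>)"
      unfolding abs_mult using dD h(3) D by (intro mult_mono) auto
    also have "\<dots> = (7 * \<kappa> * D) * norm v" by simp
    also have "\<dots> \<le> \<epsilon> * norm v" by (rule mult_right_mono[OF \<kappa>(3)]) simp
    finally show ?thesis .
  qed
  have eh: "\<bar>\<eta> x * (v $ j * h' (x $ j))\<bar> \<le> \<bar>v $ j\<bar>" for x v
  proof -
    have "\<bar>\<eta> x * (v $ j * h' (x $ j))\<bar> \<le> 1 * (\<bar>v $ j\<bar> * 1)"
      unfolding abs_mult using \<eta>(2,3)[of x] h(4) by (intro mult_mono) auto
    then show ?thesis by simp
  qed
  \<comment> \<open>\<open>W\<close> in place of \<open>K\<close> and a strict inequality keep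
    \<open>V\<close> open. \<open>V\<close> and \<open>B\<close> may overlap; what matters is that a
    point of \<open>U\<close> outside both lies in \<open>K\<close> and has slope exactly
    -1.\<close>
  define V where "V = {x\<in>W. sin (x $ j / \<kappa>) > \<tau>}"
  define B where "B = (U - K) \<union> {x\<in>U. \<bar>sin (x $ j / \<kappa>)\<bar> \<le> \<tau>}"
  have V: "open V" "V \<subseteq> U"
  proof -
    have "open {x. sin (x $ j / \<kappa>) > \<tau>}"
      by (intro open_Collect_less continuous_intros) (use \<kappa> in auto)
    then show "open V" using W(1) by (auto simp: V_def Collect_conj_eq)
    show "V \<subseteq> U" using W(3) by (auto simp: V_def)
  qed
  have Ulm: "U \<in> lmeasurable" and Vlm: "V \<in> lmeasurable"
    using U V bounded_subset by (auto intro: lmeasurable_open)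
  have dV: "frechet_derivative \<theta> (at x) v = v $ j" if "x \<in> V" for x v
    using that h(5)[of "x $ j"] by (auto simp: V_def derW)
  have KU: "U - K \<in> lmeasurable"
    using Ulm K(1) by (intro fmeasurable_Diff) (auto simp: lmeasurable_compact fmeasurableD)
  show thesis
  proof
    show "\<theta> \<in> test_functions U" by (rule t\<theta>)
    show "\<bar>\<theta> x\<bar> \<le> 1" for x
    proof -
      have "\<bar>\<theta> x\<bar> \<le> 1 * (7 * \<kappa>)"
        unfolding \<theta>_def abs_mult using \<eta>(2,3)[of x] h(3) by (intro mult_mono) auto
      then show ?thesis using \<kappa>(2) by simp
    qed
    show "\<bar>frechet_derivative \<theta> (at x) v\<bar> \<le> 2 * norm v" for x v
    proof -
      have "\<bar>frechet_derivative \<theta> (at x) v\<bar> \<le> \<bar>v $ j\<bar> + \<epsilon> * norm v"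
        unfolding der using hd[of x v] eh[of x v] by linarith
      moreover have "\<bar>v $ j\<bar> \<le> norm v" by (rule component_le_norm_cart)
      moreover have "\<epsilon> * norm v \<le> 1 * norm v" by (rule mult_right_mono[OF \<epsilon>(2)]) simp
      ultimately show ?thesis by linarith
    qed
    show "open V" "V \<subseteq> U" by (fact V)+
    \<comment> \<open>The derivative has mean zero, is 1 on \<open>V\<close> and at least \<open>- 1 - \<epsilon>\<close> elsewhere.\<close>
    show "measure lebesgue V \<le> \<mu> * measure lebesgue U"
    proof -
      let ?w = "\<lambda>x. frechet_derivative \<theta> (at x) (axis j 1)"
      have supp: "?w x = 0" if "x \<notin> U" for x
        using test_functions_zero_outside(2)[OF t\<theta>] test_functionsD(3)[OF t\<theta>] that by blast
      have int: "integrable lebesgue ?w"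
        using compact_support_integrable[OF test_functions_continuous_derivative[OF t\<theta>] test_functionsD(2)[OF t\<theta>]
          test_functions_zero_outside(2)[OF t\<theta>], of UNIV] by (simp add: lebesgue_on_UNIV_eq)
      have UV: "U - V \<in> lmeasurable" by (rule fmeasurable_Diff[OF Ulm fmeasurableD[OF Vlm]])
      have iV: "integrable lebesgue (indicat_real V)" and iUV: "integrable lebesgue (indicat_real (U - V))"
        using fmeasurableD2[OF Vlm] fmeasurableD2[OF UV] fmeasurableD[OF Vlm] fmeasurableD[OF UV]
        by (auto intro!: integrable_real_indicator simp: less_top)
      have "0 = (LINT x|lebesgue. ?w x)"
        by (rule integral_directional_derivative_eq_0[OF s\<theta> test_functionsD(2)[OF t\<theta>], symmetric])
      also have "\<dots> \<ge> (LINT x|lebesgue. indicat_real V x - (1 + \<epsilon>) * indicat_real (U - V) x)"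
      proof (rule integral_mono[OF _ int])
        show "integrable lebesgue (\<lambda>x. indicat_real V x - (1 + \<epsilon>) * indicat_real (U - V) x)"
          by (intro Bochner_Integration.integrable_diff integrable_mult_right iV iUV)
        show "indicat_real V x - (1 + \<epsilon>) * indicat_real (U - V) x \<le> ?w x" for x
        proof -
          have "\<bar>?w x\<bar> \<le> 1 + \<epsilon>"
            unfolding der using hd[of x "axis j 1"] eh[of x "axis j 1"] by (simp add: norm_axis_1)
          then show ?thesis
            using dV[of x "axis j 1"] supp[of x] V(2) by (auto simp: indicator_def)
        qed
      qed
      also have "(LINT x|lebesgue. indicat_real V x - (1 + \<epsilon>) * indicat_real (U - V) x)
          = measure lebesgue V - (1 + \<epsilon>) * measure lebesgue (U - V)"
        by (subst Bochner_Integration.integral_diff[OF iV integrable_mult_right[OF iUV]]) simp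
      also have "measure lebesgue (U - V) = measure lebesgue U - measure lebesgue V"
        using measurable_measure_Diff[OF Ulm fmeasurableD[OF Vlm] V(2)] .
      finally have "(2 + \<epsilon>) * measure lebesgue V \<le> (1 + \<epsilon>) * measure lebesgue U"
        by (simp add: algebra_simps)
      also have "\<dots> \<le> (2 + \<epsilon>) * \<mu> * measure lebesgue U"
      proof (rule mult_right_mono)
        have "\<epsilon> * \<mu> \<ge> 0" using \<epsilon> lam by simp
        then show "1 + \<epsilon> \<le> (2 + \<epsilon>) * \<mu>" using \<epsilon>(3) by (simp add: algebra_simps)
      qed simp
      finally have "(2 + \<epsilon>) * measure lebesgue V \<le> (2 + \<epsilon>) * (\<mu> * measure lebesgue U)" by (simp only: mult.assoc)
      then show ?thesis by (rule mult_left_le_imp_le) (use \<epsilon> in simp)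
    qed
    show "frechet_derivative \<theta> (at x) v = v $ j" if "x \<in> V" for x v using dV[OF that] .
    show "B \<in> lmeasurable" unfolding B_def using KU slab(2) by (rule fmeasurable.Un)
    show "B \<subseteq> U" by (auto simp: B_def)
    show "measure lebesgue B \<le> \<delta>"
      using measure_Un_le[of "U - K" lebesgue "{x\<in>U. \<bar>sin (x $ j / \<kappa>)\<bar> \<le> \<tau>}"] KU slab K(3)
      by (simp add: B_def fmeasurableD)
    show "frechet_derivative \<theta> (at x) v = - (v $ j)" if "x \<in> U - V - B" for x v
    proof -
      have "x \<in> W" "\<not> sin (x $ j / \<kappa>) > \<tau>" "\<not> \<bar>sin (x $ j / \<kappa>)\<bar> \<le> \<tau>"
        using that W(2) by (auto simp: B_def V_def)
      then show ?thesis using h(6)[of "x $ j"] by (simp add: derW)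
    qed
  qed
qed

section \<open>The infinite staircase\<close>

lemma integrable_lebesgue_on_subset:
  fixes u :: "'a::euclidean_space \<Rightarrow> 'b::euclidean_space"
  assumes "integrable (lebesgue_on S) u" "T \<subseteq> S" "S \<in> sets lebesgue" "T \<in> sets lebesgue"
  shows "integrable (lebesgue_on T) u"
proof -
  have "integrable lebesgue (\<lambda>x. if x \<in> S then u x else 0)"
    using assms(1,3) by (simp add: Lebesgue_Measure.integrable_restrict_UNIV)
  then have "integrable (lebesgue_on T) (\<lambda>x. if x \<in> S then u x else 0)"
    by (rule integrable_lebesgue_on_if[OF _ assms(4)])
  then show ?thesis
    by (rule Bochner_Integration.integrable_cong[THEN iffD1, rotated -1])
       (use assms(2) in \<open>auto simp: space_restrict_space\<close>)
qed

lemma locally_integrable_on_if_integrable: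
  fixes u :: "'a::euclidean_space \<Rightarrow> 'b::euclidean_space"
  assumes "integrable (lebesgue_on S) u" "S \<in> sets lebesgue"
  shows "locally_integrable_on u S"
  unfolding locally_integrable_on_def
  using borel_measurable_integrable[OF assms(1)] integrable_lebesgue_on_subset[OF assms(1) _ assms(2)]
  by (simp add: fmeasurableD lmeasurable_compact)

text \<open>On a set of finite measure this turns an integrable majorant of p-th powers into one of
  first powers.\<close>

lemma le_one_add_powr:
  fixes y p :: real assumes "0 \<le> y" "1 \<le> p" shows "y \<le> 1 + y powr p"
proof (cases "y \<le> 1")
  case True
  then show ?thesis by (simp add: add_increasing2)
next
  case False
  then have "y powr 1 \<le> y powr p" using assms by (intro powr_mono) auto
  then show ?thesis using False by simp
qed

text \<open>One majorant serves twice. Dominating the p-th powers, it gives convergence of the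
  functions and of their Jacobians in the norm of the Sobolev space; with \<open>1 + w\<close>
  dominating the first powers, the identity that defines the weak gradient passes to the
  limit.\<close>

lemma W1p_0_dominated_limit:
  fixes S :: "nat \<Rightarrow> real^'n \<Rightarrow> real^'m" and G :: "real^'n \<Rightarrow> real^'n^'m"
  assumes p: "1 \<le> p" and \<Omega>: "bounded \<Omega>" "open \<Omega>"
    and S: "\<And>k. S k \<in> test_functions \<Omega>"
    and mu: "u \<in> borel_measurable (lebesgue_on \<Omega>)" and mG: "G \<in> borel_measurable (lebesgue_on \<Omega>)"
    and w: "integrable (lebesgue_on \<Omega>) w"
    and lim: "AE x in lebesgue_on \<Omega>. (\<lambda>k. S k x) \<longlonglongrightarrow> u x"
      "AE x in lebesgue_on \<Omega>. (\<lambda>k. jacobian (S k) (at x)) \<longlonglongrightarrow> G x"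
    and dom: "AE x in lebesgue_on \<Omega>. \<forall>k. norm (S k x) powr p \<le> w x"
      "AE x in lebesgue_on \<Omega>. \<forall>k. norm (jacobian (S k) (at x)) powr p \<le> w x"
  shows "u \<in> W1p_0 p \<Omega> \<and> has_weak_gradient u G \<Omega>"
proof -
  let ?M = "lebesgue_on \<Omega>"
  have L: "\<Omega> \<in> sets lebesgue" by (rule open_sets_lebesgue[OF \<Omega>(2)])
  interpret finite_measure ?M by (rule finite_measure_lebesgue_on[OF lmeasurable_open[OF \<Omega>]])
  have p0: "p > 0" using p by simp
  have w1: "integrable ?M (\<lambda>x. 1 + w x)" using w by simp
  have limit_dom: "AE x in ?M. norm (v x) powr p \<le> w x"
    if "AE x in ?M. (\<lambda>k. s k x) \<longlonglongrightarrow> v x" "AE x in ?M. \<forall>k. norm (s k x) powr p \<le> w x"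
    for s :: "nat \<Rightarrow> real^'n \<Rightarrow> 'z::euclidean_space" and v
    using that
  proof eventually_elim
    case (elim x)
    have "(\<lambda>k. norm (s k x) powr p) \<longlonglongrightarrow> norm (v x) powr p"
      using p0 by (intro tendsto_powr' tendsto_norm elim tendsto_const) auto
    then show ?case using elim(2) by (intro LIMSEQ_le_const2) auto
  qed
  have Lp: "v \<in> Lp_on p \<Omega>"
    if "v \<in> borel_measurable ?M" "AE x in ?M. norm (v x) powr p \<le> w x" for v :: "real^'n \<Rightarrow> 'z::euclidean_space"
  proof -
    have "integrable ?M (\<lambda>x. norm (v x) powr p)"
      by (rule Bochner_Integration.integrable_bound[OF w]) (use that in auto)
    then show ?thesis using that by (simp add: Lp_on_def)
  qed
  have L1: "AE x in ?M. norm (v x) \<le> 1 + w x"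
    if "AE x in ?M. norm (v x) powr p \<le> w x" for v :: "real^'n \<Rightarrow> 'z::euclidean_space"
    using that
  proof eventually_elim
    case (elim x)
    then show ?case using le_one_add_powr[OF norm_ge_zero p, of "v x"] by linarith
  qed
  have int: "integrable ?M v"
    if "v \<in> borel_measurable ?M" "AE x in ?M. norm (v x) powr p \<le> w x" for v :: "real^'n \<Rightarrow> 'z::euclidean_space"
    by (rule Bochner_Integration.integrable_bound[OF w1 that(1)])
       (use L1[OF that(2)] in eventually_elim, simp)
  have du: "AE x in ?M. norm (u x) powr p \<le> w x" by (rule limit_dom[OF lim(1) dom(1)])
  have dG: "AE x in ?M. norm (G x) powr p \<le> w x" by (rule limit_dom[OF lim(2) dom(2)])
  have mS: "S k \<in> borel_measurable ?M" for k
    by (rule borel_measurable_integrable[OF test_functions_integrable[OF S L]])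
  have mJ: "(\<lambda>x. jacobian (S k) (at x)) \<in> borel_measurable ?M" for k
    by (rule borel_measurable_integrable[OF jacobian_integrable[OF S L]])
  \<comment> \<open>Stated for a general functional \<open>l\<close>, to cover both the components
    of \<open>S k\<close> and the entries of its Jacobian.\<close>
  have conv: "(\<lambda>k. LINT x|?M. l (s k x) * \<beta> x) \<longlonglongrightarrow> (LINT x|?M. l (v x) * \<beta> x)"
    if s: "\<And>k. s k \<in> borel_measurable ?M" and v: "v \<in> borel_measurable ?M"
      and sv: "AE x in ?M. (\<lambda>k. s k x) \<longlonglongrightarrow> v x" and sw: "AE x in ?M. \<forall>k. norm (s k x) powr p \<le> w x"
      and l: "bounded_linear l" "\<And>y. \<bar>l y\<bar> \<le> norm y"
      and \<beta>: "continuous_on UNIV \<beta>" "\<And>x. norm (\<beta> x) \<le> B"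
    for s :: "nat \<Rightarrow> real^'n \<Rightarrow> 'z::euclidean_space" and v \<beta> and l :: "'z \<Rightarrow> real" and B
  proof (rule integral_dominated_convergence[where w = "\<lambda>x. (1 + w x) * B"])
    have [measurable]: "\<beta> \<in> borel_measurable ?M"
      using continuous_imp_measurable_on_sets_lebesgue[OF continuous_on_subset[OF \<beta>(1)] L] by simp
    have [measurable]: "l \<in> borel_measurable borel"
      by (rule borel_measurable_continuous_onI[OF linear_continuous_on[OF l(1)]])
    show "(\<lambda>x. l (v x) * \<beta> x) \<in> borel_measurable ?M" "\<And>k. (\<lambda>x. l (s k x) * \<beta> x) \<in> borel_measurable ?M"
      using s v by measurable
    show "integrable ?M (\<lambda>x. (1 + w x) * B)" using w1 by simp
    show "AE x in ?M. (\<lambda>k. l (s k x) * \<beta> x) \<longlonglongrightarrow> l (v x) * \<beta> x"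
      using sv by eventually_elim (intro tendsto_mult tendsto_const bounded_linear.tendsto[OF l(1)])
    have "AE x in ?M. \<forall>k. norm (s k x) \<le> 1 + w x"
      using sw
    proof eventually_elim
      case (elim x)
      show ?case using elim le_one_add_powr[OF norm_ge_zero p, of "s _ x"] by (smt (verit))
    qed
    then show "AE x in ?M. norm (l (s k x) * \<beta> x) \<le> (1 + w x) * B" for k
    proof eventually_elim
      case (elim x)
      have "norm (l (s k x) * \<beta> x) \<le> norm (s k x) * B"
        unfolding real_norm_def abs_mult using l(2) \<beta>(2)[of x] by (intro mult_mono) auto
      also have "\<dots> \<le> (1 + w x) * B" using elim order_trans[OF norm_ge_zero \<beta>(2)[of x]] by (intro mult_right_mono) simp_all
      finally show ?case .
    qed
  qed
  have wg: "has_weak_gradient u G \<Omega>"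
    unfolding has_weak_gradient_def
  proof (intro conjI ballI allI)
    show "locally_integrable_on u \<Omega>" "locally_integrable_on G \<Omega>"
      using int mu mG du dG L by (blast intro: locally_integrable_on_if_integrable)+
    fix \<psi> :: "real^'n \<Rightarrow> real" and i j
    assume \<psi>: "\<psi> \<in> test_functions \<Omega>"
    let ?D = "\<lambda>x. frechet_derivative \<psi> (at x) (axis j 1)"
    obtain B1 where B1: "\<And>x. norm (\<psi> x) \<le> B1"
      using compact_support_bounded[OF test_functions_continuous[OF \<psi>] test_functionsD(2)[OF \<psi>]
        test_functions_zero_outside(1)[OF \<psi>]] by metis
    obtain B2 where B2: "\<And>x. norm (?D x) \<le> B2"
      using compact_support_bounded[OF test_functions_continuous_derivative[OF \<psi>] test_functionsD(2)[OF \<psi>]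
        test_functions_zero_outside(2)[OF \<psi>]] by metis
    have "(\<lambda>k. LINT x|?M. S k x $ i * ?D x) \<longlonglongrightarrow> (LINT x|?M. u x $ i * ?D x)"
      by (rule conv[OF mS mu lim(1) dom(1) bounded_linear_vec_nth component_le_norm_cart
            test_functions_continuous_derivative[OF \<psi>] B2])
    moreover have "(\<lambda>k. LINT x|?M. jacobian (S k) (at x) $ i $ j * \<psi> x) \<longlonglongrightarrow> (LINT x|?M. G x $ i $ j * \<psi> x)"
      by (rule conv[OF mJ mG lim(2) dom(2) bounded_linear_compose[OF bounded_linear_vec_nth bounded_linear_vec_nth] _
            test_functions_continuous[OF \<psi>] B1])
         (use component_le_norm_cart Finite_Cartesian_Product.norm_nth_le order_trans in blast)
    moreover have "(LINT x|?M. S k x $ i * ?D x) = - (LINT x|?M. jacobian (S k) (at x) $ i $ j * \<psi> x)" for k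
      using test_functions_weak_gradient[OF S \<Omega>(2), of k] \<psi> by (simp add: has_weak_gradient_def)
    ultimately show "(LINT x|?M. u x $ i * ?D x) = - (LINT x|?M. G x $ i $ j * \<psi> x)"
      using LIMSEQ_unique tendsto_minus by (metis (no_types, lifting) LIMSEQ_unique ext)
  qed
  have diff: "(\<lambda>k. LINT x|?M. norm (s k x - v x) powr p) \<longlonglongrightarrow> 0" "integrable ?M (\<lambda>x. norm (s k x - v x) powr p)"
    if s: "\<And>k. s k \<in> borel_measurable ?M" and v: "v \<in> borel_measurable ?M"
      and sv: "AE x in ?M. (\<lambda>k. s k x) \<longlonglongrightarrow> v x" and sw: "AE x in ?M. \<forall>k. norm (s k x) powr p \<le> w x"
    for s :: "nat \<Rightarrow> real^'n \<Rightarrow> 'z::euclidean_space" and v k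
  proof -
    \<comment> \<open>|a - b|^p is at most 2^p times the larger of |a|^p and |b|^p, and the limit
      inherits the majorant of the sequence.\<close>
    have d: "AE x in ?M. norm (norm (s k x - v x) powr p) \<le> 2 powr p * w x" for k
      using sw limit_dom[OF sv sw]
    proof eventually_elim
      case (elim x)
      let ?m = "max (norm (s k x)) (norm (v x))"
      have "norm (s k x - v x) \<le> 2 * ?m"
        using norm_triangle_ineq4[of "s k x" "v x"] by simp
      then have "norm (s k x - v x) powr p \<le> (2 * ?m) powr p"
        using p0 by (intro powr_mono2) auto
      also have "\<dots> = 2 powr p * ?m powr p" by (simp add: powr_mult)
      also have "?m powr p \<le> w x" using elim by (simp add: max_def)
      finally show ?case by simp
    qed
    have iw: "integrable ?M (\<lambda>x. 2 powr p * w x)" using w by simp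
    have m: "(\<lambda>x. norm (s k x - v x) powr p) \<in> borel_measurable ?M" for k using s v by measurable
    show "integrable ?M (\<lambda>x. norm (s k x - v x) powr p)"
      by (rule Bochner_Integration.integrable_bound[OF iw m]) (use d[of k] in eventually_elim, simp)
    have "(\<lambda>k. LINT x|?M. norm (s k x - v x) powr p) \<longlonglongrightarrow> (LINT x|?M. 0)"
    proof (rule integral_dominated_convergence[OF _ m iw _ d])
      show "AE x in ?M. (\<lambda>k. norm (s k x - v x) powr p) \<longlonglongrightarrow> 0"
        using sv
      proof eventually_elim
        case (elim x)
        then have "(\<lambda>k. norm (s k x - v x)) \<longlonglongrightarrow> 0" using LIM_zero tendsto_norm_zero by blast
        then show ?case using p0 by (intro tendsto_zero_powrI[OF _ tendsto_const]) auto
      qed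
    qed simp
    then show "(\<lambda>k. LINT x|?M. norm (s k x - v x) powr p) \<longlonglongrightarrow> 0" by simp
  qed
  have "(\<lambda>k. W1p_norm p \<Omega> (\<lambda>x. S k x - u x) (\<lambda>x. jacobian (S k) (at x) - G x)) \<longlonglongrightarrow> 0"
  proof -
    have "(\<lambda>k. LINT x|?M. norm (S k x - u x) powr p + norm (jacobian (S k) (at x) - G x) powr p) \<longlonglongrightarrow> 0"
      using tendsto_add[OF diff(1)[OF mS mu lim(1) dom(1)] diff(1)[OF mJ mG lim(2) dom(2)]]
      by (simp add: Bochner_Integration.integral_add[OF diff(2)[OF mS mu lim(1) dom(1)] diff(2)[OF mJ mG lim(2) dom(2)]])
    then show ?thesis unfolding W1p_norm_def
      by (rule tendsto_zero_powrI[OF _ tendsto_const]) (use p0 in auto)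
  qed
  then show ?thesis
    using wg Lp[OF mu du] Lp[OF mG dG] S unfolding W1p_0_def W1p_def by blast
qed

text \<open>The integral of the k-th term is at most a^p m (\<mu> q^p)^k, which is geometric with
  ratio below 1. The measures of the nested sets tend to 0, so almost every point lies in only
  finitely many of them and sees a finite sum.\<close>

lemma envelope_integrable:
  fixes U :: "nat \<Rightarrow> 'a::euclidean_space set"
  assumes U: "\<And>k. U k \<in> lmeasurable" "\<And>k. U (Suc k) \<subseteq> U k" "\<And>k. measure lebesgue (U k) \<le> \<mu> ^ k * m"
    and q: "q > 0" and \<mu>: "0 \<le> \<mu>" "\<mu> < 1" "\<mu> * q powr p < 1" and a: "a \<ge> 0"
  shows "integrable lebesgue (\<lambda>x. \<Sum>k. (a * q ^ k) powr p * indicat_real (U k) x)"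
    and "AE x in lebesgue. \<exists>l. x \<notin> U l"
proof -
  have mU: "U k \<in> sets lebesgue" for k using U(1) by (rule fmeasurableD)
  have "(\<Inter>k. U k) \<in> null_sets lebesgue"
  proof (rule null_setsI)
    show "(\<Inter>k. U k) \<in> sets lebesgue" using mU by auto
    have lm: "(\<Inter>k. U k) \<in> lmeasurable"
      by (rule fmeasurableI2[OF U(1)[of 0] _ \<open>(\<Inter>k. U k) \<in> sets lebesgue\<close>]) auto
    have "measure lebesgue (\<Inter>k. U k) \<le> \<mu> ^ k * m" for k
      using measure_mono_fmeasurable[OF INT_lower[of k UNIV U] _ U(1)] U(3)[of k] mU by force
    moreover have "(\<lambda>k. \<mu> ^ k * m) \<longlonglongrightarrow> 0 * m"
      by (intro tendsto_mult tendsto_const LIMSEQ_power_zero) (use \<mu> in auto)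
    ultimately have "measure lebesgue (\<Inter>k. U k) \<le> 0"
      by (intro LIMSEQ_le_const) auto
    then show "emeasure lebesgue (\<Inter>k. U k) = 0"
      using lm by (simp add: emeasure_eq_measure2 measure_nonneg antisym)
  qed
  from AE_not_in[OF this] show ae: "AE x in lebesgue. \<exists>l. x \<notin> U l" by simp
  have fin: "summable (\<lambda>k. c k * indicat_real (U k) x)" if "x \<notin> U l" for x l and c :: "nat \<Rightarrow> real"
  proof (rule summable_finite[of "{..<l}"])
    show "c k * indicat_real (U k) x = 0" if "k \<notin> {..<l}" for k
      using that \<open>x \<notin> U l\<close> lift_Suc_antimono_le[of U l k, OF U(2)] by (auto simp: indicator_def)
  qed simp
  show "integrable lebesgue (\<lambda>x. \<Sum>k. (a * q ^ k) powr p * indicat_real (U k) x)"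
  proof (rule integrable_suminf)
    show "integrable lebesgue (\<lambda>x. (a * q ^ k) powr p * indicat_real (U k) x)" for k
      using fmeasurableD2[OF U(1)[of k]] mU
      by (intro integrable_mult_right integrable_real_indicator) (auto simp: less_top)
    show "AE x in lebesgue. summable (\<lambda>k. norm ((a * q ^ k) powr p * indicat_real (U k) x))"
      using ae by eventually_elim (auto simp: abs_mult intro: fin)
    have "(LINT x|lebesgue. norm ((a * q ^ k) powr p * indicat_real (U k) x)) = (a * q ^ k) powr p * measure lebesgue (U k)" for k
      using mU by (simp add: abs_mult)
    moreover have "summable (\<lambda>k. (a * q ^ k) powr p * measure lebesgue (U k))"
    proof (rule summable_comparison_test')
      show "summable (\<lambda>k. a powr p * m * (\<mu> * q powr p) ^ k)"
        by (intro summable_mult summable_geometric) (use \<mu> in auto)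
      show "norm ((a * q ^ k) powr p * measure lebesgue (U k)) \<le> a powr p * m * (\<mu> * q powr p) ^ k" if "k \<ge> 0" for k
      proof -
        have "(a * q ^ k) powr p = a powr p * (q powr p) ^ k"
          using a q by (simp add: powr_mult powr_powr powr_realpow[symmetric] mult.commute)
        then show ?thesis
          using mult_left_mono[OF U(3)[of k], of "a powr p * (q powr p) ^ k"]
          by (simp add: power_mult_distrib algebra_simps)
      qed
    qed
    ultimately show "summable (\<lambda>k. LINT x|lebesgue. norm ((a * q ^ k) powr p * indicat_real (U k) x))" by simp
  qed
qed

section \<open>Gradients of single layers and their sums\<close>

lemma bounded_linear_axis: "bounded_linear (\<lambda>t::real. axis i (s * t) :: real^'m)"
  by (intro linear_conv_bounded_linear[THEN iffD1] linearI) (auto simp: vec_eq_iff axis_def algebra_simps)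

lemma norm_axis: "norm (axis i v :: 'a::real_inner^'m) = norm v"
  by (simp add: norm_eq_sqrt_inner inner_axis_axis)

lemma jacobian_axis:
  fixes \<theta> :: "real^'n \<Rightarrow> real"
  assumes "\<theta> \<in> test_functions \<Omega>"
  shows "jacobian (\<lambda>x. axis i (s * \<theta> x) :: real^'m) (at x)
    = axis i (s *\<^sub>R (\<chi> b. frechet_derivative \<theta> (at x) (axis b 1)))"
proof -
  have "((\<lambda>x. axis i (s * \<theta> x) :: real^'m) has_derivative (\<lambda>v. axis i (s * frechet_derivative \<theta> (at x) v))) (at x)"
    using bounded_linear.has_derivative[OF bounded_linear_axis test_functions_derivative[OF assms]] .
  from fun_cong[OF frechet_derivative_at[OF this], symmetric] show ?thesis
    by (auto simp: jacobian_def matrix_def vec_eq_iff axis_def)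
qed

text \<open>Evaluating \<open>l\<close> at its own gradient vector gives the squared norm of that
  vector.\<close>

lemma norm_gradient_le:
  fixes l :: "real^'n \<Rightarrow> real"
  assumes "linear l" "\<And>v. \<bar>l v\<bar> \<le> c * norm v" "c \<ge> 0"
  shows "norm (\<chi> b. l (axis b 1)) \<le> c"
proof -
  let ?w = "\<chi> b. l (axis b 1)"
  have "l ?w = l (\<Sum>b\<in>UNIV. (?w $ b) *\<^sub>R axis b 1)"
    using basis_expansion[of ?w] by (simp add: scalar_mult_eq_scaleR)
  also have "\<dots> = ?w \<bullet> ?w"
    by (simp add: linear_sum[OF assms(1)] linear_scale[OF assms(1)] inner_vec_def)
  finally have "norm ?w * norm ?w \<le> c * norm ?w"
    using assms(2)[of ?w] by (simp add: dot_square_norm power2_eq_square)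
  then show ?thesis using assms(3) by (cases "norm ?w = 0") auto
qed

text \<open>Up to the factor q / (q - 1), a geometric sum is as large as its last term. In the
  application \<open>l\<close> is the last level whose set contains a given point, and a bound
  uniform in \<open>A\<close> covers all partial sums at once.\<close>

lemma geometric_tail_bound:
  fixes y :: "nat \<Rightarrow> 'b::real_normed_vector" and q :: real
  assumes "q > 1" "\<And>i. norm (y i) \<le> a * q ^ i" "\<And>i. i > l \<Longrightarrow> y i = 0" "finite A"
  shows "norm (\<Sum>i\<in>A. y i) \<le> (a * q / (q - 1)) * q ^ l"
proof -
  have a: "a \<ge> 0" using order_trans[OF norm_ge_zero assms(2)[of 0]] by simp
  have "norm (\<Sum>i\<in>A. y i) \<le> (\<Sum>i\<in>A. norm (y i))" by (rule norm_sum)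
  also have "\<dots> = (\<Sum>i\<in>A \<inter> {..l}. norm (y i))"
    using assms(3,4) by (intro sum.mono_neutral_right) (auto simp: not_le)
  also have "\<dots> \<le> (\<Sum>i\<in>{..l}. norm (y i))" by (intro sum_mono2) auto
  also have "\<dots> \<le> (\<Sum>i\<in>{..l}. a * q ^ i)" by (intro sum_mono assms)
  also have "\<dots> = a * ((q ^ Suc l - 1) / (q - 1))"
    unfolding sum_distrib_left[symmetric] lessThan_Suc_atMost[symmetric]
    by (subst geometric_sum) (use assms(1) in auto)
  also have "\<dots> \<le> a * (q ^ Suc l / (q - 1))"
    using assms(1) a by (intro mult_left_mono divide_right_mono) auto
  finally show ?thesis by (simp add: field_simps)
qed

text \<open>Dropping the integral of the negative part only increases the value, so the
  quasiconvexity inequality can be exploited from an upper bound of the integrand alone.\<close>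

lemma ereal_integral_le_nn:
  assumes "ereal a \<le> ereal_integral M g" "AE x in M. e2ennreal (g x) \<le> h x"
  shows "ereal a \<le> enn2ereal (\<integral>\<^sup>+ x. h x \<partial>M)"
proof -
  have "ereal_integral M g \<le> enn2ereal (\<integral>\<^sup>+ x. e2ennreal (g x) \<partial>M)"
    unfolding ereal_integral_def
    by (metis add.right_neutral enn2ereal_nonneg ereal_minus_le_iff ereal_diff_positive add_left_mono ereal_diff_le_self)
  also have "\<dots> \<le> enn2ereal (\<integral>\<^sup>+ x. h x \<partial>M)"
    using nn_integral_mono_AE[OF assms(2)] by (simp add: less_eq_ennreal.rep_eq)
  finally show ?thesis using assms(1) by (rule order_trans[rotated])
qed

text \<open>On \<open>U k\<close> the first \<open>k\<close> laminations have turned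
  \<open>X 0\<close> exactly into \<open>X k\<close>. The next one leads to \<open>X (Suc k)\<close>
  on \<open>U (Suc k)\<close> and elsewhere, off a small bad set, to a matrix where \<open>f\<close>
  is at most \<open>c k\<close>. As \<open>U k\<close> has at most the share \<mu>^k of \<Omega>,
  the bounds \<open>c k\<close> add up with these weights. The condition on
  \<open>\<mu> * q powr p\<close> makes the limit an admissible function.\<close>

lemma quasiconvex_staircase_bound:
  fixes f :: "real^'n^'m \<Rightarrow> real" and X :: "nat \<Rightarrow> real^'n^'m"
    and i :: "nat \<Rightarrow> 'm" and j :: "nat \<Rightarrow> 'n" and s c :: "nat \<Rightarrow> real"
  assumes p: "1 \<le> p" and cf: "continuous_on UNIV f"
    and qc: "W1p_quasiconvex_at p (\<lambda>\<xi>. ereal (f \<xi>)) (X 0)"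
    and X: "\<And>k. X (Suc k) = X k + axis (i k) (axis (j k) (s k))"
    and s: "\<And>k. \<bar>s k\<bar> \<le> C * q ^ k" and q: "q > 1"
    and \<mu>: "1 / 2 < \<mu>" "\<mu> * q powr p < 1"
    and c: "\<And>k. f (X k - axis (i k) (axis (j k) (s k))) \<le> c k" "\<And>k. 0 \<le> c k"
    and sumc: "summable (\<lambda>k. \<mu> ^ k * c k)"
  shows "f (X 0) \<le> (\<Sum>k. \<mu> ^ k * c k)"
proof -
  define D :: "nat \<Rightarrow> real^'n^'m" where "D k = axis (i k) (axis (j k) (s k))" for k
  have nD: "norm (D k) = \<bar>s k\<bar>" for k by (simp add: D_def norm_axis)
  have C: "C \<ge> 0" using s[of 0] by simp
  have \<mu>1: "\<mu> < 1"
  proof -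
    have "1 \<le> q powr p" using q p by (intro ge_one_powr_ge_zero) auto
    then have "\<mu> * 1 \<le> \<mu> * q powr p" using \<mu> by (intro mult_left_mono) auto
    then show ?thesis using \<mu> by linarith
  qed
  obtain \<Omega> :: "(real^'n) set" where \<Omega>: "\<Omega> \<noteq> {}" "bounded \<Omega>" "open \<Omega>"
    and test: "\<And>\<phi> :: real^'n \<Rightarrow> real^'m. \<And>G. \<phi> \<in> W1p_0 p \<Omega> \<Longrightarrow> has_weak_gradient \<phi> G \<Omega> \<Longrightarrow>
      ereal (measure lebesgue \<Omega>) * ereal (f (X 0)) \<le> ereal_integral (lebesgue_on \<Omega>) (\<lambda>x. ereal (f (X 0 + G x)))"
    using qc unfolding W1p_quasiconvex_at_def by blast
  define m where "m = measure lebesgue \<Omega>"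
  have \<Omega>lm: "\<Omega> \<in> lmeasurable" and L: "\<Omega> \<in> sets lebesgue"
    using \<Omega> by (auto intro: lmeasurable_open open_sets_lebesgue)
  have m: "m > 0"
  proof -
    have "\<not> negligible \<Omega>" using open_not_negligible \<Omega> by blast
    then show ?thesis using \<Omega>lm by (simp add: m_def negligible_iff_measure zero_less_measure_iff)
  qed
  \<comment> \<open>The gradient of the k-th layer will be at most
    \<open>2 * \<bar>s k\<bar>\<close>, so \<open>M k\<close> bounds \<open>f\<close> at whatever
    value the total gradient takes where the construction ends on the k-th bad set.\<close>
  have "\<exists>M\<ge>0. \<forall>\<eta>. norm (\<eta> - X k) \<le> 2 * \<bar>s k\<bar> \<longrightarrow> f \<eta> \<le> M" for k
  proof -
    have "compact (f ` cball (X k) (2 * \<bar>s k\<bar>))"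
      by (intro compact_continuous_image continuous_on_subset[OF cf]) auto
    then obtain M where M: "M > 0" "\<And>y. y \<in> f ` cball (X k) (2 * \<bar>s k\<bar>) \<Longrightarrow> norm y \<le> M"
      using compact_imp_bounded bounded_pos by metis
    have "f \<eta> \<le> M" if "norm (\<eta> - X k) \<le> 2 * \<bar>s k\<bar>" for \<eta>
      using M(2)[of "f \<eta>"] that by (auto simp: dist_norm norm_minus_commute)
    then show ?thesis using M(1) by (intro exI[of _ M]) auto
  qed
  then obtain M where M: "\<And>k. M k \<ge> 0" "\<And>k \<eta>. norm (\<eta> - X k) \<le> 2 * \<bar>s k\<bar> \<Longrightarrow> f \<eta> \<le> M k" by metis
  have "f (X 0) * m \<le> (\<Sum>k. \<mu> ^ k * c k) * m"
  proof (rule field_le_epsilon)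
    fix e :: real assume e: "e > 0"
    \<comment> \<open>\<open>M k\<close> may grow arbitrarily fast, so the measure of the bad sets is chosen after it.\<close>
    define \<delta> where "\<delta> k = e * (1 / 2) ^ Suc k / (M k + 1)" for k
    have \<delta>: "\<delta> k > 0" "M k * \<delta> k \<le> e * (1 / 2) ^ Suc k" for k
    proof -
      have E: "e * (1 / 2) ^ Suc k > 0" using e by simp
      have M1: "M k + 1 > 0" using M(1)[of k] by simp
      show "\<delta> k > 0" unfolding \<delta>_def using E M1 by (rule divide_pos_pos)
      have "M k * \<delta> k \<le> (M k + 1) * \<delta> k" using \<open>\<delta> k > 0\<close> by simp
      also have "(M k + 1) * \<delta> k = e * (1 / 2) ^ Suc k"
        unfolding \<delta>_def times_divide_eq_right by (rule nonzero_mult_div_cancel_left) (use M1 in simp)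
      finally show "M k * \<delta> k \<le> e * (1 / 2) ^ Suc k" .
    qed
    define good where "good k U \<theta> V B \<longleftrightarrow>
      \<theta> \<in> test_functions U \<and> (\<forall>x. \<bar>\<theta> x\<bar> \<le> 1) \<and>
      (\<forall>x v. \<bar>frechet_derivative \<theta> (at x) v\<bar> \<le> 2 * norm v) \<and>
      open V \<and> V \<subseteq> U \<and> measure lebesgue V \<le> \<mu> * measure lebesgue U \<and>
      (\<forall>x v. x \<in> V \<longrightarrow> frechet_derivative \<theta> (at x) v = v $ j k) \<and>
      B \<in> lmeasurable \<and> B \<subseteq> U \<and> measure lebesgue B \<le> \<delta> k \<and>
      (\<forall>x v. x \<in> U - V - B \<longrightarrow> frechet_derivative \<theta> (at x) v = - (v $ j k))"
      for k U V B and \<theta> :: "real^'n \<Rightarrow> real"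
    \<comment> \<open>One fixed choice of the lamination for every level and every set, so that the
      nested sets can be defined by recursion.\<close>
    define r where "r k U = (SOME r. good k U (fst r) (fst (snd r)) (snd (snd r)))" for k U
    have r: "good k U (fst (r k U)) (fst (snd (r k U))) (snd (snd (r k U)))" if U: "bounded U" "open U" for k U
    proof -
      have "\<exists>\<theta> V B. good k U \<theta> V B"
        by (rule lamination_step[OF U \<mu>(1) \<delta>(1)[of k], where j = "j k"], unfold good_def, intro exI conjI) blast+
      then obtain \<theta> V B where "good k U \<theta> V B" by blast
      then have "good k U (fst (\<theta>, V, B)) (fst (snd (\<theta>, V, B))) (snd (snd (\<theta>, V, B)))" by simp
      then show ?thesis unfolding r_def by (rule someI)
    qed
    define th V Bd where "th k U = fst (r k U)" and "V k U = fst (snd (r k U))" and "Bd k U = snd (snd (r k U))" for k U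
    have good: "good k U (th k U) (V k U) (Bd k U)" if "bounded U" "open U" for k U
      using r[OF that] by (simp add: th_def V_def Bd_def)
    define U where "U = rec_nat \<Omega> V"
    have U0: "U 0 = \<Omega>" and US: "U (Suc k) = V k (U k)" for k by (simp_all add: U_def)
    have bo: "bounded (U k) \<and> open (U k)" for k
    proof (induction k)
      case (Suc k)
      then show ?case using good[of "U k" k] bounded_subset unfolding good_def US by blast
    qed (use \<Omega> in \<open>simp add: U0\<close>)
    define \<theta> B where "\<theta> k = th k (U k)" and "B k = Bd k (U k)" for k
    have g: "good k (U k) (\<theta> k) (U (Suc k)) (B k)" for k
      using good[of "U k" k] bo[of k] by (simp add: \<theta>_def B_def US)
    have \<theta>: "\<theta> k \<in> test_functions (U k)" "\<bar>\<theta> k x\<bar> \<le> 1"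
      "\<bar>frechet_derivative (\<theta> k) (at x) v\<bar> \<le> 2 * norm v"
      "U (Suc k) \<subseteq> U k" "measure lebesgue (U (Suc k)) \<le> \<mu> * measure lebesgue (U k)"
      "x \<in> U (Suc k) \<Longrightarrow> frechet_derivative (\<theta> k) (at x) v = v $ j k"
      "B k \<in> lmeasurable" "B k \<subseteq> U k" "measure lebesgue (B k) \<le> \<delta> k"
      "x \<in> U k - U (Suc k) - B k \<Longrightarrow> frechet_derivative (\<theta> k) (at x) v = - (v $ j k)" for k x v
      using g[of k] unfolding good_def by blast+
    have anti: "U l \<subseteq> U k" if "k \<le> l" for k l by (rule lift_Suc_antimono_le[of U, OF \<theta>(4) that])
    have U\<Omega>: "U k \<subseteq> \<Omega>" for k using anti[of 0 k] by (simp add: U0)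
    have Ulm: "U k \<in> lmeasurable" for k using bo by (simp add: lmeasurable_open)
    have mU: "measure lebesgue (U k) \<le> \<mu> ^ k * m" for k
    proof (induction k)
      case (Suc k)
      have "measure lebesgue (U (Suc k)) \<le> \<mu> * (\<mu> ^ k * m)"
        using \<theta>(5)[of k] mult_left_mono[OF Suc, of \<mu>] \<mu> by linarith
      then show ?case by simp
    qed (simp add: U0 m_def)
    define \<Psi> :: "nat \<Rightarrow> real^'n \<Rightarrow> real^'m" where "\<Psi> k x = axis (i k) (s k * \<theta> k x)" for k x
    define J where "J k x = jacobian (\<Psi> k) (at x)" for k x
    have \<Psi>U: "\<Psi> k \<in> test_functions (U k)" for k
      unfolding \<Psi>_def using test_functions_linear[OF bounded_linear_axis \<theta>(1)] .
    have \<Psi>: "\<Psi> k \<in> test_functions \<Omega>" for k by (rule test_functions_mono[OF \<Psi>U U\<Omega>])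
    have J: "J k x = axis (i k) (s k *\<^sub>R (\<chi> b. frechet_derivative (\<theta> k) (at x) (axis b 1)))" for k x
      unfolding J_def \<Psi>_def by (rule jacobian_axis[OF \<theta>(1)])
    have nJ: "norm (J k x) \<le> 2 * \<bar>s k\<bar>" for k x
    proof -
      have "norm (\<chi> b. frechet_derivative (\<theta> k) (at x) (axis b 1)) \<le> 2"
        by (rule norm_gradient_le[OF has_derivative_linear[OF test_functions_derivative[OF \<theta>(1)]] \<theta>(3)]) simp
      from mult_left_mono[OF this, of "\<bar>s k\<bar>"] show ?thesis by (simp add: J norm_axis)
    qed
    have n\<Psi>: "norm (\<Psi> k x) \<le> \<bar>s k\<bar>" for k x
      using mult_left_mono[OF \<theta>(2)[of k x], of "\<bar>s k\<bar>"] by (simp add: \<Psi>_def norm_axis abs_mult)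
    have out: "\<Psi> k x = 0" "J k x = 0" if "x \<notin> U k" for k x
    proof -
      have x: "x \<notin> closure {x. \<Psi> k x \<noteq> 0}" using that test_functionsD(3)[OF \<Psi>U] by blast
      show "\<Psi> k x = 0" by (rule test_functions_zero_outside(1)[OF \<Psi> x])
      show "J k x = 0" unfolding J_def by (rule jacobian_zero_outside_support[OF \<Psi> x])
    qed
    have up: "J k x = D k" if "x \<in> U (Suc k)" for k x
      unfolding J D_def using \<theta>(6)[OF that] by (auto simp: vec_eq_iff axis_def)
    have down: "J k x = - D k" if "x \<in> U k - U (Suc k) - B k" for k x
      unfolding J D_def using \<theta>(10)[OF that] by (auto simp: vec_eq_iff axis_def)
    \<comment> \<open>The constant of \<open>geometric_tail_bound\<close> for terms of size at most
      \<open>2 * C * q ^ k\<close>. At a point with last level \<open>l\<close> all partial sums are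
      at most \<open>a * q ^ l\<close>, whose p-th power is one of the terms of
      \<open>w\<close>.\<close>
    define a where "a = 2 * C * q / (q - 1)"
    define w where "w x = (\<Sum>k. (a * q ^ k) powr p * indicat_real (U k) x)" for x
    have a: "a \<ge> 0" using C q by (simp add: a_def)
    have env: "integrable lebesgue w" "AE x in lebesgue. \<exists>l. x \<notin> U l"
      unfolding w_def using envelope_integrable[of U \<mu> m q p a] Ulm \<theta>(4) mU q \<mu> \<mu>1 a by auto
    \<comment> \<open>Almost every point leaves the staircase at some finite level, so the series
      for the limit function and its gradient are finite sums there.\<close>
    have last: "AE x in lebesgue_on \<Omega>. \<exists>l. x \<in> U l \<and> x \<notin> U (Suc l)"
    proof -
      have "AE x in lebesgue_on \<Omega>. x \<in> \<Omega> \<and> (\<exists>l. x \<notin> U l)"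
        using env(2) L by (auto simp: AE_restrict_space_iff elim: eventually_mono)
      then show ?thesis
      proof eventually_elim
        case (elim x)
        define l where "l = (LEAST l. x \<notin> U l)"
        have l: "x \<notin> U l" unfolding l_def using elim LeastI_ex by (metis (mono_tags, lifting))
        then obtain l' where l': "l = Suc l'" using elim U0 by (cases l) auto
        have "x \<in> U l'" using not_less_Least[of l' "\<lambda>l. x \<notin> U l"] l' by (auto simp: l_def)
        then show ?case using l l' by blast
      qed
    qed
    have beyond: "x \<notin> U k" if "x \<notin> U (Suc l)" "k > l" for x k l
      using anti[of "Suc l" k] that by auto
    have envelope_ge: "(a * q ^ l) powr p \<le> w x" if "x \<in> U l" "x \<notin> U (Suc l)" for x l
    proof -
      have "summable (\<lambda>k. (a * q ^ k) powr p * indicat_real (U k) x)"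
        by (rule summable_finite[of "{..l}"]) (use beyond[OF that(2)] in \<open>auto simp: indicator_def not_le\<close>)
      from sum_le_suminf[OF this, of "{l}"] show ?thesis using that by (simp add: w_def)
    qed
    have series: "(\<lambda>k. \<Sum>l<k. y l x) \<longlonglongrightarrow> (\<Sum>l. y l x)" "(\<Sum>k. y k x) = (\<Sum>k\<le>l. y k x)"
      "norm (\<Sum>l<k. y l x) powr p \<le> w x"
      if "\<And>k x. x \<notin> U k \<Longrightarrow> y k x = 0" "\<And>k x. norm (y k x) \<le> 2 * \<bar>s k\<bar>" "x \<in> U l" "x \<notin> U (Suc l)"
      for y :: "nat \<Rightarrow> real^'n \<Rightarrow> 'z::euclidean_space" and x l k
    proof -
      have y0: "y k x = 0" if "k \<notin> {..l}" for k
        using that(1) beyond[OF \<open>x \<notin> U (Suc l)\<close>, of k] \<open>\<And>k x. x \<notin> U k \<Longrightarrow> y k x = 0\<close> by auto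
      show "(\<lambda>k. \<Sum>l<k. y l x) \<longlonglongrightarrow> (\<Sum>l. y l x)"
        by (rule summable_LIMSEQ[OF summable_finite[OF finite_atMost y0]])
      show "(\<Sum>k. y k x) = (\<Sum>k\<le>l. y k x)" by (rule suminf_finite[OF finite_atMost y0])
      have "norm (\<Sum>l<k. y l x) \<le> 2 * C * q / (q - 1) * q ^ l"
      proof (rule geometric_tail_bound[OF q])
        show "norm (y k x) \<le> 2 * C * q ^ k" for k using that(2)[of k x] s[of k] by simp
      qed (use y0 in auto)
      then have "norm (\<Sum>l<k. y l x) powr p \<le> (a * q ^ l) powr p"
        unfolding a_def using p by (intro powr_mono2) auto
      also have "\<dots> \<le> w x" by (rule envelope_ge[OF that(3,4)])
      finally show "norm (\<Sum>l<k. y l x) powr p \<le> w x" .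
    qed
    have n\<Psi>2: "norm (\<Psi> k x) \<le> 2 * \<bar>s k\<bar>" for k x using n\<Psi>[of k x] by simp
    define S where "S k x = (\<Sum>l<k. \<Psi> l x)" for k x
    have S: "S k \<in> test_functions \<Omega>" for k
      unfolding S_def by (rule test_functions_sum[OF \<Psi>])
    have JS: "jacobian (S k) (at x) = (\<Sum>l<k. J l x)" for k x
      unfolding S_def J_def by (rule jacobian_sum[OF \<Psi>])
    define u where "u x = (\<Sum>k. \<Psi> k x)" for x
    define G where "G x = (\<Sum>k. J k x)" for x
    have "u \<in> W1p_0 p \<Omega> \<and> has_weak_gradient u G \<Omega>"
    proof (rule W1p_0_dominated_limit[OF p \<Omega>(2,3) S])
      show "u \<in> borel_measurable (lebesgue_on \<Omega>)" unfolding u_def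
        by (intro borel_measurable_suminf borel_measurable_integrable test_functions_integrable[OF \<Psi> L])
      show "G \<in> borel_measurable (lebesgue_on \<Omega>)" unfolding G_def J_def
        by (intro borel_measurable_suminf borel_measurable_integrable jacobian_integrable[OF \<Psi> L])
      show "integrable (lebesgue_on \<Omega>) w" by (rule integrable_lebesgue_on_if[OF env(1) L])
      show "AE x in lebesgue_on \<Omega>. (\<lambda>k. S k x) \<longlonglongrightarrow> u x"
        using last by eventually_elim (use series(1)[of \<Psi>, OF out(1) n\<Psi>2] in \<open>auto simp: S_def u_def\<close>)
      show "AE x in lebesgue_on \<Omega>. (\<lambda>k. jacobian (S k) (at x)) \<longlonglongrightarrow> G x"
        using last by eventually_elim (use series(1)[of J, OF out(2) nJ] in \<open>auto simp: JS G_def\<close>)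
      show "AE x in lebesgue_on \<Omega>. \<forall>k. norm (S k x) powr p \<le> w x"
        using last by eventually_elim (use series(3)[of \<Psi>, OF out(1) n\<Psi>2] in \<open>auto simp: S_def\<close>)
      show "AE x in lebesgue_on \<Omega>. \<forall>k. norm (jacobian (S k) (at x)) powr p \<le> w x"
        using last by eventually_elim (use series(3)[of J, OF out(2) nJ] in \<open>auto simp: JS\<close>)
    qed
    then have qcu: "ereal (m * f (X 0)) \<le> ereal_integral (lebesgue_on \<Omega>) (\<lambda>x. ereal (f (X 0 + G x)))"
      using test[of u G] by (simp add: m_def)
    \<comment> \<open>A majorant of the integrand. Level \<open>k\<close> is charged
      \<open>c k\<close> on all of \<open>U k\<close>, although that bound is used only at points
      that leave at this level, and \<open>M k\<close> on the bad set.\<close>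
    define h where "h k x = ennreal (c k) * indicator (U k) x + ennreal (M k) * indicator (B k) x" for k x
    have Xsum: "X 0 + (\<Sum>k<l. D k) = X l" for l
      by (induction l) (simp_all add: X D_def algebra_simps)
    have "AE x in lebesgue_on \<Omega>. e2ennreal (ereal (f (X 0 + G x))) \<le> (\<Sum>k. h k x)"
      using last
    proof eventually_elim
      case (elim x)
      then obtain l where l: "x \<in> U l" "x \<notin> U (Suc l)" by blast
      \<comment> \<open>Every layer before the last contributes its full jump \<open>D k\<close>,
        since the point still belongs to \<open>U (Suc k)\<close>; with \<open>X 0\<close> these
        jumps add up to \<open>X l\<close>.\<close>
      have "G x = (\<Sum>k\<le>l. J k x)" unfolding G_def by (rule series(2)[of J, OF out(2) nJ l])
      also have "\<dots> = (\<Sum>k<l. J k x) + J l x" by (simp add: lessThan_Suc_atMost[symmetric])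
      also have "(\<Sum>k<l. J k x) = (\<Sum>k<l. D k)"
      proof (rule sum.cong[OF refl])
        fix k assume "k \<in> {..<l}"
        then show "J k x = D k" using anti[of "Suc k" l] l(1) by (intro up) auto
      qed
      finally have "X 0 + G x = X 0 + (\<Sum>k<l. D k) + J l x" by (simp add: add.assoc)
      then have G: "X 0 + G x = X l + J l x" by (simp only: Xsum)
      have "ennreal (f (X 0 + G x)) \<le> h l x"
      proof (cases "x \<in> B l")
        case True
        have "f (X 0 + G x) \<le> M l" unfolding G by (rule M(2)) (simp add: nJ)
        then have "ennreal (f (X 0 + G x)) \<le> ennreal (M l)" by (rule ennreal_leI)
        then show ?thesis using True by (simp add: h_def add_increasing)
      next
        case False
        then have "X 0 + G x = X l - D l" using down[of x l] l by (simp add: G)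
        then have "f (X 0 + G x) \<le> c l" using c(1)[of l] by (simp add: D_def)
        then have "ennreal (f (X 0 + G x)) \<le> ennreal (c l)" by (rule ennreal_leI)
        then show ?thesis using l by (simp add: h_def add_increasing2)
      qed
      also have "h l x \<le> (\<Sum>k. h k x)"
        using sum_le_suminf[of "\<lambda>k. h k x" "{l}"] by simp
      finally show ?case by (simp add: e2ennreal_ereal)
    qed
    from ereal_integral_le_nn[OF qcu this]
    have "ereal (m * f (X 0)) \<le> enn2ereal (\<integral>\<^sup>+ x. (\<Sum>k. h k x) \<partial>lebesgue_on \<Omega>)" .
    also have "(\<integral>\<^sup>+ x. (\<Sum>k. h k x) \<partial>lebesgue_on \<Omega>) \<le> ennreal (m * (\<Sum>k. \<mu> ^ k * c k) + e)"
    proof -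
      have sU: "U k \<in> sets (lebesgue_on \<Omega>)" "emeasure (lebesgue_on \<Omega>) (U k) = ennreal (measure lebesgue (U k))" for k
        using U\<Omega>[of k] Ulm[of k] L
        by (auto simp: sets_restrict_space_iff emeasure_restrict_space emeasure_eq_measure2 fmeasurableD)
      have sB: "B k \<in> sets (lebesgue_on \<Omega>)" "emeasure (lebesgue_on \<Omega>) (B k) = ennreal (measure lebesgue (B k))" for k
        using \<theta>(8)[of k] U\<Omega>[of k] \<theta>(7)[of k] L
        by (auto simp: sets_restrict_space_iff emeasure_restrict_space emeasure_eq_measure2 fmeasurableD)
      have ik: "(\<integral>\<^sup>+ x. h k x \<partial>lebesgue_on \<Omega>) \<le> ennreal (m * (\<mu> ^ k * c k) + e * (1 / 2) ^ Suc k)" for k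
      proof -
        have "(\<integral>\<^sup>+ x. h k x \<partial>lebesgue_on \<Omega>)
            = ennreal (c k) * ennreal (measure lebesgue (U k)) + ennreal (M k) * ennreal (measure lebesgue (B k))"
          unfolding h_def using sU[of k] sB[of k]
          by (subst nn_integral_add) (auto simp: nn_integral_cmult_indicator)
        also have "\<dots> = ennreal (c k * measure lebesgue (U k) + M k * measure lebesgue (B k))"
          using c(2) M(1) by (simp add: ennreal_mult ennreal_plus)
        also have "\<dots> \<le> ennreal (m * (\<mu> ^ k * c k) + e * (1 / 2) ^ Suc k)"
        proof (intro ennreal_leI add_mono)
          show "c k * measure lebesgue (U k) \<le> m * (\<mu> ^ k * c k)"
            using mult_left_mono[OF mU[of k] c(2)[of k]] by (simp add: mult_ac)
          show "M k * measure lebesgue (B k) \<le> e * (1 / 2) ^ Suc k"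
            using mult_left_mono[OF \<theta>(9)[of k] M(1)[of k]] \<delta>(2)[of k] by linarith
        qed
        finally show ?thesis .
      qed
      have sums: "(\<lambda>k. m * (\<mu> ^ k * c k) + e * (1 / 2) ^ Suc k) sums (m * (\<Sum>k. \<mu> ^ k * c k) + e * 1)"
        by (intro sums_add sums_mult summable_sums[OF sumc] power_half_series)
      have "(\<integral>\<^sup>+ x. (\<Sum>k. h k x) \<partial>lebesgue_on \<Omega>) = (\<Sum>k. \<integral>\<^sup>+ x. h k x \<partial>lebesgue_on \<Omega>)"
        by (rule nn_integral_suminf) (use sU sB in \<open>auto simp: h_def\<close>)
      also have "\<dots> \<le> (\<Sum>k. ennreal (m * (\<mu> ^ k * c k) + e * (1 / 2) ^ Suc k))"
        by (intro suminf_le ik) auto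
      also have "\<dots> = ennreal (\<Sum>k. m * (\<mu> ^ k * c k) + e * (1 / 2) ^ Suc k)"
        using c(2) m e \<mu> sums by (intro suminf_ennreal2) (auto simp: sums_iff intro!: add_nonneg_nonneg)
      also have "\<dots> = ennreal (m * (\<Sum>k. \<mu> ^ k * c k) + e)" using sums by (simp add: sums_iff)
      finally show ?thesis .
    qed
    also have "enn2ereal (ennreal (m * (\<Sum>k. \<mu> ^ k * c k) + e)) = ereal (m * (\<Sum>k. \<mu> ^ k * c k) + e)"
      using c(2) m e \<mu> by (intro enn2ereal_ennreal add_nonneg_nonneg mult_nonneg_nonneg suminf_nonneg sumc) auto
    finally show "f (X 0) * m \<le> (\<Sum>k. \<mu> ^ k * c k) * m + e"
      by (simp add: mult.commute less_eq_ennreal.rep_eq)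
  qed
  then show ?thesis using m by simp
qed

section \<open>Linear growth\<close>

text \<open>The estimates use the Euclidean norm; this transfers the growth conditions from \<nu>
  and back. The second constant comes from the minimum of \<nu> on the unit sphere, where \<nu> is
  continuous by its Lipschitz bound.\<close>

lemma is_norm_equivalent:
  fixes \<nu> :: "'a::euclidean_space \<Rightarrow> real"
  assumes "is_norm \<nu>"
  obtains A B where "A > 0" "B > 0" "\<And>x. \<nu> x \<le> A * norm x" "\<And>x. norm x \<le> B * \<nu> x"
proof -
  have \<nu>: "\<nu> x \<ge> 0" "\<nu> x = 0 \<longleftrightarrow> x = 0" "\<nu> (a *\<^sub>R x) = \<bar>a\<bar> * \<nu> x" "\<nu> (x + y) \<le> \<nu> x + \<nu> y" for a x y
    using assms by (simp_all add: is_norm_def)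
  have \<nu>0: "\<nu> 0 = 0" using \<nu>(2) by blast
  have sum: "\<nu> (\<Sum>i\<in>I. g i) \<le> (\<Sum>i\<in>I. \<nu> (g i))" if "finite I" for I :: "'a set" and g
    using that
  proof (induction I)
    case (insert i I)
    then show ?case using \<nu>(4)[of "g i" "\<Sum>i\<in>I. g i"] by simp
  qed (simp add: \<nu>0)
  define A where "A = (\<Sum>b\<in>Basis. \<nu> (b :: 'a)) + 1"
  have A: "A > 0" by (simp add: A_def \<nu>(1) add_nonneg_pos sum_nonneg)
  have upper: "\<nu> x \<le> A * norm x" for x
  proof -
    have "\<nu> x = \<nu> (\<Sum>b\<in>Basis. (x \<bullet> b) *\<^sub>R b)" by (simp add: euclidean_representation)
    also have "\<dots> \<le> (\<Sum>b\<in>Basis. \<bar>x \<bullet> b\<bar> * \<nu> b)" using sum[OF finite_Basis, of "\<lambda>b. (x \<bullet> b) *\<^sub>R b"] by (simp only: \<nu>(3))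
    also have "\<dots> \<le> (\<Sum>b\<in>Basis. norm x * \<nu> b)"
      by (intro sum_mono mult_right_mono \<nu>(1)) (simp add: Basis_le_norm)
    also have "\<dots> \<le> A * norm x" by (simp add: A_def sum_distrib_left[symmetric] algebra_simps)
    finally show ?thesis .
  qed
  have lip: "\<bar>\<nu> x - \<nu> y\<bar> \<le> A * norm (x - y)" for x y
  proof -
    have "\<nu> x \<le> \<nu> y + \<nu> (x - y)" using \<nu>(4)[of y "x - y"] by simp
    moreover have "\<nu> y \<le> \<nu> x + \<nu> (y - x)" using \<nu>(4)[of x "y - x"] by simp
    ultimately show ?thesis using upper[of "x - y"] upper[of "y - x"] by (simp add: norm_minus_commute)
  qed
  have "A-lipschitz_on UNIV \<nu>"
    by (rule lipschitz_onI) (use lip A in \<open>auto simp: dist_norm\<close>)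
  then have "continuous_on (sphere 0 1) \<nu>"
    using lipschitz_on_continuous_on continuous_on_subset by blast
  moreover have "sphere (0::'a) 1 \<noteq> {}" by simp
  ultimately obtain z where z: "z \<in> sphere 0 1" "\<And>y. y \<in> sphere 0 1 \<Longrightarrow> \<nu> z \<le> \<nu> y"
    using continuous_attains_inf[of "sphere 0 1" \<nu>] by auto
  have nz: "\<nu> z > 0" using z(1) \<nu>(1,2)[of z] by (metis dist_0_norm less_eq_real_def mem_sphere norm_zero zero_neq_one)
  have lower: "norm x \<le> (1 / \<nu> z) * \<nu> x" for x
  proof (cases "x = 0")
    case False
    then have "\<nu> z \<le> \<nu> ((1 / norm x) *\<^sub>R x)" by (intro z(2)) simp
    then show ?thesis using False nz by (simp add: \<nu>(3) field_simps)
  qed (use \<nu> in simp)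
  show thesis using that[OF A _ upper lower] nz by simp
qed

section \<open>Growth along sums of elementary matrices\<close>

lemma rank_axis_axis_le: "rank (axis i (axis j c) :: real^'n^'m) \<le> 1"
proof -
  have "columns (axis i (axis j c) :: real^'n^'m) \<subseteq> span {axis i 1}"
  proof
    fix v assume "v \<in> columns (axis i (axis j c) :: real^'n^'m)"
    then obtain b where "v = column b (axis i (axis j c) :: real^'n^'m)" by (auto simp: columns_def)
    then have "v = (axis j c $ b) *\<^sub>R axis i 1" by (auto simp: column_def vec_eq_iff axis_def)
    then show "v \<in> span {axis i 1}" by (simp add: span_base span_scale)
  qed
  from dim_le_card[OF this] show ?thesis by (simp add: column_rank_def)
qed

text \<open>Jumps double only at every second step, hence the rate \<open>sqrt 2\<close> per step
  that serves as \<open>q\<close>.\<close>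

lemma two_power_div_2_le: "2 ^ (k div 2) \<le> sqrt 2 ^ k"
proof -
  have "(2::real) ^ (k div 2) = sqrt 2 ^ (2 * (k div 2))" by (simp add: power_mult)
  also have "\<dots> \<le> sqrt 2 ^ k" by (intro power_increasing) auto
  finally show ?thesis .
qed

text \<open>The lines are parametrised so that the two summands correspond to t = 1; their size then
  enters only through \<open>K\<close>. Since \<open>M\<close> does not depend on the matrices, the
  estimate is homogeneous in \<open>K\<close>, which is what makes it usable in the induction over
  the entries.\<close>

lemma quasiconvex_two_directions_bound:
  assumes p: "1 \<le> p" "p < 2"
  obtains M where "M \<ge> 0"
    "\<And>f K Z i j a i' j' b. continuous_on UNIV f \<Longrightarrow> (\<And>\<xi>. W1p_quasiconvex_at p (\<lambda>\<xi>. ereal (f \<xi>)) \<xi>) \<Longrightarrow>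
      K \<ge> 0 \<Longrightarrow>
      (\<And>t. f (Z + axis i (axis j (t * a))) \<le> K * (1 + \<bar>t\<bar>)) \<Longrightarrow>
      (\<And>t. f (Z + axis i' (axis j' (t * b))) \<le> K * (1 + \<bar>t\<bar>)) \<Longrightarrow>
      f (Z + axis i (axis j a) + axis i' (axis j' b) :: real^'n^'m) \<le> K * M"
proof -
  define q :: real where "q = sqrt 2"
  \<comment> \<open>Any \<open>\<mu> > 1 / 2\<close> with \<open>\<mu> * 2 powr (p / 2) < 1\<close> works; it exists since \<open>p < 2\<close>.\<close>
  define \<mu> :: real where "\<mu> = 2 powr (- (p + 2) / 4)"
  have q: "q > 1" by (simp add: q_def)
  have q2: "q = 2 powr (1 / 2)" by (simp add: q_def powr_half_sqrt)
  have \<mu>: "1 / 2 < \<mu>" "\<mu> * q powr p < 1" "\<mu> * q < 1" "0 < \<mu>" "\<mu> < 1"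
  proof -
    have "(2::real) powr (-1) < \<mu>" unfolding \<mu>_def using p by (intro powr_less_mono) auto
    then show "1 / 2 < \<mu>" by (simp add: powr_minus_divide)
    have "\<mu> * q powr p = 2 powr ((p - 2) / 4)"
      by (simp add: \<mu>_def q2 powr_powr powr_add[symmetric] field_simps)
    also have "\<dots> < 2 powr 0" using p by (intro powr_less_mono) auto
    finally show "\<mu> * q powr p < 1" by simp
    have "\<mu> * q = 2 powr (- p / 4)"
      by (simp add: \<mu>_def q2 powr_add[symmetric] field_simps)
    also have "\<dots> < 2 powr 0" using p by (intro powr_less_mono) auto
    finally show mq: "\<mu> * q < 1" by simp
    show "0 < \<mu>" by (simp add: \<mu>_def)
    then have "\<mu> * 1 < \<mu> * q" using q by (intro mult_strict_left_mono)
    then show "\<mu> < 1" using mq by linarith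
  qed
  \<comment> \<open>The sum of \<mu>^k (1 + 2 q^k): the linear bounds at the matrices left behind,
    weighted by measure.\<close>
  define M where "M = 1 / (1 - \<mu>) + 2 * (1 / (1 - \<mu> * q))"
  have sums: "(\<lambda>k. \<mu> ^ k * (K * (1 + 2 * q ^ k))) sums (K * M)" for K
  proof -
    have "(\<lambda>k. K * (\<mu> ^ k + 2 * (\<mu> * q) ^ k)) sums (K * M)" unfolding M_def
      by (intro sums_mult sums_add geometric_sums) (use \<mu> q in auto)
    then show ?thesis by (simp add: algebra_simps power_mult_distrib)
  qed
  show thesis
  proof (rule that[of M])
    show "M \<ge> 0" using \<mu> by (simp add: M_def)
    fix f :: "real^'n^'m \<Rightarrow> real" and K Z i j a i' j' b
    assume cf: "continuous_on UNIV f" and qc: "\<And>\<xi>. W1p_quasiconvex_at p (\<lambda>\<xi>. ereal (f \<xi>)) \<xi>"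
      and K: "K \<ge> 0"
      and h1: "\<And>t. f (Z + axis i (axis j (t * a))) \<le> K * (1 + \<bar>t\<bar>)"
      and h2: "\<And>t. f (Z + axis i' (axis j' (t * b))) \<le> K * (1 + \<bar>t\<bar>)"
    \<comment> \<open>Even steps double the coefficient of the first direction, odd steps that of
      the second; \<open>X 0\<close> is the matrix to be estimated.\<close>
    define X :: "nat \<Rightarrow> real^'n^'m" where
      "X k = Z + axis i (axis j (2 ^ (Suc k div 2) * a)) + axis i' (axis j' (2 ^ (k div 2) * b))" for k
    define ik jk sk where "ik k = (if even k then i else i')" and "jk k = (if even k then j else j')"
      and "sk k = 2 ^ (k div 2) * (if even k then a else b)" for k :: nat
    have "f (X 0) \<le> (\<Sum>k. \<mu> ^ k * (K * (1 + 2 * q ^ k)))"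
    proof (rule quasiconvex_staircase_bound[where X = X and i = ik and j = jk and s = sk
          and C = "max \<bar>a\<bar> \<bar>b\<bar>", OF p(1) cf qc _ _ q \<mu>(1,2)])
      show "X (Suc k) = X k + axis (ik k) (axis (jk k) (sk k))" for k
      proof (cases "even k")
        case True
        then obtain r where "k = 2 * r" by (rule evenE)
        then show ?thesis by (auto simp: X_def ik_def jk_def sk_def vec_eq_iff axis_def)
      next
        case False
        then obtain r where "k = 2 * r + 1" by (rule oddE)
        then show ?thesis by (auto simp: X_def ik_def jk_def sk_def vec_eq_iff axis_def)
      qed
      show "\<bar>sk k\<bar> \<le> max \<bar>a\<bar> \<bar>b\<bar> * q ^ k" for k
        using mult_mono[OF two_power_div_2_le[of k], of "\<bar>if even k then a else b\<bar>" "max \<bar>a\<bar> \<bar>b\<bar>"]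
        by (auto simp: sk_def q_def abs_mult mult.commute)
      \<comment> \<open>The jump equals the current coefficient, so subtracting it removes that
        direction altogether. For k = 2 r this leaves the second line at t = 2^r, for k = 2 r + 1
        the first line at t = 2^(r + 1), which is twice 2^(k div 2); hence the factor 2.\<close>
      show "f (X k - axis (ik k) (axis (jk k) (sk k))) \<le> K * (1 + 2 * q ^ k)" for k
      proof -
        have q: "2 ^ (k div 2) \<le> q ^ k" unfolding q_def by (rule two_power_div_2_le)
        have "f (X k - axis (ik k) (axis (jk k) (sk k))) \<le> K * (1 + 2 * 2 ^ (k div 2))"
        proof (cases "even k")
          case True
          then obtain r where r: "k = 2 * r" by (rule evenE)
          have "f (X k - axis (ik k) (axis (jk k) (sk k))) \<le> K * (1 + \<bar>2 ^ r\<bar>)"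
            using h2[of "2 ^ r"] r by (simp add: X_def ik_def jk_def sk_def)
          also have "\<dots> \<le> K * (1 + 2 * 2 ^ (k div 2))" using K r by (intro mult_left_mono) auto
          finally show ?thesis .
        next
          case False
          then obtain r where r: "k = 2 * r + 1" by (rule oddE)
          show ?thesis
            using h1[of "2 ^ Suc r"] r by (simp add: X_def ik_def jk_def sk_def)
        qed
        also have "\<dots> \<le> K * (1 + 2 * q ^ k)" using K q by (intro mult_left_mono) auto
        finally show ?thesis .
      qed
      show "0 \<le> K * (1 + 2 * q ^ k)" for k using K q by simp
      show "summable (\<lambda>k. \<mu> ^ k * (K * (1 + 2 * q ^ k)))" using sums by (rule sums_summable)
    qed
    then show "f (Z + axis i (axis j a) + axis i' (axis j' b)) \<le> K * M"
      using sums[of K] by (simp add: sums_iff X_def)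
  qed
qed

text \<open>The induction is over sets \<open>I\<close> of matrix positions, with all coefficients
  left free, so that its hypothesis covers entire lines. With at most one position the matrix has
  rank at most 1; with two or more, omitting one of two chosen positions gives the growth along the
  line of the other.\<close>

lemma quasiconvex_linear_growth:
  fixes f :: "real^'n^'m \<Rightarrow> real"
  assumes p: "1 \<le> p" "p < 2" and cf: "continuous_on UNIV f"
    and qc: "\<And>\<xi>. W1p_quasiconvex_at p (\<lambda>\<xi>. ereal (f \<xi>)) \<xi>"
    and L: "L \<ge> 0" "\<And>\<xi>. rank \<xi> \<le> 1 \<Longrightarrow> f \<xi> \<le> L * (1 + norm \<xi>)"
  obtains K where "K \<ge> 0" "\<And>\<xi>. f \<xi> \<le> K * (1 + norm \<xi>)"
proof -
  obtain M where M: "M \<ge> 0"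
    "\<And>K Z i j a i' j' b. K \<ge> 0 \<Longrightarrow>
      (\<And>t. f (Z + axis i (axis j (t * a))) \<le> K * (1 + \<bar>t\<bar>)) \<Longrightarrow>
      (\<And>t. f (Z + axis i' (axis j' (t * b))) \<le> K * (1 + \<bar>t\<bar>)) \<Longrightarrow>
      f (Z + axis i (axis j a) + axis i' (axis j' b)) \<le> K * M"
    using quasiconvex_two_directions_bound[OF p, where 'n = 'n and 'm = 'm] cf qc by metis
  define E :: "'m \<times> 'n \<Rightarrow> real \<Rightarrow> real^'n^'m" where "E z t = axis (fst z) (axis (snd z) t)" for z t
  have "\<exists>K\<ge>0. \<forall>c. f (\<Sum>z\<in>I. E z (c z)) \<le> K * (1 + (\<Sum>z\<in>I. \<bar>c z\<bar>))" if "finite I" for I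
    using that
  proof (induction I rule: finite_psubset_induct)
    case (psubset I)
    show ?case
    proof (cases "\<exists>z z'. z \<in> I \<and> z' \<in> I \<and> z \<noteq> z'")
      case False
      then consider "I = {}" | z where "I = {z}" by blast
      then show ?thesis
      proof cases
        case 1
        then show ?thesis by (intro exI[of _ "\<bar>f 0\<bar>"]) auto
      next
        case (2 z)
        have "f (E z t) \<le> L * (1 + \<bar>t\<bar>)" for t
          using L(2)[OF rank_axis_axis_le, of "fst z" "snd z" t] by (simp add: E_def norm_axis)
        then show ?thesis using 2 L(1) by (intro exI[of _ L]) simp
      qed
    next
      case True
      then obtain z z' where z: "z \<in> I" "z' \<in> I" "z \<noteq> z'" by blast
      obtain K1 where K1: "K1 \<ge> 0" "\<And>c. f (\<Sum>z\<in>I - {z'}. E z (c z)) \<le> K1 * (1 + (\<Sum>z\<in>I - {z'}. \<bar>c z\<bar>))"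
        using psubset.IH[of "I - {z'}"] z by blast
      obtain K2 where K2: "K2 \<ge> 0" "\<And>c. f (\<Sum>z\<in>I - {z}. E z (c z)) \<le> K2 * (1 + (\<Sum>z\<in>I - {z}. \<bar>c z\<bar>))"
        using psubset.IH[of "I - {z}"] z by blast
      define K where "K = max K1 K2"
      let ?I = "I - {z, z'}"
      have "f (\<Sum>z\<in>I. E z (c z)) \<le> (K * M) * (1 + (\<Sum>z\<in>I. \<bar>c z\<bar>))" for c
      proof -
        define S where "S = (\<Sum>z\<in>I. \<bar>c z\<bar>)"
        define Z where "Z = (\<Sum>z\<in>?I. E z (c z))"
        have S0: "S \<ge> 0" by (simp add: S_def sum_nonneg)
        have ins: "I - {z'} = insert z ?I" "I - {z} = insert z' ?I" "I = insert z (insert z' ?I)"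
          using z by auto
        have fin: "finite ?I" using psubset by simp
        \<comment> \<open>The bound separates into a factor \<open>1 + S\<close> that measures the
          matrix and a factor \<open>1 + \<bar>t\<bar>\<close> along the line. The first becomes
          part of the growth constant, and the two-direction bound passes it on linearly.\<close>
        have line: "f (Z + E y (t * c y)) \<le> (K * (1 + S)) * (1 + \<bar>t\<bar>)"
          if y: "y \<in> I" "y \<notin> ?I" and K': "K' \<ge> 0" "K' \<le> K"
            and h: "\<And>c. f (\<Sum>z\<in>insert y ?I. E z (c z)) \<le> K' * (1 + (\<Sum>z\<in>insert y ?I. \<bar>c z\<bar>))" for y t K'
        proof -
          let ?c = "c(y := t * c y)"
          have "(\<Sum>z\<in>?I. E z (?c z)) = Z" unfolding Z_def using y by (intro sum.cong) auto
          moreover have eq: "(\<Sum>z\<in>?I. \<bar>?c z\<bar>) = (\<Sum>z\<in>?I. \<bar>c z\<bar>)" using y by (intro sum.cong) auto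
          ultimately have "f (Z + E y (t * c y)) \<le> K' * (1 + (\<bar>t\<bar> * \<bar>c y\<bar> + (\<Sum>z\<in>?I. \<bar>c z\<bar>)))"
            using h[of ?c] y fin by (simp add: add.commute abs_mult)
          also have "\<dots> \<le> K' * ((1 + S) * (1 + \<bar>t\<bar>))"
          proof (rule mult_left_mono[OF _ K'(1)])
            have "(\<Sum>z\<in>insert y ?I. \<bar>c z\<bar>) \<le> S" unfolding S_def
              using y psubset by (intro sum_mono2) auto
            then have "\<bar>c y\<bar> + (\<Sum>z\<in>?I. \<bar>c z\<bar>) \<le> S" using y fin by simp
            moreover have "(\<Sum>z\<in>?I. \<bar>c z\<bar>) \<ge> 0" by (simp add: sum_nonneg)
            ultimately have "\<bar>c y\<bar> \<le> S" "(\<Sum>z\<in>?I. \<bar>c z\<bar>) \<le> S" by linarith+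
            moreover from this have "\<bar>t\<bar> * \<bar>c y\<bar> \<le> \<bar>t\<bar> * S" by (intro mult_left_mono) auto
            ultimately show "1 + (\<bar>t\<bar> * \<bar>c y\<bar> + (\<Sum>z\<in>?I. \<bar>c z\<bar>)) \<le> (1 + S) * (1 + \<bar>t\<bar>)"
              by (simp add: algebra_simps)
          qed
          also have "\<dots> \<le> K * ((1 + S) * (1 + \<bar>t\<bar>))" using K' S0 by (intro mult_right_mono) auto
          finally show ?thesis by (simp add: mult.assoc)
        qed
        have "f (Z + E z (c z) + E z' (c z')) \<le> (K * (1 + S)) * M"
          unfolding E_def
        proof (rule M(2))
          show "0 \<le> K * (1 + S)" using K1 S0 by (simp add: K_def)
          show "f (Z + axis (fst z) (axis (snd z) (t * c z))) \<le> K * (1 + S) * (1 + \<bar>t\<bar>)" for t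
            using line[of z K1 t] z K1 by (simp add: E_def K_def ins(1)[symmetric])
          show "f (Z + axis (fst z') (axis (snd z') (t * c z'))) \<le> K * (1 + S) * (1 + \<bar>t\<bar>)" for t
            using line[of z' K2 t] z K2 by (simp add: E_def K_def ins(2)[symmetric])
        qed
        moreover have "(\<Sum>z\<in>I. E z (c z)) = Z + E z (c z) + E z' (c z')"
          unfolding Z_def by (subst ins(3)) (use z fin in \<open>simp add: add_ac\<close>)
        ultimately show ?thesis by (simp add: S_def mult_ac)
      qed
      moreover have "K * M \<ge> 0" using K1 M(1) by (simp add: K_def)
      ultimately show ?thesis by blast
    qed
  qed
  from this[of UNIV] obtain K where K: "K \<ge> 0"
    "\<And>c. f (\<Sum>z\<in>UNIV. E z (c z)) \<le> K * (1 + (\<Sum>z\<in>UNIV. \<bar>c z\<bar>))" by auto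
  define N where "N = real (card (UNIV :: ('m \<times> 'n) set))"
  have "f \<xi> \<le> (K * (1 + N)) * (1 + norm \<xi>)" for \<xi>
  proof -
    let ?c = "\<lambda>z. \<xi> $ fst z $ snd z"
    have "(\<Sum>z\<in>UNIV. E z (?c z)) = \<xi>"
    proof -
      have "E z (?c z) $ r $ t = (if z = (r, t) then \<xi> $ r $ t else 0)" for z r t
        by (cases z) (auto simp: E_def axis_def)
      then show ?thesis by (simp add: vec_eq_iff)
    qed
    moreover have "(\<Sum>z\<in>UNIV. \<bar>?c z\<bar>) \<le> N * norm \<xi>"
      unfolding N_def
      by (rule sum_bounded_above) (metis component_le_norm_cart Finite_Cartesian_Product.norm_nth_le order_trans)
    ultimately have "f \<xi> \<le> K * (1 + N * norm \<xi>)"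
      using K(2)[of ?c] mult_left_mono[of "1 + (\<Sum>z\<in>UNIV. \<bar>?c z\<bar>)" "1 + N * norm \<xi>" K] K(1) by simp
    also have "\<dots> \<le> K * ((1 + N) * (1 + norm \<xi>))"
      using K(1) by (intro mult_left_mono) (auto simp: N_def algebra_simps)
    finally show ?thesis by (simp add: mult.assoc)
  qed
  moreover have "K * (1 + N) \<ge> 0" using K by (simp add: N_def)
  ultimately show thesis by (rule that[rotated])
qed

section \<open>Quasiconvexity for the exponent 1\<close>

text \<open>A one-sided form of the fundamental lemma of the calculus of variations. Cutoffs that
  shrink to a compact set show that \<open>g\<close> has integral 0 over it. Up to a null set, the
  points where \<open>g\<close> is positive form a countable union of compact sets, and each of
  these must then be null.\<close>

lemma integral_test_functions_eq_0_imp_AE_nonpos: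
  fixes g :: "'a::euclidean_space \<Rightarrow> real"
  assumes \<Omega>: "open \<Omega>" and g: "locally_integrable_on g \<Omega>"
    and zero: "\<And>\<psi>. \<psi> \<in> test_functions \<Omega> \<Longrightarrow> (LINT x|lebesgue_on \<Omega>. g x * \<psi> x) = 0"
  shows "AE x in lebesgue_on \<Omega>. g x \<le> 0"
proof -
  let ?M = "lebesgue_on \<Omega>"
  have L: "\<Omega> \<in> sets lebesgue" by (rule open_sets_lebesgue[OF \<Omega>])
  have mg: "g \<in> borel_measurable ?M" using g by (simp add: locally_integrable_on_def)
  have compact: "(LINT x|lebesgue_on K. g x) = 0" if K: "compact K" "K \<subseteq> \<Omega>" "K \<noteq> {}" for K
  proof -
    obtain \<eta> :: "'a \<Rightarrow> real" and W where \<eta>: "\<eta> \<in> test_functions \<Omega>" "\<And>x. 0 \<le> \<eta> x" "\<And>x. \<eta> x \<le> 1"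
      and W: "open W" "K \<subseteq> W" "W \<subseteq> \<Omega>" "\<And>x. x \<in> W \<Longrightarrow> \<eta> x = 1"
      using smooth_cutoff[OF K(1) \<Omega> K(2)] by metis
    define K1 where "K1 = closure {x. \<eta> x \<noteq> 0}"
    have K1: "compact K1" "K1 \<subseteq> \<Omega>" using test_functionsD[OF \<eta>(1)] by (simp_all only: K1_def)
    have WK1: "W \<subseteq> K1" using W(4) closure_subset[of "{x. \<eta> x \<noteq> 0}"] by (force simp: K1_def)
    have LK: "K \<in> sets lebesgue" and LK1: "K1 \<in> sets lebesgue"
      using K(1) K1(1) by (simp_all add: lmeasurable_compact fmeasurableD)
    \<comment> \<open>\<open>W\<close> keeps all supports inside the fixed compact set
      \<open>K1\<close>, on which \<open>g\<close> is integrable; this supplies the majorant. The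
      condition on the distance makes the cutoffs converge to the indicator of
      \<open>K\<close>.\<close>
    define V where "V n = W \<inter> {x. infdist x K < inverse (real (Suc n))}" for n
    have V: "open (V n)" "K \<subseteq> V n" for n
    proof -
      have "open {x. infdist x K < inverse (real (Suc n))}"
        by (intro open_Collect_less continuous_intros)
      then show "open (V n)" unfolding V_def using W(1) by (intro open_Int)
      show "K \<subseteq> V n" using W(2) by (auto simp: V_def)
    qed
    have "\<exists>\<psi>. \<psi> \<in> test_functions (V n) \<and> (\<forall>x. 0 \<le> \<psi> x \<and> \<psi> x \<le> (1::real)) \<and> (\<forall>x\<in>K. \<psi> x = 1)" for n
      by (rule smooth_cutoff[OF K(1) V(1)[of n] V(2)[of n]]) blast
    then obtain \<psi> where \<psi>: "\<And>n. \<psi> n \<in> test_functions (V n)" "\<And>n x. 0 \<le> \<psi> n x" "\<And>n x. \<psi> n x \<le> (1::real)"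
      "\<And>n x. x \<in> K \<Longrightarrow> \<psi> n x = 1" by metis
    have \<psi>0: "\<psi> n x = 0" if "x \<notin> V n" for n x
      using test_functions_zero_outside(1)[OF \<psi>(1)[of n], of x] test_functionsD(3)[OF \<psi>(1)[of n]] that by blast
    have \<psi>\<Omega>: "\<psi> n \<in> test_functions \<Omega>" for n
      by (rule test_functions_mono[OF \<psi>(1)]) (use W(3) in \<open>auto simp: V_def\<close>)
    have m\<psi>: "\<psi> n \<in> borel_measurable ?M" for n
      by (rule borel_measurable_integrable[OF test_functions_integrable[OF \<psi>\<Omega> L]])
    have mind: "indicat_real K \<in> borel_measurable ?M"
      using LK K(2) by (intro borel_measurable_indicator) (simp add: sets_restrict_space_iff L)
    have "integrable (lebesgue_on K1) g" using g K1 by (simp add: locally_integrable_on_def)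
    then have "integrable lebesgue (\<lambda>x. if x \<in> K1 then g x else 0)"
      using LK1 by (simp add: Lebesgue_Measure.integrable_restrict_UNIV)
    then have dom: "integrable ?M (\<lambda>x. \<bar>if x \<in> K1 then g x else 0\<bar>)"
      using integrable_lebesgue_on_if[OF _ L] by (intro integrable_abs) blast
    have "(\<lambda>n. LINT x|?M. g x * \<psi> n x) \<longlonglongrightarrow> (LINT x|?M. g x * indicat_real K x)"
    proof (rule integral_dominated_convergence[OF _ _ dom])
      show "(\<lambda>x. g x * indicat_real K x) \<in> borel_measurable ?M" "\<And>n. (\<lambda>x. g x * \<psi> n x) \<in> borel_measurable ?M"
        using mg m\<psi> mind by (auto intro: borel_measurable_times)
      show "AE x in ?M. norm (g x * \<psi> n x) \<le> \<bar>if x \<in> K1 then g x else 0\<bar>" for n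
      proof (rule AE_I2)
        fix x
        have "\<bar>g x * \<psi> n x\<bar> \<le> \<bar>g x\<bar> * 1"
          unfolding abs_mult using \<psi>(2,3)[of n x] by (intro mult_left_mono) auto
        then show "norm (g x * \<psi> n x) \<le> \<bar>if x \<in> K1 then g x else 0\<bar>"
          using \<psi>0[of x n] WK1 by (auto simp: V_def)
      qed
      show "AE x in ?M. (\<lambda>n. g x * \<psi> n x) \<longlonglongrightarrow> g x * indicat_real K x"
      proof (rule AE_I2, rule tendsto_mult[OF tendsto_const])
        fix x
        show "(\<lambda>n. \<psi> n x) \<longlonglongrightarrow> indicat_real K x"
        proof (cases "x \<in> K")
          case False
          then have "infdist x K > 0"
            using K infdist_pos_not_in_closed compact_imp_closed by blast
          from order_tendstoD(2)[OF LIMSEQ_inverse_real_of_nat this]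
          have "\<forall>\<^sub>F n in sequentially. \<psi> n x = 0"
            by eventually_elim (rule \<psi>0, auto simp: V_def)
          then show ?thesis using False by (simp add: tendsto_eventually)
        qed (simp add: \<psi>(4))
      qed
    qed
    then have "(LINT x|?M. g x * indicat_real K x) = 0"
      by (simp add: zero[OF \<psi>\<Omega>] LIMSEQ_const_iff)
    moreover have "(LINT x|?M. g x * indicat_real K x) = (LINT x|?M. (if x \<in> K then g x else 0))"
      by (intro Bochner_Integration.integral_cong) auto
    ultimately show ?thesis using Lebesgue_Measure.integral_restrict[OF K(2) LK L, of g] by simp
  qed
  define P where "P = {x \<in> \<Omega>. g x > 0}"
  have "{x \<in> space ?M. g x > 0} \<in> sets ?M" using mg by measurable
  then have "P \<in> sets ?M" by (simp add: P_def space_restrict_space)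
  then have "P \<in> sets lebesgue" using L by (simp add: sets_restrict_space_iff)
  then obtain F N where F: "fsigma F" "negligible N" "F \<union> N = P"
    using lebesgue_set_almost_fsigma negligible_iff_null_sets by metis
  then obtain C :: "nat \<Rightarrow> 'a set" where C': "range C \<subseteq> Collect compact" "F = (\<Union>n. C n)"
    using fsigma_Union_compact[of F] by blast
  then have C: "compact (C n)" for n by blast
  have "negligible (C n)" for n
  proof (cases "C n = {}")
    case False
    have sub: "C n \<subseteq> P" using C'(2) F(3) by blast
    have LC: "C n \<in> sets lebesgue" using C[of n] by (simp add: lmeasurable_compact fmeasurableD)
    have C\<Omega>: "C n \<subseteq> \<Omega>" using sub by (auto simp: P_def)
    have "integrable (lebesgue_on (C n)) g" using g C C\<Omega> by (simp add: locally_integrable_on_def)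
    moreover have "(LINT x|lebesgue_on (C n). g x) = 0" by (rule compact[OF C C\<Omega> False])
    moreover have "AE x in lebesgue_on (C n). 0 \<le> g x"
      by (rule AE_I2) (use sub in \<open>auto simp: P_def space_restrict_space\<close>)
    ultimately have "AE x in lebesgue_on (C n). g x = 0"
      by (simp add: integral_nonneg_eq_0_iff_AE)
    then have "AE x in lebesgue. x \<in> C n \<longrightarrow> g x = 0" using LC by (simp add: AE_restrict_space_iff)
    then have "AE x in lebesgue. x \<notin> C n"
      by eventually_elim (use sub in \<open>auto simp: P_def\<close>)
    then show ?thesis using LC by (simp add: negligible_iff_null_sets AE_iff_null_sets)
  qed simp
  then have "negligible F" unfolding C'(2) by (intro negligible_countable_Union) auto
  then have "negligible P" using F(2,3) negligible_Un by metis
  then have "AE x in lebesgue. x \<notin> P" by (simp add: negligible_iff_null_sets AE_not_in)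
  then show ?thesis using L by (auto simp: AE_restrict_space_iff P_def not_less elim: eventually_mono)
qed

section \<open>Uniqueness of the weak gradient\<close>

lemma locally_integrable_on_linear:
  fixes u :: "'a::euclidean_space \<Rightarrow> 'b::euclidean_space" and l :: "'b \<Rightarrow> 'c::euclidean_space"
  assumes "bounded_linear l" "locally_integrable_on u \<Omega>"
  shows "locally_integrable_on (\<lambda>x. l (u x)) \<Omega>"
  using assms(2) integrable_bounded_linear[OF assms(1)]
    measurable_compose[OF _ borel_measurable_continuous_onI[OF linear_continuous_on[OF assms(1)]]]
  unfolding locally_integrable_on_def by blast

lemma locally_integrable_on_diff:
  fixes u v :: "'a::euclidean_space \<Rightarrow> 'b::euclidean_space"
  assumes "locally_integrable_on u \<Omega>" "locally_integrable_on v \<Omega>"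
  shows "locally_integrable_on (\<lambda>x. u x - v x) \<Omega>"
  using assms by (auto simp: locally_integrable_on_def)

lemma locally_integrable_on_mult_test:
  fixes g :: "'a::euclidean_space \<Rightarrow> real"
  assumes g: "locally_integrable_on g \<Omega>" and \<psi>: "\<psi> \<in> test_functions \<Omega>" and \<Omega>: "open \<Omega>"
  shows "integrable (lebesgue_on \<Omega>) (\<lambda>x. g x * \<psi> x)"
proof -
  have L: "\<Omega> \<in> sets lebesgue" by (rule open_sets_lebesgue[OF \<Omega>])
  let ?K = "closure {x. \<psi> x \<noteq> 0}"
  have K: "compact ?K" "?K \<subseteq> \<Omega>" by (fact test_functionsD[OF \<psi>])+
  have LK: "?K \<in> sets lebesgue" using K(1) by (simp only: lmeasurable_compact fmeasurableD)
  obtain B where B: "\<And>x. norm (\<psi> x) \<le> B"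
    using compact_support_bounded[OF test_functions_continuous[OF \<psi>] K(1) test_functions_zero_outside(1)[OF \<psi>]] by metis
  have "integrable (lebesgue_on ?K) g" using g K unfolding locally_integrable_on_def by blast
  then have "integrable lebesgue (\<lambda>x. if x \<in> ?K then g x else 0)"
    using Lebesgue_Measure.integrable_restrict_UNIV[OF LK] by blast
  then have i: "integrable (lebesgue_on \<Omega>) (\<lambda>x. B * (if x \<in> ?K then g x else 0))"
    using integrable_lebesgue_on_if[OF _ L] by (intro integrable_mult_right) blast
  show ?thesis
  proof (rule Bochner_Integration.integrable_bound[OF i])
    show "(\<lambda>x. g x * \<psi> x) \<in> borel_measurable (lebesgue_on \<Omega>)"
      using g borel_measurable_integrable[OF test_functions_integrable[OF \<psi> L]]
      by (auto simp: locally_integrable_on_def)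
    show "AE x in lebesgue_on \<Omega>. norm (g x * \<psi> x) \<le> norm (B * (if x \<in> ?K then g x else 0))"
    proof (rule AE_I2)
      fix x
      show "norm (g x * \<psi> x) \<le> norm (B * (if x \<in> ?K then g x else 0))"
      proof (cases "x \<in> ?K")
        case True
        have "\<bar>\<psi> x\<bar> \<le> \<bar>B\<bar>" using B[of x] by simp
        from mult_left_mono[OF this, of "\<bar>g x\<bar>"] show ?thesis
          unfolding if_P[OF True] real_norm_def abs_mult by (simp only: mult.commute abs_ge_zero)
      next
        case False
        then show ?thesis using test_functions_zero_outside(1)[OF \<psi> False] by (simp only: mult_zero_right norm_zero norm_ge_zero)
      qed
    qed
  qed
qed

text \<open>Membership in \<open>W1p_0\<close> supplies one weak gradient that is a limit of
  Jacobians, whereas quasiconvexity speaks of an arbitrary one; here they are identified. The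
  one-sided fundamental lemma is applied to the entries of both differences.\<close>

lemma weak_gradient_unique:
  fixes u :: "real^'n \<Rightarrow> real^'m"
  assumes \<Omega>: "open \<Omega>" and G: "has_weak_gradient u G \<Omega>" and H: "has_weak_gradient u H \<Omega>"
  shows "AE x in lebesgue_on \<Omega>. G x = H x"
proof -
  have le: "AE x in lebesgue_on \<Omega>. G x $ i $ j - H x $ i $ j \<le> 0"
    if G: "has_weak_gradient u G \<Omega>" and H: "has_weak_gradient u H \<Omega>" for G H i j
  proof (rule integral_test_functions_eq_0_imp_AE_nonpos[OF \<Omega>])
    have e: "bounded_linear (\<lambda>A::real^'n^'m. A $ i $ j)"
      by (rule bounded_linear_compose[OF bounded_linear_vec_nth bounded_linear_vec_nth])
    have lG: "locally_integrable_on (\<lambda>x. G x $ i $ j) \<Omega>" and lH: "locally_integrable_on (\<lambda>x. H x $ i $ j) \<Omega>"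
      using locally_integrable_on_linear[OF e] G H by (auto simp: has_weak_gradient_def)
    show "locally_integrable_on (\<lambda>x. G x $ i $ j - H x $ i $ j) \<Omega>"
      by (rule locally_integrable_on_diff[OF lG lH])
    fix \<psi> :: "real^'n \<Rightarrow> real" assume \<psi>: "\<psi> \<in> test_functions \<Omega>"
    have "(LINT x|lebesgue_on \<Omega>. (G x $ i $ j - H x $ i $ j) * \<psi> x)
        = (LINT x|lebesgue_on \<Omega>. G x $ i $ j * \<psi> x) - (LINT x|lebesgue_on \<Omega>. H x $ i $ j * \<psi> x)"
      using locally_integrable_on_mult_test[OF lG \<psi> \<Omega>] locally_integrable_on_mult_test[OF lH \<psi> \<Omega>]
      by (simp add: left_diff_distrib Bochner_Integration.integral_diff)
    also have "\<dots> = 0"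
    proof -
      have "(LINT x|lebesgue_on \<Omega>. G x $ i $ j * \<psi> x) = - (LINT x|lebesgue_on \<Omega>. u x $ i * frechet_derivative \<psi> (at x) (axis j 1))"
        "(LINT x|lebesgue_on \<Omega>. H x $ i $ j * \<psi> x) = - (LINT x|lebesgue_on \<Omega>. u x $ i * frechet_derivative \<psi> (at x) (axis j 1))"
        using G H \<psi> unfolding has_weak_gradient_def by simp_all
      then show ?thesis by simp
    qed
    finally show "(LINT x|lebesgue_on \<Omega>. (G x $ i $ j - H x $ i $ j) * \<psi> x) = 0" .
  qed
  have "AE x in lebesgue_on \<Omega>. \<forall>i j. G x $ i $ j - H x $ i $ j \<le> 0 \<and> H x $ i $ j - G x $ i $ j \<le> 0"
    using le[OF G H] le[OF H G] by (simp add: AE_all_countable AE_conj_iff)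
  then show ?thesis
    by eventually_elim (simp add: vec_eq_iff order.antisym)
qed

lemma ereal_integral_integrable:
  assumes "integrable M g"
  shows "ereal_integral M (\<lambda>x. ereal (g x)) = ereal (LINT x|M. g x)"
proof -
  have fin: "(\<integral>\<^sup>+ x. ennreal (g x) \<partial>M) \<noteq> \<infinity>" "(\<integral>\<^sup>+ x. ennreal (- g x) \<partial>M) \<noteq> \<infinity>"
    using assms real_integrable_def by auto
  have e: "enn2ereal a = ereal (enn2real a)" if "a \<noteq> \<infinity>" for a
    using that by (cases a) (auto simp: enn2ereal_ennreal)
  show ?thesis
    unfolding ereal_integral_def real_lebesgue_integral_def[OF assms]
    by (simp add: e2ennreal_ereal e[OF fin(1)] e[OF fin(2)])
qed

text \<open>For \<open>f\<close> itself Fatou's lemma would bound the limit from the wrong side. It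
  is applied to the nonnegative function \<open>K * (1 + norm) - f\<close>, whose first part has
  convergent integrals, and gives upper semicontinuity for \<open>f\<close>. The set \<Omega>
  obtained for the exponent \<open>p\<close> also serves for 1: the approximating test functions
  belong to both spaces.\<close>

lemma W1p_quasiconvex_at_1:
  fixes f :: "real^'n^'m \<Rightarrow> real"
  assumes p: "1 \<le> p" and cf: "continuous_on UNIV f" and c: "\<And>\<xi>. c \<le> f \<xi>"
    and K: "K \<ge> 0" "\<And>\<xi>. f \<xi> \<le> K * (1 + norm \<xi>)"
    and qc: "W1p_quasiconvex_at p (\<lambda>\<xi>. ereal (f \<xi>)) \<xi>"
  shows "W1p_quasiconvex_at 1 (\<lambda>\<xi>. ereal (f \<xi>)) \<xi>"
proof -
  obtain \<Omega> :: "(real^'n) set" where \<Omega>: "\<Omega> \<noteq> {}" "bounded \<Omega>" "open \<Omega>" "frontier \<Omega> \<in> null_sets lebesgue"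
    and test: "\<And>\<phi> :: real^'n \<Rightarrow> real^'m. \<And>G. \<phi> \<in> W1p_0 p \<Omega> \<Longrightarrow> has_weak_gradient \<phi> G \<Omega> \<Longrightarrow>
      ereal (measure lebesgue \<Omega>) * ereal (f \<xi>) \<le> ereal_integral (lebesgue_on \<Omega>) (\<lambda>x. ereal (f (\<xi> + G x)))"
    using qc unfolding W1p_quasiconvex_at_def by blast
  let ?M = "lebesgue_on \<Omega>"
  have L: "\<Omega> \<in> sets lebesgue" by (rule open_sets_lebesgue[OF \<Omega>(3)])
  interpret finite_measure ?M by (rule finite_measure_lebesgue_on[OF lmeasurable_open[OF \<Omega>(2,3)]])
  have [measurable]: "f \<in> borel_measurable borel" by (rule borel_measurable_continuous_onI[OF cf])
  have growth: "integrable ?M (\<lambda>x. K * (1 + norm (\<xi> + Y x)))" "integrable ?M (\<lambda>x. f (\<xi> + Y x))"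
    if Y: "integrable ?M Y" for Y :: "real^'n \<Rightarrow> real^'n^'m"
  proof -
    show 1: "integrable ?M (\<lambda>x. K * (1 + norm (\<xi> + Y x)))" using Y by simp
    show "integrable ?M (\<lambda>x. f (\<xi> + Y x))"
    proof (rule Bochner_Integration.integrable_bound)
      show "integrable ?M (\<lambda>x. \<bar>c\<bar> + K * (1 + norm (\<xi> + Y x)))" using 1 by simp
      show "(\<lambda>x. f (\<xi> + Y x)) \<in> borel_measurable ?M" using Y by measurable
      show "AE x in ?M. norm (f (\<xi> + Y x)) \<le> norm (\<bar>c\<bar> + K * (1 + norm (\<xi> + Y x)))"
      proof (rule AE_I2)
        fix x
        have "0 \<le> K * (1 + norm (\<xi> + Y x))" using K(1) by simp
        then show "norm (f (\<xi> + Y x)) \<le> norm (\<bar>c\<bar> + K * (1 + norm (\<xi> + Y x)))"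
          using c[of "\<xi> + Y x"] K(2)[of "\<xi> + Y x"] by (simp add: abs_le_iff) linarith
      qed
    qed
  qed
  have "ereal (measure lebesgue \<Omega>) * ereal (f \<xi>) \<le> ereal_integral ?M (\<lambda>x. ereal (f (\<xi> + G x)))"
    if \<phi>: "\<phi> \<in> W1p_0 1 \<Omega>" and G: "has_weak_gradient \<phi> G \<Omega>" for \<phi> :: "real^'n \<Rightarrow> real^'m" and G
  proof -
    obtain H \<psi> where H: "H \<in> Lp_on 1 \<Omega>" "has_weak_gradient \<phi> H \<Omega>"
      and \<psi>: "\<And>k. \<psi> k \<in> test_functions \<Omega>"
        "(\<lambda>k. W1p_norm 1 \<Omega> (\<lambda>x. \<psi> k x - \<phi> x) (\<lambda>x. jacobian (\<psi> k) (at x) - H x)) \<longlonglongrightarrow> 0"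
      using \<phi> unfolding W1p_0_def by blast
    have Lp1: "integrable ?M v" if "v \<in> Lp_on 1 \<Omega>" for v :: "real^'n \<Rightarrow> 'z::euclidean_space"
      using that by (auto simp: Lp_on_def intro: integrable_norm_cancel)
    have i\<phi>: "integrable ?M \<phi>" using Lp1 \<phi> by (auto simp: W1p_0_def W1p_def)
    have iH: "integrable ?M H" by (rule Lp1[OF H(1)])
    define J where "J k x = jacobian (\<psi> k) (at x)" for k x
    have iJ: "integrable ?M (J k)" for k unfolding J_def by (rule jacobian_integrable[OF \<psi>(1) L])
    have i\<psi>: "integrable ?M (\<psi> k)" for k by (rule test_functions_integrable[OF \<psi>(1) L])
    have GH: "AE x in ?M. H x = G x" by (rule weak_gradient_unique[OF \<Omega>(3) H(2) G])
    have mG: "G \<in> borel_measurable ?M" using G by (simp add: has_weak_gradient_def locally_integrable_on_def)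
    have iG: "integrable ?M G"
      using iH integrable_cong_AE[OF borel_measurable_integrable[OF iH] mG GH] by simp
    have JG: "(\<lambda>k. LINT x|?M. norm (J k x - G x)) \<longlonglongrightarrow> 0"
    proof (rule tendsto_sandwich[OF _ _ tendsto_const \<psi>(2)])
      show "\<forall>\<^sub>F k in sequentially. 0 \<le> (LINT x|?M. norm (J k x - G x))" by simp
      have "(LINT x|?M. norm (J k x - G x)) \<le> W1p_norm 1 \<Omega> (\<lambda>x. \<psi> k x - \<phi> x) (\<lambda>x. jacobian (\<psi> k) (at x) - H x)" for k
      proof -
        have "(LINT x|?M. norm (J k x - G x)) \<le> (LINT x|?M. norm (\<psi> k x - \<phi> x) + norm (J k x - H x))"
          by (rule integral_mono_AE) (use iJ iG i\<psi> i\<phi> iH GH in auto)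
        also have "\<dots> = W1p_norm 1 \<Omega> (\<lambda>x. \<psi> k x - \<phi> x) (\<lambda>x. jacobian (\<psi> k) (at x) - H x)"
          by (simp add: W1p_norm_def J_def)
        finally show ?thesis .
      qed
      then show "\<forall>\<^sub>F k in sequentially. (LINT x|?M. norm (J k x - G x)) \<le>
          W1p_norm 1 \<Omega> (\<lambda>x. \<psi> k x - \<phi> x) (\<lambda>x. jacobian (\<psi> k) (at x) - H x)" by simp
    qed
    \<comment> \<open>Convergence in mean gives pointwise convergence only along a subsequence,
      which is enough for Fatou's lemma.\<close>
    obtain r where r: "strict_mono r" "AE x in ?M. (\<lambda>k. J (r k) x - G x) \<longlonglongrightarrow> 0"
      using tendsto_L1_AE_subseq[of ?M "\<lambda>k x. J k x - G x"] iJ iG JG by auto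
    define b where "b Y = (LINT x|?M. K * (1 + norm (\<xi> + Y x)))" for Y :: "real^'n \<Rightarrow> real^'n^'m"
    define h where "h Y x = K * (1 + norm (\<xi> + Y x)) - f (\<xi> + Y x)" for Y :: "real^'n \<Rightarrow> real^'n^'m" and x
    have h0: "h Y x \<ge> 0" for Y x using K(2)[of "\<xi> + Y x"] by (simp add: h_def)
    have ih: "integrable ?M (h Y)" "(LINT x|?M. h Y x) = b Y - (LINT x|?M. f (\<xi> + Y x))" if "integrable ?M Y" for Y
      unfolding h_def b_def using growth[OF that] by simp_all
    have low: "measure lebesgue \<Omega> * f \<xi> \<le> (LINT x|?M. f (\<xi> + J k x))" for k
    proof -
      have "\<psi> k \<in> W1p_0 p \<Omega>" using test_functions_subset_W1p_0[OF \<psi>(1) \<Omega>(3)] p by simp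
      from test[OF this test_functions_weak_gradient[OF \<psi>(1) \<Omega>(3)]] show ?thesis
        using ereal_integral_integrable[OF growth(2)[OF iJ[of k]]] by (simp add: J_def)
    qed
    \<comment> \<open>Convergence of the gradients in mean enters here: the integral of the linear
      majorant is Lipschitz with constant \<open>K\<close> in that sense.\<close>
    have bJ: "(\<lambda>k. b (J k)) \<longlonglongrightarrow> b G"
    proof (rule Lim_null[THEN iffD2], rule Lim_null_comparison)
      show "(\<lambda>k. K * (LINT x|?M. norm (J k x - G x))) \<longlonglongrightarrow> 0"
        using tendsto_mult[OF tendsto_const JG, of K] by simp
      have "norm (b (J k) - b G) \<le> K * (LINT x|?M. norm (J k x - G x))" for k
      proof -
        have "b (J k) - b G = (LINT x|?M. K * (1 + norm (\<xi> + J k x)) - K * (1 + norm (\<xi> + G x)))"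
          unfolding b_def by (rule Bochner_Integration.integral_diff[symmetric]) (use growth(1) iJ iG in auto)
        also have "norm \<dots> \<le> (LINT x|?M. norm (K * (1 + norm (\<xi> + J k x)) - K * (1 + norm (\<xi> + G x))))"
          by (rule integral_norm_bound)
        also have "\<dots> \<le> (LINT x|?M. K * norm (J k x - G x))"
        proof (rule integral_mono)
          show "integrable ?M (\<lambda>x. norm (K * (1 + norm (\<xi> + J k x)) - K * (1 + norm (\<xi> + G x))))"
            using growth(1)[OF iJ[of k]] growth(1)[OF iG] by (intro integrable_norm Bochner_Integration.integrable_diff)
          show "integrable ?M (\<lambda>x. K * norm (J k x - G x))" using iJ[of k] iG by simp
          show "norm (K * (1 + norm (\<xi> + J k x)) - K * (1 + norm (\<xi> + G x))) \<le> K * norm (J k x - G x)" for x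
          proof -
            have "\<bar>norm (\<xi> + J k x) - norm (\<xi> + G x)\<bar> \<le> norm (J k x - G x)"
              using norm_triangle_ineq3[of "\<xi> + J k x" "\<xi> + G x"] by simp
            from mult_left_mono[OF this K(1)] show ?thesis
              using K(1) by (simp add: right_diff_distrib[symmetric] abs_mult)
          qed
        qed
        finally show ?thesis by simp
      qed
      then show "\<forall>\<^sub>F k in sequentially. norm (b (J k) - b G) \<le> K * (LINT x|?M. norm (J k x - G x))" by simp
    qed
    have R: "(\<lambda>k. b (J (r k)) - measure lebesgue \<Omega> * f \<xi>) \<longlonglongrightarrow> b G - measure lebesgue \<Omega> * f \<xi>"
      using LIMSEQ_subseq_LIMSEQ[OF bJ r(1)] by (intro tendsto_diff tendsto_const) (simp add: o_def)
    have hk: "(\<integral>\<^sup>+ x. ennreal (h (J k) x) \<partial>?M) \<le> ennreal (b (J k) - measure lebesgue \<Omega> * f \<xi>)"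
      "0 \<le> b (J k) - measure lebesgue \<Omega> * f \<xi>" for k
    proof -
      have eq: "(\<integral>\<^sup>+ x. ennreal (h (J k) x) \<partial>?M) = ennreal (LINT x|?M. h (J k) x)"
        by (rule nn_integral_eq_integral[OF ih(1)[OF iJ]]) (simp add: h0)
      have le: "(LINT x|?M. h (J k) x) \<le> b (J k) - measure lebesgue \<Omega> * f \<xi>"
        using low[of k] by (simp add: ih(2)[OF iJ])
      show "(\<integral>\<^sup>+ x. ennreal (h (J k) x) \<partial>?M) \<le> ennreal (b (J k) - measure lebesgue \<Omega> * f \<xi>)"
        unfolding eq using le by (rule ennreal_leI)
      have "0 \<le> (LINT x|?M. h (J k) x)" by (rule Bochner_Integration.integral_nonneg) (simp add: h0)
      then show "0 \<le> b (J k) - measure lebesgue \<Omega> * f \<xi>" using le by linarith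
    qed
    have "ennreal (LINT x|?M. h G x) = (\<integral>\<^sup>+ x. ennreal (h G x) \<partial>?M)"
      by (rule nn_integral_eq_integral[OF ih(1)[OF iG], symmetric]) (simp add: h0)
    also have "\<dots> = (\<integral>\<^sup>+ x. liminf (\<lambda>k. ennreal (h (J (r k)) x)) \<partial>?M)"
    proof (rule nn_integral_cong_AE)
      show "AE x in ?M. ennreal (h G x) = liminf (\<lambda>k. ennreal (h (J (r k)) x))"
        using r(2)
      proof eventually_elim
        case (elim x)
        then have lim: "(\<lambda>k. \<xi> + J (r k) x) \<longlonglongrightarrow> \<xi> + G x"
          by (intro tendsto_add tendsto_const) (rule LIM_zero_cancel)
        have "(\<lambda>k. f (\<xi> + J (r k) x)) \<longlonglongrightarrow> f (\<xi> + G x)"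
          by (rule isCont_tendsto_compose[OF _ lim]) (use cf in \<open>simp add: continuous_on_eq_continuous_at\<close>)
        then have "(\<lambda>k. h (J (r k)) x) \<longlonglongrightarrow> h G x"
          unfolding h_def by (intro tendsto_intros lim)
        then have "(\<lambda>k. ennreal (h (J (r k)) x)) \<longlonglongrightarrow> ennreal (h G x)" by (rule tendsto_ennrealI)
        from lim_imp_Liminf[OF _ this] show ?case by simp
      qed
    qed
    also have "\<dots> \<le> liminf (\<lambda>k. \<integral>\<^sup>+ x. ennreal (h (J (r k)) x) \<partial>?M)"
      by (rule nn_integral_liminf) (use borel_measurable_integrable[OF ih(1)[OF iJ]] in measurable)
    also have "\<dots> \<le> liminf (\<lambda>k. ennreal (b (J (r k)) - measure lebesgue \<Omega> * f \<xi>))"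
      by (rule Liminf_mono) (simp add: hk)
    also have "\<dots> = ennreal (b G - measure lebesgue \<Omega> * f \<xi>)"
      by (rule lim_imp_Liminf[OF _ tendsto_ennrealI[OF R]]) simp
    finally have "ennreal (LINT x|?M. h G x) \<le> ennreal (b G - measure lebesgue \<Omega> * f \<xi>)" .
    \<comment> \<open>\<open>ennreal\<close> truncates at 0, so the inequality between reals is
      recovered from the nonnegativity of its right-hand side.\<close>
    moreover have "0 \<le> b G - measure lebesgue \<Omega> * f \<xi>"
      by (rule LIMSEQ_le_const[OF R]) (use hk(2) in auto)
    ultimately have "(LINT x|?M. h G x) \<le> b G - measure lebesgue \<Omega> * f \<xi>"
      by (simp add: ennreal_le_iff)
    then have "measure lebesgue \<Omega> * f \<xi> \<le> (LINT x|?M. f (\<xi> + G x))" using ih(2)[OF iG] by simp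
    then show ?thesis by (simp add: ereal_integral_integrable[OF growth(2)[OF iG]])
  qed
  then show ?thesis unfolding W1p_quasiconvex_at_def using \<Omega> by blast
qed

theorem theorem1p3:
  fixes f :: "real^'n^'m \<Rightarrow> real"
    and \<nu> :: "real^'n^'m \<Rightarrow> real"
    and p L :: real
  assumes "CARD('n) \<ge> 2" and "CARD('m) \<ge> 2"
    and "is_norm \<nu>"
    and "1 \<le> p" and "p < 2"
    and "continuous_on UNIV f"
    and "bdd_below (range f)"
    and "W1p_quasiconvex p (\<lambda>\<xi>. ereal (f \<xi>))"
    and "L > 0"
    and "\<forall>\<xi>. rank \<xi> \<le> 1 \<longrightarrow> f \<xi> \<le> L * (1 + \<nu> \<xi>)"
  shows "(\<exists>L'>0. \<forall>\<xi>. f \<xi> \<le> L' * (1 + \<nu> \<xi>)) \<and>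
         W1p_quasiconvex 1 (\<lambda>\<xi>. ereal (f \<xi>))"
proof -
  obtain A B where AB: "A > 0" "B > 0" "\<And>\<xi>. \<nu> \<xi> \<le> A * norm \<xi>" "\<And>\<xi>. norm \<xi> \<le> B * \<nu> \<xi>"
    by (rule is_norm_equivalent[OF assms(3)]) blast
  have qc: "W1p_quasiconvex_at p (\<lambda>\<xi>. ereal (f \<xi>)) \<xi>" for \<xi>
    using assms(8) by (simp add: W1p_quasiconvex_def)
  have rank1: "f \<xi> \<le> (L * (1 + A)) * (1 + norm \<xi>)" if "rank \<xi> \<le> 1" for \<xi>
  proof -
    have "(1 + A) * (1 + norm \<xi>) = 1 + A + norm \<xi> + A * norm \<xi>" by (simp add: algebra_simps)
    then have "1 + \<nu> \<xi> \<le> (1 + A) * (1 + norm \<xi>)" using AB(1) AB(3)[of \<xi>] norm_ge_zero[of \<xi>] by linarith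
    then have "L * (1 + \<nu> \<xi>) \<le> L * ((1 + A) * (1 + norm \<xi>))" using assms(9) by (intro mult_left_mono) auto
    moreover have "f \<xi> \<le> L * (1 + \<nu> \<xi>)" using assms(10) that by blast
    ultimately show ?thesis by (simp only: mult.assoc)
  qed
  obtain K where K: "K \<ge> 0" "\<And>\<xi>. f \<xi> \<le> K * (1 + norm \<xi>)"
    using quasiconvex_linear_growth[OF assms(4,5,6) qc _ rank1] assms(9) AB(1) by auto
  \<comment> \<open>\<open>K + 1\<close> because \<open>K\<close> may be 0, while the constant has
    to be positive.\<close>
  have "f \<xi> \<le> ((K + 1) * (1 + B)) * (1 + \<nu> \<xi>)" for \<xi>
  proof -
    have \<nu>0: "\<nu> \<xi> \<ge> 0" using assms(3) by (simp add: is_norm_def)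
    have "(1 + B) * (1 + \<nu> \<xi>) = 1 + B + \<nu> \<xi> + B * \<nu> \<xi>" by (simp add: algebra_simps)
    then have "1 + norm \<xi> \<le> (1 + B) * (1 + \<nu> \<xi>)" using AB(2) AB(4)[of \<xi>] \<nu>0 by linarith
    then have "(K + 1) * (1 + norm \<xi>) \<le> (K + 1) * ((1 + B) * (1 + \<nu> \<xi>))" using K(1) by (intro mult_left_mono) auto
    moreover have "K * (1 + norm \<xi>) \<le> (K + 1) * (1 + norm \<xi>)" by (intro mult_right_mono) auto
    ultimately show ?thesis using K(2)[of \<xi>] by (simp only: mult.assoc)
  qed
  moreover have "(K + 1) * (1 + B) > 0" using K(1) AB(2) by simp
  moreover have "W1p_quasiconvex 1 (\<lambda>\<xi>. ereal (f \<xi>))"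
  proof -
    obtain c where c: "\<And>\<xi>. c \<le> f \<xi>" using assms(7) by (auto simp: bdd_below_def)
    show ?thesis
      using W1p_quasiconvex_at_1[OF assms(4,6) c K qc] assms(8) by (simp add: W1p_quasiconvex_def)
  qed
  ultimately show ?thesis by blast
qed

end
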